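(* Let $d, K$ be integers with $d \geq 2$ and $K \geq 2$. Then $$\max\left\{ \rho_v\left( \mathbb{C}^{d} \otimes \mathbb{C}^{d} \right),\ \rho_w\left( \mathbb{C}^{d} \otimes \mathbb{C}^{d} \right) \right\} \leq \frac{10}{\sqrt{d}},$$ $$\max\left\{ \rho_v\left( (\mathbb{C}^{2})^{\otimes K} \right),\ \rho_w\left( (\mathbb{C}^{2})^{\otimes K} \right)\right\} \leq \sqrt{48 e}\, \frac{\sqrt{ K \log K }}{2^{K/2}},$$ where $e$ is Euler's number, $\log$ is the natural logarithm, and for a multiway Hilbert space $\mathcal{H}$ $$\rho_v(\mathcal{H}) = \frac{\mathrm{vr}(\mathcal{S}^{\mathrm{sep}}_+(\mathcal{H}))}{\mathrm{vr}(\mathcal{S}^{\mathrm{sa}}_+(\mathcal{H}))},\qquad \rho_w(\mathcal{H}) = \frac{w(\mathcal{S}^{\mathrm{sep}}_+(\mathcal{H}))}{w(\mathcal{S}^{\mathrm{sa}}_+(\mathcal{H}))}$$ are the ratios of volume radii and of mean widths of the unit-trace Kronecker-separable operators and of all unit-trace positive semidefinite operators on $\mathcal{H}$.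
   Context: Let $\mathcal{H} = \bigotimes_{k=1}^M \mathcal{H}_k$ be a tensor product of finite-dimensional complex Hilbert spaces (for $\mathbb{C}^d\otimes\mathbb{C}^d$ there are $M=2$ factors $\mathbb{C}^d$; for $(\mathbb{C}^2)^{\otimes K}$ there are $M=K$ factors $\mathbb{C}^2$). Let $\mathcal{B}^{\mathrm{sa}}(\mathcal{H})$ be the real vector space of self-adjoint operators on $\mathcal{H}$, with the Hilbert–Schmidt inner product, and $\mathcal{B}^{\mathrm{sa}}_+(\mathcal{H})$ the cone of positive semidefinite (PSD) operators in it. An operator $\Sigma \in \mathcal{B}^{\mathrm{sa}}_+(\mathcal{H})$ is Kronecker-separable if there are an integer $r\ge 1$ and operators $\Sigma^{(k)}_a \in \mathcal{B}^{\mathrm{sa}}_+(\mathcal{H}_k)$ ($1\le k\le M$, $1\le a\le r$) with $\Sigma = \sum_{a=1}^r \Sigma^{(1)}_a \otimes \cdots \otimes \Sigma^{(M)}_a$. Let $\mathcal{B}^{\mathrm{sep}}_+(\mathcal{H})$ be the set of Kronecker-separable operators, $\mathcal{T}_1 = \{\Sigma \in \mathcal{B}^{\mathrm{sa}}(\mathcal{H}) : \mathrm{tr}\,\Sigma = 1\}$, $\mathcal{S}^{\mathrm{sa}}_+(\mathcal{H}) = \mathcal{B}^{\mathrm{sa}}_+(\mathcal{H}) \cap \mathcal{T}_1$ and $\mathcal{S}^{\mathrm{sep}}_+(\mathcal{H}) = \mathcal{B}^{\mathrm{sep}}_+(\mathcal{H}) \cap \mathcal{T}_1$. For a nonempty bounded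 Lebesgue measurable $\mathcal{S} \subset \mathbb{R}^m$, the volume radius is $\mathrm{vr}(\mathcal{S}) = (\mathrm{vol}(\mathcal{S})/\mathrm{vol}(\mathbb{B}^m_2))^{1/m}$, where $\mathbb{B}^m_2$ is the unit Euclidean ball and $\mathrm{vol}$ is $m$-dimensional Lebesgue measure. For a nonempty bounded $\mathcal{S}\subset\mathbb{R}^m$, the mean width is $w(\mathcal{S}) = \int_{\mathbb{S}^{m-1}} \sup_{x \in \mathcal{S}} \langle u, x\rangle\, d\mu(u)$, where $\mu$ is the rotation-invariant (Haar) probability measure on the unit sphere $\mathbb{S}^{m-1}$. Both quantities are invariant under translations and rotations. They are applied to subsets of $\mathcal{T}_1$ by identifying the affine space $\mathcal{T}_1$, with the metric induced by the Hilbert–Schmidt norm, isometrically with $\mathbb{R}^m$, $m = (\dim_{\mathbb{C}}\mathcal{H})^2-1$. *)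

theory Defs
  imports "HOL-Probability.Probability"
begin

section \<open>Volume radius and mean width in Euclidean space\<close>

definition vol_radius :: "(real^'m) set \<Rightarrow> real" where
  "vol_radius S = (measure lebesgue S / measure lebesgue (ball (0 :: real^'m) 1)) powr (1 / real CARD('m))"

text \<open>A measure on the unit sphere is represented by a Borel measure on the ambient space that is
  concentrated on the sphere.\<close>

definition rotation_invariant_on_sphere :: "(real^'m) measure \<Rightarrow> bool" where
  "rotation_invariant_on_sphere \<mu> \<longleftrightarrow>
     sets \<mu> = sets borel \<and> prob_space \<mu> \<and> emeasure \<mu> (sphere 0 1) = 1 \<and>
     (\<forall>f. orthogonal_transformation f \<longrightarrow> distr \<mu> borel f = \<mu>)"

definition sphere_measure :: "(real^'m) measure" where
  "sphere_measure = (THE \<mu>. rotation_invariant_on_sphere \<mu>)"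

definition mean_width :: "(real^'m) set \<Rightarrow> real" where
  "mean_width S = (LINT u|sphere_measure. (SUP x\<in>S. u \<bullet> x))"


section \<open>Operators on a finite-dimensional complex Hilbert space\<close>

text \<open>An operator is given by its matrix in an orthonormal basis. The real inner product that the
  library provides on matrices is \<open>Re (tr (A\<^sup>* B))\<close>, hence the Hilbert--Schmidt
  inner product on self-adjoint matrices (see \<open>self_adjoint_inner\<close> below).\<close>

definition self_adjoint :: "complex^'n^'n \<Rightarrow> bool" where
  "self_adjoint A \<longleftrightarrow> (\<forall>i j. A $ i $ j = cnj (A $ j $ i))"

definition psd :: "complex^'n^'n \<Rightarrow> bool" where
  "psd A \<longleftrightarrow> self_adjoint A \<and>
     (\<forall>x :: complex^'n. 0 \<le> Re (\<Sum>i\<in>UNIV. cnj (x $ i) * (A *v x) $ i))"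

definition unit_trace :: "(complex^'n^'n) set" where
  "unit_trace = {A. self_adjoint A \<and> trace A = 1}"

definition psd_states :: "(complex^'n^'n) set" where
  "psd_states = {A. psd A} \<inter> unit_trace"


section \<open>Kronecker-separable operators\<close>

text \<open>The \<open>CARD('k)\<close>-fold tensor power of \<open>complex^'d\<close>: the coordinate at
  \<open>i :: 'k \<Rightarrow> 'd\<close> belongs to the product basis vector \<open>\<Otimes>\<^sub>k e\<^bsub>i k\<^esub>\<close>.\<close>

type_synonym ('d, 'k) tensor_power = "complex^('k \<Rightarrow> 'd)"
type_synonym ('d, 'k) tensor_op = "complex^('k \<Rightarrow> 'd)^('k \<Rightarrow> 'd)"

definition kronecker :: "('k \<Rightarrow> complex^'d^'d) \<Rightarrow> ('d::finite, 'k::finite) tensor_op" where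
  "kronecker X = (\<chi> i j. \<Prod>k\<in>UNIV. X k $ i k $ j k)"

definition kronecker_separable :: "('d::finite, 'k::finite) tensor_op \<Rightarrow> bool" where
  "kronecker_separable A \<longleftrightarrow> psd A \<and>
     (\<exists>r\<ge>1. \<exists>X :: nat \<Rightarrow> 'k \<Rightarrow> complex^'d^'d.
        (\<forall>a\<in>{1..r}. \<forall>k. psd (X a k)) \<and> A = (\<Sum>a=1..r. kronecker (X a)))"

definition separable_states :: "('d::finite, 'k::finite) tensor_op set" where
  "separable_states = {A. kronecker_separable A} \<inter> unit_trace"


section \<open>Identification of the unit-trace operators with a Euclidean space\<close>

text \<open>An index type with \<open>CARD('n)\<^sup>2 - 1\<close> elements. The maximum only serves to make the type
  nonempty when \<open>CARD('n) = 1\<close>.\<close>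

typedef ('n :: finite) coord = "{..<max 1 (CARD('n)\<^sup>2 - 1)}"
  by (rule exI[of _ 0]) simp

instance coord :: (finite) finite
proof
  have "finite (Rep_coord ` (UNIV :: 'a coord set))"
    by (rule finite_subset[of _ "{..<max 1 (CARD('a)\<^sup>2 - 1)}"]) (use Rep_coord in auto)
  then show "finite (UNIV :: 'a coord set)"
    by (rule finite_imageD) (simp add: inj_on_def Rep_coord_inject)
qed

lemma card_coord: "CARD('n coord) = CARD('n::finite)\<^sup>2 - 1" if "CARD('n) \<ge> 2"
proof -
  have "CARD('n)\<^sup>2 \<ge> 2\<^sup>2" using that by (rule power_mono) simp
  then show ?thesis
    using type_definition.card[OF type_definition_coord[where 'n='n]] by simp
qed

text \<open>The change of variables results of the library require a well-ordered index type.\<close>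

instantiation coord :: (finite) linorder
begin
definition "x \<le> y \<longleftrightarrow> Rep_coord x \<le> Rep_coord y"
definition "x < y \<longleftrightarrow> Rep_coord x < Rep_coord y"
instance by standard (auto simp: less_eq_coord_def less_coord_def Rep_coord_inject)
end

instance coord :: (finite) wellorder
proof
  fix P :: "'a coord \<Rightarrow> bool" and a
  assume step: "\<And>x. (\<And>y. y < x \<Longrightarrow> P y) \<Longrightarrow> P x"
  show "P a"
  proof (induction a rule: measure_induct_rule[of Rep_coord])
    case (less x)
    show ?case by (rule step) (rule less, simp only: less_coord_def)
  qed
qed

text \<open>The choice of the isometry is immaterial, since the volume radius and the mean width are
  invariant under isometries of \<open>real^'m\<close>; it exists by \<open>trace_chart_exists\<close>
  below.\<close>

definition trace_chart :: "real^('n coord) \<Rightarrow> complex^('n::finite)^'n" where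
  "trace_chart = (SOME \<phi>. (\<forall>x y. dist (\<phi> x) (\<phi> y) = dist x y) \<and> range \<phi> = unit_trace)"

definition rho_v :: "('d::finite, 'k::finite) tensor_power itself \<Rightarrow> real" where
  "rho_v _ = vol_radius (trace_chart -` (separable_states :: ('d, 'k) tensor_op set)) /
             vol_radius (trace_chart -` (psd_states :: ('d, 'k) tensor_op set))"

definition rho_w :: "('d::finite, 'k::finite) tensor_power itself \<Rightarrow> real" where
  "rho_w _ = mean_width (trace_chart -` (separable_states :: ('d, 'k) tensor_op set)) /
             mean_width (trace_chart -` (psd_states :: ('d, 'k) tensor_op set))"


section \<open>Well-definedness\<close>

subsection \<open>The rotation-invariant probability measure exists and is unique\<close>

lemma rotation_invariant_on_sphere_exists:
  "\<exists>\<mu> :: (real^'m::{finite,wellorder}) measure. rotation_invariant_on_sphere \<mu>"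
proof -
  define B where "B = ball (0 :: (real, 'm) vec) 1"
  define g where "g = (\<lambda>x :: (real, 'm) vec. x /\<^sub>R norm x)"
  define U where "U = uniform_measure lborel B"
  define \<sigma> where "\<sigma> = distr U borel g"
  have g [measurable]: "g \<in> borel_measurable borel" unfolding g_def by measurable
  have B [measurable]: "B \<in> sets borel" by (simp add: B_def)
  have Bpos: "emeasure lborel B \<noteq> 0"
    using emeasure_ball[of 1 "0::(real, 'm) vec"]
    by (simp add: B_def unit_ball_vol_pos unit_ball_vol_nonneg less_imp_neq[symmetric])
  have Bfin: "emeasure lborel B < \<infinity>"
    using emeasure_lborel_ball_finite[of "0 :: (real, 'm) vec" 1] by (simp add: B_def)
  have setsU [measurable_cong]: "sets U = sets borel" by (simp add: U_def)
  interpret U: prob_space U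
    unfolding U_def by (rule prob_space_uniform_measure) (use Bpos Bfin in auto)
  interpret S: prob_space \<sigma>
    unfolding \<sigma>_def by (rule U.prob_space_distr) measurable
  have sphere: "emeasure \<sigma> (sphere 0 1) = 1"
  proof (rule S.emeasure_eq_1_AE)
    show "sphere 0 1 \<in> sets \<sigma>" by (simp add: \<sigma>_def)
    have "AE x in lborel. x \<noteq> (0 :: (real, 'm) vec)" by (rule AE_lborel_singleton)
    then have "AE x in U. g x \<in> sphere 0 1"
      unfolding U_def by (intro AE_uniform_measureI) (auto simp: g_def)
    then show "AE x in \<sigma>. x \<in> sphere 0 1"
      unfolding \<sigma>_def by (subst AE_distr_iff) (auto intro: closed_sphere)
  qed
  have inv: "distr \<sigma> borel f = \<sigma>" if f: "orthogonal_transformation f" for f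
  proof (rule measure_eqI)
    have f_meas [measurable]: "f \<in> borel_measurable borel"
      using orthogonal_transformation_linear[OF f]
      by (simp add: borel_measurable_continuous_onI linear_continuous_on linear_conv_bounded_linear)
    show "sets (distr \<sigma> borel f) = sets \<sigma>" by (simp add: \<sigma>_def)
    fix A assume "A \<in> sets (distr \<sigma> borel f)"
    then have A [measurable]: "A \<in> sets borel" by simp
    define C where "C = B \<inter> g -` A"
    define D where "D = B \<inter> g -` (f -` A)"
    have meas [measurable]: "g -` A \<in> sets borel" "g -` (f -` A) \<in> sets borel"
      using measurable_sets_borel[OF g A]
        measurable_sets_borel[OF g measurable_sets_borel[OF f_meas A]] by auto
    have gf: "g (f x) = f (g x)" for x
      by (simp add: g_def orthogonal_transformation_norm[OF f] orthogonal_transformation_scaleR[OF f])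
    have fB: "f x \<in> B \<longleftrightarrow> x \<in> B" for x
      by (simp add: B_def orthogonal_transformation_norm[OF f])
    have img: "f ` D = C"
    proof
      show "f ` D \<subseteq> C" by (auto simp: C_def D_def gf fB)
      show "C \<subseteq> f ` D"
      proof
        fix y assume y: "y \<in> C"
        obtain x where x: "y = f x" using orthogonal_transformation_surj[OF f] by (metis surjD)
        show "y \<in> f ` D" using y by (auto simp: x C_def D_def gf fB)
      qed
    qed
    have lm: "C \<in> lmeasurable" "D \<in> lmeasurable"
      by (auto simp: C_def D_def B_def intro!: fmeasurable_Int_fmeasurable lmeasurable_ball
          sets_completionI_sets meas)
    have "measure lebesgue C = measure lebesgue D"
      using measure_orthogonal_image[OF f lm(2)] img by simp
    then have "emeasure lebesgue C = emeasure lebesgue D"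
      using lm by (simp add: emeasure_eq_measure2)
    moreover have "C \<in> sets borel" "D \<in> sets borel" by (auto simp: C_def D_def)
    ultimately have CD: "emeasure lborel C = emeasure lborel D"
      by simp
    have "emeasure (distr \<sigma> borel f) A = emeasure U (g -` (f -` A))"
      by (simp add: \<sigma>_def emeasure_distr distr_distr vimage_comp U_def)
    also have "\<dots> = emeasure U (g -` A)"
      using CD by (simp add: U_def C_def D_def)
    also have "\<dots> = emeasure \<sigma> A"
      by (simp add: \<sigma>_def emeasure_distr U_def)
    finally show "emeasure (distr \<sigma> borel f) A = emeasure \<sigma> A" .
  qed
  have "rotation_invariant_on_sphere \<sigma>"
    unfolding rotation_invariant_on_sphere_def using sphere inv S.prob_space_axioms
    by (simp add: \<sigma>_def)
  then show ?thesis ..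
qed

lemma rotation_invariant_on_sphere_emeasure_ball:
  fixes \<mu> :: "(real^'m) measure"
  assumes \<mu>: "rotation_invariant_on_sphere \<mu>" and xy: "norm x = 1" "norm y = 1"
  shows "emeasure \<mu> (ball x r) = emeasure \<mu> (ball y r)"
proof -
  obtain f where f: "orthogonal_transformation f" "f x = y"
    using orthogonal_transformation_exists[of x y] xy by auto
  have [measurable]: "f \<in> borel_measurable borel"
    using orthogonal_transformation_linear[OF f(1)]
    by (simp add: borel_measurable_continuous_onI linear_continuous_on linear_conv_bounded_linear)
  have sets [measurable_cong]: "sets \<mu> = sets borel"
    and inv: "distr \<mu> borel f = \<mu>"
    using \<mu> f(1) by (auto simp: rotation_invariant_on_sphere_def)
  have "f -` ball y r = ball x r"
    using f by (auto simp: orthogonal_transformation_isometry mem_ball)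
  then have "emeasure (distr \<mu> borel f) (ball y r) = emeasure \<mu> (ball x r)"
    using sets_eq_imp_space_eq[OF sets] by (subst emeasure_distr) auto
  then show ?thesis by (simp add: inv)
qed

lemma rotation_invariant_on_sphere_emeasure_ball_pos:
  fixes \<mu> :: "(real^'m) measure"
  assumes \<mu>: "rotation_invariant_on_sphere \<mu>" and x: "norm x = 1" and r: "r > 0"
  shows "emeasure \<mu> (ball x r) > 0"
proof (rule ccontr)
  assume "\<not> ?thesis"
  then have zero: "emeasure \<mu> (ball x r) = 0" by simp
  have sets: "sets \<mu> = sets borel" using \<mu> by (simp add: rotation_invariant_on_sphere_def)
  have "compact (sphere (0 :: real^'m) 1)" by simp
  then obtain Y :: "(real^'m) set" where Y: "finite Y" "Y \<subseteq> sphere 0 1" "sphere 0 1 \<subseteq> (\<Union>y\<in>Y. ball y r)"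
    by (rule compactE_image[where C="sphere 0 1" and f="\<lambda>y. ball y r"]) (use r in auto)
  have "emeasure \<mu> (sphere 0 1) \<le> emeasure \<mu> (\<Union>y\<in>Y. ball y r)"
    using Y by (intro emeasure_mono) (auto simp: sets)
  also have "\<dots> \<le> (\<Sum>y\<in>Y. emeasure \<mu> (ball y r))"
    using Y by (intro emeasure_subadditive_finite) (auto simp: sets)
  also have "\<dots> = 0"
    using Y zero rotation_invariant_on_sphere_emeasure_ball[OF \<mu> _ x]
    by (intro sum.neutral) auto
  finally show False using \<mu> by (simp add: rotation_invariant_on_sphere_def)
qed

lemma rotation_invariant_on_sphere_AE:
  assumes "rotation_invariant_on_sphere \<mu>"
  shows "AE x in \<mu>. norm x = 1"
proof -
  interpret prob_space \<mu> using assms by (simp add: rotation_invariant_on_sphere_def)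
  have "AE x in \<mu>. x \<in> sphere 0 1"
    using assms by (subst AE_in_set_eq_1)
      (auto simp: rotation_invariant_on_sphere_def measure_def)
  then show ?thesis by simp
qed

lemma rotation_invariant_on_sphere_Fubini:
  fixes \<mu> \<nu> :: "(real^'m) measure"
  assumes \<mu>: "rotation_invariant_on_sphere \<mu>" and \<nu>: "rotation_invariant_on_sphere \<nu>"
    and e: "norm e = 1" and U: "open U"
  shows "(\<integral>\<^sup>+x. emeasure \<nu> (U \<inter> ball x r) \<partial>\<mu>) = emeasure \<mu> (ball e r) * emeasure \<nu> U"
proof -
  have sets [measurable_cong]: "sets \<mu> = sets borel" "sets \<nu> = sets borel"
    using \<mu> \<nu> by (auto simp: rotation_invariant_on_sphere_def)
  interpret M: prob_space \<mu> using \<mu> by (simp add: rotation_invariant_on_sphere_def)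
  interpret N: prob_space \<nu> using \<nu> by (simp add: rotation_invariant_on_sphere_def)
  interpret pair_sigma_finite \<mu> \<nu> ..
  have [measurable]: "U \<in> sets borel" using U by simp
  define f :: "real^'m \<Rightarrow> real^'m \<Rightarrow> ennreal"
    where "f = (\<lambda>x y. indicator U y * indicator {..<r} (dist x y))"
  have f [measurable]: "case_prod f \<in> borel_measurable (\<mu> \<Otimes>\<^sub>M \<nu>)"
    unfolding f_def by measurable
  have "(\<integral>\<^sup>+x. emeasure \<nu> (U \<inter> ball x r) \<partial>\<mu>) = (\<integral>\<^sup>+x. (\<integral>\<^sup>+y. f x y \<partial>\<nu>) \<partial>\<mu>)"
  proof (rule nn_integral_cong)
    fix x
    have "(\<integral>\<^sup>+y. f x y \<partial>\<nu>) = (\<integral>\<^sup>+y. indicator (U \<inter> ball x r) y \<partial>\<nu>)"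
      by (intro nn_integral_cong) (auto simp: f_def split: split_indicator)
    then show "emeasure \<nu> (U \<inter> ball x r) = (\<integral>\<^sup>+y. f x y \<partial>\<nu>)"
      using sets by simp
  qed
  also have "\<dots> = (\<integral>\<^sup>+y. (\<integral>\<^sup>+x. f x y \<partial>\<mu>) \<partial>\<nu>)"
    by (rule Fubini'[symmetric]) (rule f)
  also have "\<dots> = (\<integral>\<^sup>+y. emeasure \<mu> (ball e r) * indicator U y \<partial>\<nu>)"
  proof (rule nn_integral_cong_AE)
    show "AE y in \<nu>. (\<integral>\<^sup>+x. f x y \<partial>\<mu>) = emeasure \<mu> (ball e r) * indicator U y"
      using rotation_invariant_on_sphere_AE[OF \<nu>]
    proof eventually_elim
      fix y :: "real^'m" assume y: "norm y = 1"
      have "(\<integral>\<^sup>+x. f x y \<partial>\<mu>) = (\<integral>\<^sup>+x. indicator U y * indicator (ball y r) x \<partial>\<mu>)"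
        by (intro nn_integral_cong) (auto simp: f_def dist_commute split: split_indicator)
      also have "\<dots> = indicator U y * emeasure \<mu> (ball y r)"
        using sets by (subst nn_integral_cmult_indicator) auto
      finally show "(\<integral>\<^sup>+x. f x y \<partial>\<mu>) = emeasure \<mu> (ball e r) * indicator U y"
        using rotation_invariant_on_sphere_emeasure_ball[OF \<mu> y e] by (simp add: mult.commute)
    qed
  qed
  also have "\<dots> = emeasure \<mu> (ball e r) * emeasure \<nu> U"
    using sets by (subst nn_integral_cmult_indicator) auto
  finally show ?thesis .
qed

lemma rotation_invariant_on_sphere_open_le:
  fixes \<mu> \<nu> :: "(real^'m) measure"
  assumes \<mu>: "rotation_invariant_on_sphere \<mu>" and \<nu>: "rotation_invariant_on_sphere \<nu>"
    and U: "open U"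
  shows "emeasure \<mu> U \<le> emeasure \<nu> U"
proof -
  obtain e :: "real^'m" where e: "norm e = 1" using vector_choose_size[of 1] by auto
  have sets [measurable_cong]: "sets \<mu> = sets borel" "sets \<nu> = sets borel"
    using \<mu> \<nu> by (auto simp: rotation_invariant_on_sphere_def)
  have space: "space \<mu> = UNIV" "space \<nu> = UNIV"
    using sets_eq_imp_space_eq[OF sets(1)] sets_eq_imp_space_eq[OF sets(2)] by auto
  interpret M: prob_space \<mu> using \<mu> by (simp add: rotation_invariant_on_sphere_def)
  interpret N: prob_space \<nu> using \<nu> by (simp add: rotation_invariant_on_sphere_def)
  have [measurable]: "U \<in> sets borel" using U by simp
  define h where "h r = emeasure \<nu> (ball e r)" for r
  have hpos: "h r > 0" if "r > 0" for r
    unfolding h_def by (rule rotation_invariant_on_sphere_emeasure_ball_pos[OF \<nu> e that])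
  have hfin: "h r \<noteq> \<top>" for r by (simp add: h_def)
  have h\<mu>: "emeasure \<mu> (ball e r) = h r" for r
  proof -
    have "emeasure \<mu> (ball e r) = (\<integral>\<^sup>+x. emeasure \<nu> (UNIV \<inter> ball x r) \<partial>\<mu>)"
      using rotation_invariant_on_sphere_Fubini[OF \<mu> \<nu> e, of UNIV r] N.emeasure_space_1
      by (simp add: space)
    also have "\<dots> = (\<integral>\<^sup>+x. h r \<partial>\<mu>)"
      using rotation_invariant_on_sphere_AE[OF \<mu>]
      by (intro nn_integral_cong_AE)
        (auto elim!: eventually_mono simp: h_def
          intro: rotation_invariant_on_sphere_emeasure_ball[OF \<nu> _ e])
    also have "\<dots> = h r" using M.emeasure_space_1 by simp
    finally show ?thesis .
  qed
  define r where "r n = inverse (real (Suc n))" for n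
  have rpos: "r n > 0" for n by (simp add: r_def)
  have meas [measurable]: "(\<lambda>x. emeasure \<nu> (U \<inter> ball x \<rho>)) \<in> borel_measurable \<mu>" for \<rho>
  proof -
    have "(\<lambda>x. emeasure \<nu> (Pair x -` {p \<in> space (\<mu> \<Otimes>\<^sub>M \<nu>). snd p \<in> U \<and> dist (fst p) (snd p) < \<rho>}))
            \<in> borel_measurable \<mu>"
      by (rule N.measurable_emeasure_Pair) measurable
    also have "(\<lambda>x. Pair x -` {p \<in> space (\<mu> \<Otimes>\<^sub>M \<nu>). snd p \<in> U \<and> dist (fst p) (snd p) < \<rho>}) =
        (\<lambda>x. U \<inter> ball x \<rho>)"
      by (auto simp: space_pair_measure space fun_eq_iff)
    finally show ?thesis .
  qed
  have "emeasure \<mu> U = (\<integral>\<^sup>+x. indicator U x \<partial>\<mu>)" by simp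
  also have "\<dots> \<le> (\<integral>\<^sup>+x. liminf (\<lambda>n. emeasure \<nu> (U \<inter> ball x (r n)) / h (r n)) \<partial>\<mu>)"
  proof (rule nn_integral_mono_AE)
    show "AE x in \<mu>. indicator U x \<le> liminf (\<lambda>n. emeasure \<nu> (U \<inter> ball x (r n)) / h (r n))"
      using rotation_invariant_on_sphere_AE[OF \<mu>]
    proof eventually_elim
      fix x :: "real^'m" assume x: "norm x = 1"
      show "indicator U x \<le> liminf (\<lambda>n. emeasure \<nu> (U \<inter> ball x (r n)) / h (r n))"
      proof (cases "x \<in> U")
        case True
        then obtain \<epsilon> where \<epsilon>: "\<epsilon> > 0" "ball x \<epsilon> \<subseteq> U"
          using U by (auto simp: open_contains_ball)
        have "eventually (\<lambda>n. r n < \<epsilon>) sequentially"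
          using order_tendstoD(2)[OF LIMSEQ_inverse_real_of_nat \<epsilon>(1)] by (simp add: r_def)
        then have "eventually (\<lambda>n. 1 \<le> emeasure \<nu> (U \<inter> ball x (r n)) / h (r n)) sequentially"
        proof eventually_elim
          case (elim n)
          then have "U \<inter> ball x (r n) = ball x (r n)" using \<epsilon>(2) by auto
          then have "emeasure \<nu> (U \<inter> ball x (r n)) = h (r n)"
            unfolding h_def using rotation_invariant_on_sphere_emeasure_ball[OF \<nu> x e] by simp
          then show ?case using hpos[OF rpos[of n]] hfin[of "r n"]
            by (simp add: ennreal_divide_self top.not_eq_extremum)
        qed
        then show ?thesis using True by (simp add: Liminf_bounded)
      qed simp
    qed
  qed
  also have "\<dots> \<le> liminf (\<lambda>n. \<integral>\<^sup>+x. emeasure \<nu> (U \<inter> ball x (r n)) / h (r n) \<partial>\<mu>)"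
    by (rule nn_integral_liminf) measurable
  also have "(\<lambda>n. \<integral>\<^sup>+x. emeasure \<nu> (U \<inter> ball x (r n)) / h (r n) \<partial>\<mu>) = (\<lambda>n. emeasure \<nu> U)"
  proof
    fix n
    have "(\<integral>\<^sup>+x. emeasure \<nu> (U \<inter> ball x (r n)) / h (r n) \<partial>\<mu>) =
        (h (r n) * emeasure \<nu> U) / h (r n)"
      using rotation_invariant_on_sphere_Fubini[OF \<mu> \<nu> e U, of "r n"]
      by (subst nn_integral_divide) (auto simp: h\<mu>)
    also have "\<dots> = emeasure \<nu> U"
      using hpos[OF rpos[of n]] hfin[of "r n"]
      by (metis ennreal_mult_divide_eq mult.commute order_less_irrefl)
    finally show "(\<integral>\<^sup>+x. emeasure \<nu> (U \<inter> ball x (r n)) / h (r n) \<partial>\<mu>) = emeasure \<nu> U" .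
  qed
  finally show ?thesis by (simp add: Liminf_const)
qed

lemma rotation_invariant_on_sphere_unique:
  fixes \<mu> \<nu> :: "(real^'m) measure"
  assumes \<mu>: "rotation_invariant_on_sphere \<mu>" and \<nu>: "rotation_invariant_on_sphere \<nu>"
  shows "\<mu> = \<nu>"
proof (rule measure_eqI_generator_eq[where E="{S. open S}" and \<Omega>=UNIV and A="\<lambda>_. UNIV"])
  interpret M: prob_space \<mu> using \<mu> by (simp add: rotation_invariant_on_sphere_def)
  show "Int_stable {S :: (real^'m) set. open S}" by (auto simp: Int_stable_def)
  show "emeasure \<mu> X = emeasure \<nu> X" if "X \<in> {S. open S}" for X
    using that rotation_invariant_on_sphere_open_le[OF \<mu> \<nu>]
      rotation_invariant_on_sphere_open_le[OF \<nu> \<mu>] by (auto intro: antisym)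
  show "sets \<mu> = sigma_sets UNIV {S. open S}" "sets \<nu> = sigma_sets UNIV {S. open S}"
    using \<mu> \<nu> by (auto simp: rotation_invariant_on_sphere_def borel_def)
  show "emeasure \<mu> UNIV \<noteq> \<infinity>" by simp
qed auto

lemma sphere_measure:
  "rotation_invariant_on_sphere (sphere_measure :: (real^'m::{finite,wellorder}) measure)"
proof -
  obtain \<sigma> :: "(real, 'm) vec measure" where \<sigma>: "rotation_invariant_on_sphere \<sigma>"
    using rotation_invariant_on_sphere_exists by blast
  show ?thesis
    unfolding sphere_measure_def
    by (rule theI[where P=rotation_invariant_on_sphere, OF \<sigma>])
      (rule rotation_invariant_on_sphere_unique[OF _ \<sigma>])
qed


subsection \<open>The Hilbert--Schmidt inner product and the isometric chart\<close>

lemma self_adjoint_inner: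
  assumes "self_adjoint A"
  shows "A \<bullet> B = Re (trace (A ** B))"
proof -
  have "A $ i $ j \<bullet> B $ i $ j = Re (A $ j $ i * B $ i $ j)" for i j
  proof -
    have "A $ j $ i = cnj (A $ i $ j)" using assms unfolding self_adjoint_def by blast
    then show ?thesis by (simp add: inner_complex_def)
  qed
  then have "A \<bullet> B = (\<Sum>i\<in>UNIV. \<Sum>j\<in>UNIV. Re (A $ j $ i * B $ i $ j))"
    by (simp add: inner_vec_def)
  also have "\<dots> = (\<Sum>j\<in>UNIV. \<Sum>i\<in>UNIV. Re (A $ j $ i * B $ i $ j))"
    by (rule sum.swap)
  finally show ?thesis
    by (simp add: trace_def matrix_matrix_mult_def)
qed

lemma subspace_self_adjoint: "subspace {A :: complex^'n^'n. self_adjoint A}"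
proof (rule subspaceI; clarsimp)
  show "self_adjoint (0 :: complex^'n^'n)" by (simp add: self_adjoint_def)
  show "self_adjoint (A + B)" if "self_adjoint A" "self_adjoint B" for A B :: "complex^'n^'n"
    unfolding self_adjoint_def
  proof (intro allI)
    fix i j
    have "A $ i $ j = cnj (A $ j $ i)" "B $ i $ j = cnj (B $ j $ i)"
      using that unfolding self_adjoint_def by blast+
    then show "(A + B) $ i $ j = cnj ((A + B) $ j $ i)" by simp
  qed
  show "self_adjoint (c *\<^sub>R A)" if "self_adjoint A" for c and A :: "complex^'n^'n"
    unfolding self_adjoint_def
  proof (intro allI)
    fix i j
    have "A $ i $ j = cnj (A $ j $ i)" using that unfolding self_adjoint_def by blast
    then show "(c *\<^sub>R A) $ i $ j = cnj ((c *\<^sub>R A) $ j $ i)" by simp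
  qed
qed

lemma dim_self_adjoint: "dim {A :: complex^'n^'n. self_adjoint A} = CARD('n)\<^sup>2"
proof -
  define S where "S = {A :: complex^'n^'n. self_adjoint A}"
  define J :: "complex^'n^'n \<Rightarrow> complex^'n^'n" where "J A = (\<chi> i j. \<i> * A $ i $ j)" for A
  have lin: "linear J"
    by (auto intro!: linearI simp: J_def vec_eq_iff algebra_simps)
  have inj: "inj J" by (auto simp: inj_def J_def vec_eq_iff)
  have sub: "subspace S" unfolding S_def by (rule subspace_self_adjoint)
  have subJ: "subspace (J ` S)" using lin sub by (rule linear_subspace_image)
  have dimJ: "dim (J ` S) = dim S"
    using lin inj by (intro dim_image_eq) (auto intro: inj_on_subset)
  have int: "S \<inter> J ` S = {0}"
  proof -
    have "B = 0" if "self_adjoint B" "self_adjoint A" "B = J A" for A B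
    proof -
      have "B $ i $ j = 0" for i j
      proof -
        have "B $ i $ j = cnj (B $ j $ i)" using that(1) unfolding self_adjoint_def by blast
        also have "\<dots> = - \<i> * cnj (A $ j $ i)" by (simp add: that(3) J_def)
        also have "cnj (A $ j $ i) = A $ i $ j" using that(2) unfolding self_adjoint_def by metis
        finally show ?thesis by (simp add: that(3) J_def)
      qed
      then show ?thesis by (simp add: vec_eq_iff)
    qed
    moreover have "0 \<in> S \<inter> J ` S"
      using sub subJ by (simp add: subspace_0)
    ultimately show ?thesis by (auto simp: S_def)
  qed
  have "A \<in> {x + y |x y. x \<in> S \<and> y \<in> J ` S}" for A
  proof -
    define P where "P = (\<chi> i j. (A $ i $ j + cnj (A $ j $ i)) / 2)"
    define Q where "Q = (\<chi> i j. (A $ i $ j - cnj (A $ j $ i)) / (2 * \<i>))"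
    have "self_adjoint P" "self_adjoint Q"
      by (auto simp: self_adjoint_def P_def Q_def field_simps)
    moreover have "A = P + J Q"
      by (auto simp: vec_eq_iff P_def Q_def J_def field_simps)
    ultimately show ?thesis by (auto simp: S_def)
  qed
  then have "{x + y |x y. x \<in> S \<and> y \<in> J ` S} = UNIV" by blast
  with dim_sums_Int[OF sub subJ] have "2 * dim S = DIM(complex^'n^'n)"
    by (simp add: dimJ int)
  then show ?thesis by (simp add: S_def power2_eq_square)
qed

lemma trace_chart_exists:
  assumes n: "CARD('n::finite) \<ge> 2"
  shows "\<exists>\<phi> :: real^('n coord) \<Rightarrow> complex^'n^'n.
           (\<forall>x y. dist (\<phi> x) (\<phi> y) = dist x y) \<and> range \<phi> = unit_trace"
proof -
  define S where "S = {A :: complex^'n^'n. self_adjoint A}"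
  define I where "I = (mat 1 :: complex^'n^'n)"
  define T where "T = {A \<in> S. \<forall>x\<in>span {I}. orthogonal x A}"
  have sub: "subspace S" unfolding S_def by (rule subspace_self_adjoint)
  have I: "I \<in> S" by (simp add: S_def self_adjoint_def I_def mat_def)
  have I0: "I \<noteq> 0"
    by (simp add: I_def vec_eq_iff mat_def)
  have tr: "I \<bullet> A = Re (trace A)" for A
    using I self_adjoint_inner[of I A] by (simp add: S_def I_def)
  have tr_real: "Im (trace A) = 0" if "A \<in> S" for A
  proof -
    have "A $ i $ i = cnj (A $ i $ i)" for i
      using that unfolding S_def self_adjoint_def by blast
    from arg_cong[OF this, of Im] have "Im (A $ i $ i) = 0" for i by simp
    then show ?thesis by (simp add: trace_def)
  qed
  have T_iff: "A \<in> T \<longleftrightarrow> A \<in> S \<and> trace A = 0" for A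
  proof -
    have "(\<forall>x\<in>span {I}. orthogonal x A) \<longleftrightarrow> I \<bullet> A = 0"
    proof
      show "I \<bullet> A = 0" if "\<forall>x\<in>span {I}. orthogonal x A"
        using that span_base[of I "{I}"] by (simp add: orthogonal_def)
      show "\<forall>x\<in>span {I}. orthogonal x A" if "I \<bullet> A = 0"
        using that by (auto simp: span_singleton orthogonal_def)
    qed
    then show ?thesis using tr_real by (auto simp: T_def tr complex_eq_iff)
  qed
  have subT: "subspace T"
    using sub by (auto simp: subspace_def T_def orthogonal_def inner_add_right)
  have "dim T + dim (span {I}) = dim S"
    unfolding T_def using I sub
    by (intro dim_subspace_orthogonal_to_vectors) (auto simp: span_minimal)
  then have dimT: "dim T = CARD('n)\<^sup>2 - 1"
    using dim_self_adjoint[where 'n='n] I0 by (simp add: S_def)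
  obtain f :: "real^('n coord) \<Rightarrow> complex^'n^'n"
    where f: "linear f" "f ` UNIV = T" "\<And>x. x \<in> UNIV \<Longrightarrow> norm (f x) = norm x"
    by (rule isometry_subspaces[of "UNIV :: (real^('n coord)) set" T])
      (auto simp: subT dimT card_coord[OF n] subspace_UNIV)
  define P where "P = (1 / real CARD('n)) *\<^sub>R I"
  have P: "P \<in> S" using sub I by (simp add: P_def subspace_scale)
  have trP: "trace P = 1"
    by (simp add: P_def I_def trace_def mat_def) (simp add: scaleR_conv_of_real)?
  define \<phi> where "\<phi> x = P + f x" for x
  have "dist (\<phi> x) (\<phi> y) = dist x y" for x y
    using f(3)[of "x - y"] by (simp add: \<phi>_def dist_norm linear_diff[OF f(1)])
  moreover have "range \<phi> = unit_trace"
  proof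
    have "\<phi> x \<in> unit_trace" for x
    proof -
      have "f x \<in> T" using f(2) by auto
      then have "f x \<in> S" "trace (f x) = 0" by (auto simp: T_iff)
      then have "P + f x \<in> S" "trace (P + f x) = 1"
        using P sub trP by (auto simp: subspace_add trace_add)
      then show ?thesis by (simp add: \<phi>_def unit_trace_def S_def)
    qed
    then show "range \<phi> \<subseteq> unit_trace" by auto
    show "unit_trace \<subseteq> range \<phi>"
    proof
      fix A :: "complex^'n^'n" assume "A \<in> unit_trace"
      then have "A \<in> S" "trace A = 1" by (auto simp: unit_trace_def S_def)
      then have "A - P \<in> T" using P sub trP by (simp add: T_iff subspace_diff trace_sub)
      then obtain x where "f x = A - P" using f(2) by (metis imageE)
      then show "A \<in> range \<phi>" by (auto simp: \<phi>_def image_iff intro!: exI[of _ x])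
    qed
  qed
  ultimately show ?thesis by blast
qed

lemma trace_chart:
  assumes "CARD('n::finite) \<ge> 2"
  shows "dist (trace_chart x :: complex^'n^'n) (trace_chart y) = dist x y"
    and "range (trace_chart :: real^('n coord) \<Rightarrow> complex^'n^'n) = unit_trace"
proof -
  note * = someI_ex[OF trace_chart_exists[OF assms], folded trace_chart_def]
  show "dist (trace_chart x :: complex^'n^'n) (trace_chart y) = dist x y"
    by (rule *[THEN conjunct1, THEN spec, THEN spec])
  show "range (trace_chart :: real^('n coord) \<Rightarrow> complex^'n^'n) = unit_trace"
    by (rule *[THEN conjunct2])
qed

end

theory Submission
  imports Defs "HOL-Real_Asymp.Real_Asymp"
begin

text \<open>
  Everything is transferred to a standard Gaussian vector \<open>Z\<close> in the trace hyperplane of dimension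
  \<open>m = n\<^sup>2 - 1\<close>, centred at the maximally mixed state. With \<open>h\<close> the support function and \<open>p\<close> the gauge of
  a convex body \<open>K\<close>, a transport inequality gives the upper bound \<open>vr(K)\<^sup>2 \<le> E h(Z)\<^sup>2 / m\<close>, and Jensen's
  inequality the lower bound \<open>vr(K)\<^sup>2 \<ge> m / E p(Z)\<^sup>2\<close>; the mean width is \<open>E h(Z) / E \<parallel>Z\<parallel>\<close>. For separable
  states \<open>h\<close> is a supremum over product vectors, and for all states \<open>p\<close> is at most \<open>n\<close> times a
  supremum over unit vectors. Such a supremum is estimated without nets: around each vector the
  uniform measure of the spherical cap \<open>{|\<langle>x, z\<rangle>|\<^sup>2 \<ge> \<rho>}\<close> is exactly \<open>(1 - \<rho>)\<^bsup>n-1\<^esup>\<close>, and the mean of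
  \<open>z z\<^sup>*\<close> over the cap is a depolarised version of \<open>x x\<^sup>*\<close>, so by convexity \<open>cosh\<close> of the supremum is at
  most a multiple of an average of \<open>cosh\<close> over all vectors. The lower bound
  \<open>1 / sqrt n\<close> for the mean width of all states comes from the extreme eigenvalues of \<open>Z\<close>. For small \<open>d\<close>
  and \<open>K\<close> the right-hand sides exceed 1 and the claim is monotonicity.
\<close>

section \<open>Gaussian measures on Euclidean spaces\<close>

text \<open>The difficulty is the supremum over product vectors. Averaging over a product of caps
  replaces each of the K factors by a depolarised projection with weight s \<ge> \<rho> on its
  centre, and multiplying out leaves 2^K - 1 error terms. Each of them is a positive combination of
  product projections, so it is bounded by the very supremum under estimation; their total weight is
  1 - s^K, and the estimate closes once 2 \<rho>^K > 1. For K qubits this asks for 1 - \<rho> of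
  order 1/K. With 1 - \<rho> = 1/(4 K) the product cap has measure (4 K)^-K, and the logarithm K ln
  (4 K) of its inverse is the origin of K log K. For two factors a constant \<rho> = 31/32 suffices,
  and the cost is linear in d. For the set of all states there is a single factor, the error term
  vanishes because Z is traceless, and \<rho> = 3/4 serves.

  The constants in both volume inequalities are those of the Euclidean ball, so the numerical loss
  comes from the caps and from elementary bounds for E |Z|, ln 2 and pi.\<close>

definition gauss_density :: "'a::euclidean_space \<Rightarrow> real" where
  "gauss_density x = (1 / sqrt (2 * pi)) ^ DIM('a) * exp (- (norm x)\<^sup>2 / 2)"

definition gauss :: "'a::euclidean_space measure" where
  "gauss = density lborel (\<lambda>x. ennreal (gauss_density x))"

lemma gauss_density_nonneg [simp]: "gauss_density x \<ge> 0"
  by (simp add: gauss_density_def)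

lemma measurable_gauss_density [measurable]: "gauss_density \<in> borel_measurable borel"
  unfolding gauss_density_def by measurable

lemma sets_gauss [measurable_cong, simp]: "sets gauss = sets borel"
  by (simp add: gauss_def)

lemma space_gauss [simp]: "space gauss = UNIV"
  by (simp add: gauss_def)

lemma norm_sq_Basis: "(norm (x :: 'a::euclidean_space))\<^sup>2 = (\<Sum>b\<in>Basis. (x \<bullet> b)\<^sup>2)"
  unfolding power2_norm_eq_inner by (subst euclidean_inner) (simp add: power2_eq_square)

lemma gauss_density_prod:
  "gauss_density (x :: 'a::euclidean_space) = (\<Prod>b\<in>Basis. std_normal_density (x \<bullet> b))"
proof -
  have "(\<Prod>b\<in>Basis. std_normal_density (x \<bullet> b))
      = (1 / sqrt (2 * pi)) ^ DIM('a) * (\<Prod>b\<in>(Basis :: 'a set). exp (- (x \<bullet> b)\<^sup>2 / 2))"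
    unfolding std_normal_density_def prod.distrib by simp
  also have "(\<Prod>b\<in>(Basis :: 'a set). exp (- (x \<bullet> b)\<^sup>2 / 2)) = exp (\<Sum>b\<in>(Basis :: 'a set). - (x \<bullet> b)\<^sup>2 / 2)"
    by (simp add: exp_sum)
  also have "(\<Sum>b\<in>(Basis :: 'a set). - (x \<bullet> b)\<^sup>2 / 2) = - (norm x)\<^sup>2 / 2"
    by (simp add: norm_sq_Basis sum_negf sum_divide_distrib)
  finally show ?thesis by (simp add: gauss_density_def)
qed

lemma nn_integral_gauss:
  "f \<in> borel_measurable borel \<Longrightarrow> (\<integral>\<^sup>+x. f x \<partial>gauss) = (\<integral>\<^sup>+x. ennreal (gauss_density x) * f x \<partial>lborel)"
  unfolding gauss_def by (subst nn_integral_density) auto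

lemma nn_integral_gauss_prod:
  fixes f :: "'a::euclidean_space \<Rightarrow> real \<Rightarrow> real"
  assumes [measurable]: "\<And>b. b \<in> Basis \<Longrightarrow> f b \<in> borel_measurable borel"
    and nn: "\<And>b t. b \<in> Basis \<Longrightarrow> 0 \<le> f b t"
  shows "(\<integral>\<^sup>+x. ennreal (\<Prod>b\<in>Basis. f b (x \<bullet> b)) \<partial>gauss)
       = (\<Prod>b\<in>Basis. \<integral>\<^sup>+t. ennreal (f b t) \<partial>std_normal_distribution)"
proof -
  have "(\<integral>\<^sup>+x. ennreal (\<Prod>b\<in>Basis. f b (x \<bullet> b)) \<partial>gauss)
      = (\<integral>\<^sup>+x. (\<Prod>b\<in>Basis. ennreal (std_normal_density (x \<bullet> b) * f b (x \<bullet> b))) \<partial>lborel)"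
    by (subst nn_integral_gauss)
      (auto intro!: nn_integral_cong simp: gauss_density_prod prod_ennreal nn prod_nonneg
         prod.distrib ennreal_mult[symmetric])
  also have "\<dots> = (\<Prod>b\<in>Basis. \<integral>\<^sup>+t. ennreal (std_normal_density t * f b t) \<partial>lborel)"
    by (rule nn_integral_lborel_prod) auto
  also have "\<dots> = (\<Prod>b\<in>Basis. \<integral>\<^sup>+t. ennreal (f b t) \<partial>std_normal_distribution)"
    by (intro prod.cong refl, subst nn_integral_density)
      (auto simp: ennreal_mult nn)
  finally show ?thesis .
qed

lemma prob_space_std_normal: "prob_space std_normal_distribution"
  using real_dist_normal_dist by (simp add: real_distribution_def)

interpretation std_normal: prob_space std_normal_distribution
  by (rule prob_space_std_normal)

text \<open>In the product formula every other coordinate carries the constant function 1, whose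
  integral is 1.\<close>

lemma nn_integral_gauss_component:
  fixes f :: "real \<Rightarrow> real"
  assumes [measurable]: "f \<in> borel_measurable borel" and nn: "\<And>t. 0 \<le> f t"
    and b: "(b :: 'a::euclidean_space) \<in> Basis"
  shows "(\<integral>\<^sup>+x. ennreal (f (x \<bullet> b)) \<partial>gauss) = (\<integral>\<^sup>+t. ennreal (f t) \<partial>std_normal_distribution)"
proof -
  define g where "g = (\<lambda>c. if c = b then f else (\<lambda>_. 1))"
  have "(\<Prod>c\<in>Basis. g c (x \<bullet> c)) = f (x \<bullet> b)" for x
  proof -
    have "(\<Prod>c\<in>Basis. g c (x \<bullet> c)) = g b (x \<bullet> b) * (\<Prod>c\<in>Basis - {b}. g c (x \<bullet> c))"
      using b by (simp add: prod.remove)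
    also have "(\<Prod>c\<in>Basis - {b}. g c (x \<bullet> c)) = 1" by (rule prod.neutral) (auto simp: g_def)
    finally show ?thesis by (simp add: g_def)
  qed
  then have "(\<integral>\<^sup>+x. ennreal (f (x \<bullet> b)) \<partial>gauss) = (\<integral>\<^sup>+x. ennreal (\<Prod>c\<in>Basis. g c (x \<bullet> c)) \<partial>gauss)"
    by simp
  also have "\<dots> = (\<Prod>c\<in>Basis. \<integral>\<^sup>+t. ennreal (g c t) \<partial>std_normal_distribution)"
    by (rule nn_integral_gauss_prod) (auto simp: g_def nn)
  also have "\<dots> = (\<integral>\<^sup>+t. ennreal (g b t) \<partial>std_normal_distribution) * 
       (\<Prod>c\<in>Basis - {b}. \<integral>\<^sup>+t. ennreal (g c t) \<partial>std_normal_distribution)"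
    using b by (simp add: prod.remove)
  also have "(\<Prod>c\<in>Basis - {b}. \<integral>\<^sup>+t. ennreal (g c t) \<partial>std_normal_distribution) = 1"
    using std_normal.emeasure_space_1 by (intro prod.neutral) (auto simp: g_def simp del: space_density)
  finally show ?thesis by (simp add: g_def)
qed

lemma prob_space_gauss: "prob_space (gauss :: 'a::euclidean_space measure)"
proof
  obtain b :: 'a where b: "b \<in> Basis" using nonempty_Basis by blast
  have "(\<integral>\<^sup>+x. ennreal ((\<lambda>_. 1) (x \<bullet> b)) \<partial>(gauss :: 'a measure)) = 1"
    using std_normal.emeasure_space_1
    by (subst nn_integral_gauss_component[OF _ _ b]) auto
  then show "emeasure (gauss :: 'a measure) (space gauss) = 1" by simp
qed

interpretation gauss: prob_space "gauss :: 'a::euclidean_space measure"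
  by (rule prob_space_gauss)

lemma gauss_component_square:
  assumes b: "(b :: 'a::euclidean_space) \<in> Basis"
  shows "integrable gauss (\<lambda>x. (x \<bullet> b)\<^sup>2)" "(\<integral>x. (x \<bullet> b)\<^sup>2 \<partial>gauss) = 1"
proof -
  have "has_bochner_integral std_normal_distribution (\<lambda>x. x ^ 2) 1"
    using std_normal_distribution_even_moments[of 1]
    by (auto simp: has_bochner_integral_iff)
  then have "(\<integral>\<^sup>+t. ennreal (t\<^sup>2) \<partial>std_normal_distribution) = 1"
    by (simp add: has_bochner_integral_iff nn_integral_eq_integral)
  then have "(\<integral>\<^sup>+x. ennreal ((x \<bullet> b)\<^sup>2) \<partial>gauss) = 1"
    using nn_integral_gauss_component[OF _ _ b, of "\<lambda>t. t\<^sup>2"] by simp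
  then have "has_bochner_integral gauss (\<lambda>x. (x \<bullet> b)\<^sup>2) 1"
    by (intro has_bochner_integral_nn_integral) auto
  then show "integrable gauss (\<lambda>x. (x \<bullet> b)\<^sup>2)" "(\<integral>x. (x \<bullet> b)\<^sup>2 \<partial>gauss) = 1"
    by (auto simp: has_bochner_integral_iff)
qed

lemma gauss_component_abs:
  assumes b: "(b :: 'a::euclidean_space) \<in> Basis"
  shows "integrable gauss (\<lambda>x. \<bar>x \<bullet> b\<bar>)" "(\<integral>x. \<bar>x \<bullet> b\<bar> \<partial>gauss) = sqrt (2 / pi)"
proof -
  have "has_bochner_integral lborel (\<lambda>x. std_normal_density x * \<bar>x\<bar>) (sqrt (2 / pi))"
    using std_normal_moment_abs_odd[of 0] by simp
  then have "has_bochner_integral std_normal_distribution (\<lambda>x. \<bar>x\<bar>) (sqrt (2 / pi))"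
    by (intro has_bochner_integral_density) auto
  then have "(\<integral>\<^sup>+t. ennreal \<bar>t\<bar> \<partial>std_normal_distribution) = ennreal (sqrt (2 / pi))"
    by (simp add: has_bochner_integral_iff nn_integral_eq_integral)
  then have "(\<integral>\<^sup>+x. ennreal \<bar>x \<bullet> b\<bar> \<partial>gauss) = ennreal (sqrt (2 / pi))"
    using nn_integral_gauss_component[OF _ _ b, of abs] by simp
  then have "has_bochner_integral gauss (\<lambda>x. \<bar>x \<bullet> b\<bar>) (sqrt (2 / pi))"
    by (intro has_bochner_integral_nn_integral) auto
  then show "integrable gauss (\<lambda>x. \<bar>x \<bullet> b\<bar>)" "(\<integral>x. \<bar>x \<bullet> b\<bar> \<partial>gauss) = sqrt (2 / pi)"
    by (auto simp: has_bochner_integral_iff)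
qed

lemma gauss_norm_square:
  "integrable gauss (\<lambda>x :: 'a::euclidean_space. (norm x)\<^sup>2)"
  "(\<integral>x. (norm x)\<^sup>2 \<partial>(gauss :: 'a::euclidean_space measure)) = DIM('a)"
  unfolding norm_sq_Basis by (auto simp: gauss_component_square)

lemma integrable_gauss_norm: "integrable gauss (\<lambda>x :: 'a::euclidean_space. norm x)"
proof (rule Bochner_Integration.integrable_bound)
  show "integrable gauss (\<lambda>x :: 'a. 1 + (norm x)\<^sup>2)"
    using gauss_norm_square by auto
  have "norm x \<le> 1 + (norm x)\<^sup>2" for x :: 'a
  proof -
    have "0 \<le> (norm x)\<^sup>2 - 2 * norm x + 1"
      using zero_le_power2[of "norm x - 1"] by (simp add: power2_diff)
    then show ?thesis using norm_ge_zero[of x] zero_le_power2[of "norm x"] by linarith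
  qed
  then show "AE x in gauss. norm (norm (x :: 'a)) \<le> norm (1 + (norm x)\<^sup>2)"
    by (auto intro!: AE_I2 simp: abs_of_nonneg add_nonneg_nonneg)
qed auto

text \<open>Cauchy-Schwarz compares the l1 norm with the Euclidean norm, and every coordinate
  contributes E |x . b| = sqrt (2 / pi). For large dimension the true value is close to the square
  root of the dimension; the lost factor sqrt (pi / 2) reappears in the bound for
  \<open>rho_w\<close>.\<close>

lemma gauss_norm_lower:
  "sqrt (2 / pi) * sqrt (real DIM('a)) \<le> (\<integral>x. norm x \<partial>(gauss :: 'a::euclidean_space measure))"
proof -
  have pointwise: "(\<Sum>b\<in>Basis. \<bar>x \<bullet> b\<bar>) \<le> sqrt (real DIM('a)) * norm x" for x :: 'a
  proof -
    have "(\<Sum>b\<in>Basis. \<bar>x \<bullet> b\<bar>)\<^sup>2 = (\<Sum>b\<in>(Basis :: 'a set). \<bar>x \<bullet> b\<bar> * 1)\<^sup>2" by simp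
    also have "\<dots> \<le> (\<Sum>b\<in>(Basis :: 'a set). \<bar>x \<bullet> b\<bar>\<^sup>2) * (\<Sum>b\<in>(Basis :: 'a set). 1\<^sup>2)"
      by (rule Cauchy_Schwarz_ineq_sum)
    also have "\<dots> = (sqrt (real DIM('a)) * norm x)\<^sup>2"
      by (simp add: norm_sq_Basis power_mult_distrib)
    finally show ?thesis by (rule power2_le_imp_le) auto
  qed
  have "real DIM('a) * sqrt (2 / pi) = (\<integral>x. (\<Sum>b\<in>Basis. \<bar>x \<bullet> b\<bar>) \<partial>(gauss :: 'a measure))"
    by (subst Bochner_Integration.integral_sum) (auto simp: gauss_component_abs)
  also have "\<dots> \<le> (\<integral>x. sqrt (real DIM('a)) * norm x \<partial>(gauss :: 'a measure))"
    by (rule integral_mono) (auto simp: gauss_component_abs integrable_gauss_norm pointwise)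
  finally have "sqrt (real DIM('a)) * (sqrt (real DIM('a)) * sqrt (2 / pi))
      \<le> sqrt (real DIM('a)) * (\<integral>x. norm x \<partial>(gauss :: 'a measure))"
    by (simp add: mult.assoc[symmetric])
  then have "sqrt (real DIM('a)) * sqrt (2 / pi) \<le> (\<integral>x. norm x \<partial>(gauss :: 'a measure))"
    by (subst (asm) mult_le_cancel_left_pos) auto
  then show ?thesis by (simp add: mult.commute)
qed

lemma nn_integral_lborel_translate:
  fixes f :: "'a::euclidean_space \<Rightarrow> ennreal"
  assumes [measurable]: "f \<in> borel_measurable borel"
  shows "(\<integral>\<^sup>+x. f (c + x) \<partial>lborel) = (\<integral>\<^sup>+x. f x \<partial>lborel)"
  by (subst (2) lborel_affine[of 1 c]) (auto simp: nn_integral_density nn_integral_distr)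

text \<open>Completing the square: the tilted density is a constant times a translate of the
  Gaussian density.\<close>

lemma gauss_mgf:
  "(\<integral>\<^sup>+x. ennreal (exp (x \<bullet> v)) \<partial>(gauss :: 'a::euclidean_space measure)) = ennreal (exp ((norm v)\<^sup>2 / 2))"
proof -
  have "(\<integral>\<^sup>+x. ennreal (exp (x \<bullet> v)) \<partial>gauss) = (\<integral>\<^sup>+x. ennreal (gauss_density x * exp (x \<bullet> v)) \<partial>lborel)"
    by (subst nn_integral_gauss) (auto simp: ennreal_mult)
  also have "\<dots> = (\<integral>\<^sup>+x. ennreal (gauss_density (- v + x)) * ennreal (exp ((norm v)\<^sup>2 / 2)) \<partial>lborel)"
  proof (intro nn_integral_cong)
    fix x :: 'a
    have "- (norm (- v + x))\<^sup>2 / 2 + (norm v)\<^sup>2 / 2 = - (norm x)\<^sup>2 / 2 + x \<bullet> v"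
      by (simp add: power2_norm_eq_inner inner_simps inner_commute field_simps)
    then have "gauss_density x * exp (x \<bullet> v) = gauss_density (- v + x) * exp ((norm v)\<^sup>2 / 2)"
      unfolding gauss_density_def mult.assoc exp_add[symmetric] by simp
    then show "ennreal (gauss_density x * exp (x \<bullet> v))
        = ennreal (gauss_density (- v + x)) * ennreal (exp ((norm v)\<^sup>2 / 2))"
      by (simp add: ennreal_mult)
  qed
  also have "\<dots> = (\<integral>\<^sup>+x. ennreal (gauss_density (- v + x)) \<partial>lborel) * ennreal (exp ((norm v)\<^sup>2 / 2))"
    by (rule nn_integral_multc) measurable
  also have "(\<integral>\<^sup>+x. ennreal (gauss_density (- v + x)) \<partial>lborel) = (\<integral>\<^sup>+x. ennreal (gauss_density (x :: 'a)) \<partial>lborel)"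
    by (rule nn_integral_lborel_translate) measurable
  also have "\<dots> = (\<integral>\<^sup>+x. 1 \<partial>(gauss :: 'a measure))"
    by (subst nn_integral_gauss) auto
  also have "\<dots> = 1" using gauss.emeasure_space_1 by simp
  finally show ?thesis by simp
qed

lemma gauss_cosh:
  assumes v: "norm v \<le> 1"
  shows "(\<integral>\<^sup>+x. ennreal (cosh (t * (x \<bullet> v))) \<partial>(gauss :: 'a::euclidean_space measure)) \<le> ennreal (exp (t\<^sup>2 / 2))"
proof -
  have "(\<integral>\<^sup>+x. ennreal (cosh (t * (x \<bullet> v))) \<partial>gauss)
     = (\<integral>\<^sup>+x. ennreal (1/2) * (ennreal (exp (x \<bullet> (t *\<^sub>R v))) + ennreal (exp (x \<bullet> (- t *\<^sub>R v)))) \<partial>gauss)"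
  proof (intro nn_integral_cong)
    fix x
    have "cosh (t * (x \<bullet> v)) = (1/2) * (exp (x \<bullet> (t *\<^sub>R v)) + exp (x \<bullet> (- t *\<^sub>R v)))"
      by (simp add: cosh_def)
    then show "ennreal (cosh (t * (x \<bullet> v)))
        = ennreal (1/2) * (ennreal (exp (x \<bullet> (t *\<^sub>R v))) + ennreal (exp (x \<bullet> (- t *\<^sub>R v))))"
      by (simp only: ennreal_mult ennreal_plus exp_ge_zero add_nonneg_nonneg zero_le_divide_1_iff zero_le_numeral)
  qed
  also have "\<dots> = ennreal (1/2) * (ennreal (exp ((norm (t *\<^sub>R v))\<^sup>2 / 2)) + ennreal (exp ((norm (- t *\<^sub>R v))\<^sup>2 / 2)))"
    by (subst nn_integral_cmult, simp, subst nn_integral_add) (simp_all only: gauss_mgf, auto)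
  also have "\<dots> = ennreal (exp ((t * norm v)\<^sup>2 / 2))"
  proof -
    have "ennreal (1/2) * (ennreal a + ennreal a) = ennreal a" if "a \<ge> 0" for a
      using that by (simp only: ennreal_plus[symmetric] ennreal_mult[symmetric] add_nonneg_nonneg
          zero_le_divide_1_iff zero_le_numeral) simp
    then show ?thesis by (simp add: power_mult_distrib)
  qed
  also have "\<dots> \<le> ennreal (exp (t\<^sup>2 / 2))"
    using v by (intro ennreal_leI) (auto simp: power_mult_distrib intro!: mult_left_le power_le_one)
  finally show ?thesis .
qed

text \<open>By Fubini, two translation-invariant measures are proportional; the unit ball
  fixes the constant.\<close>

lemma distr_lborel_isometry:
  fixes f :: "'a::euclidean_space \<Rightarrow> 'b::euclidean_space"
  assumes lin: "linear f" and norm: "\<And>x. norm (f x) = norm x" and surj: "surj f"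
  shows "distr lborel borel f = lborel"
proof -
  define \<mu> where "\<mu> = distr lborel borel f"
  have [measurable]: "f \<in> borel_measurable borel"
    using lin by (simp add: borel_measurable_continuous_onI linear_continuous_on linear_conv_bounded_linear)
  have inj: "inj f"
    unfolding linear_injective_0[OF lin]
  proof (intro allI impI)
    show "x = 0" if "f x = 0" for x using that norm[of x] by simp
  qed
  have DIM: "DIM('a) = DIM('b)"
    using dim_image_eq[OF lin, of UNIV] inj surj by (simp add: inj_on_def)
  have sets [measurable_cong]: "sets \<mu> = sets borel" and space: "space \<mu> = UNIV" by (auto simp: \<mu>_def)
  define g where "g = inv f"
  have fg: "f (g y) = y" for y by (simp add: g_def surj surj_f_inv_f)
  have nn_\<mu>: "(\<integral>\<^sup>+x. h x \<partial>\<mu>) = (\<integral>\<^sup>+x. h (f x) \<partial>lborel)" if [measurable]: "h \<in> borel_measurable borel" for h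
    unfolding \<mu>_def by (subst nn_integral_distr) auto
  have trans: "(\<integral>\<^sup>+x. h (c + x) \<partial>\<mu>) = (\<integral>\<^sup>+x. h x \<partial>\<mu>)" if [measurable]: "h \<in> borel_measurable borel" for h c
  proof -
    have "(\<integral>\<^sup>+x. h (c + x) \<partial>\<mu>) = (\<integral>\<^sup>+x. h (f (g c + x)) \<partial>lborel)"
      by (subst nn_\<mu>) (auto simp: linear_add[OF lin] fg)
    also have "\<dots> = (\<integral>\<^sup>+x. h (f x) \<partial>lborel)"
      by (rule nn_integral_lborel_translate) measurable
    finally show ?thesis by (simp add: nn_\<mu>)
  qed
  define B where "B = ball (0 :: 'b) 1"
  have [measurable]: "B \<in> sets borel" by (simp add: B_def)
  \<comment> \<open>Balls about 0 are preserved, so on them \<open>\<mu>\<close> agrees with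
    Lebesgue measure; this gives both sigma-finiteness and the normalisation on the unit
    ball.\<close>
  have fB: "emeasure \<mu> (ball 0 r) = emeasure lborel (ball (0 :: 'b) r)" if "r \<ge> 0" for r
  proof -
    have "f -` ball 0 r = ball 0 r" by (auto simp: norm)
    then show ?thesis using that unfolding \<mu>_def
      by (subst emeasure_distr) (auto simp: emeasure_ball DIM)
  qed
  have sf: "sigma_finite_measure \<mu>"
  proof
    show "\<exists>A. countable A \<and> A \<subseteq> sets \<mu> \<and> \<Union>A = space \<mu> \<and> (\<forall>a\<in>A. emeasure \<mu> a \<noteq> \<infinity>)"
    proof (intro exI[of _ "range (\<lambda>n::nat. ball (0::'b) (real n))"] conjI ballI)
      show "\<Union> (range (\<lambda>n::nat. ball (0::'b) (real n))) = space \<mu>"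
        by (auto simp: space reals_Archimedean2)
      show "emeasure \<mu> a \<noteq> \<infinity>" if "a \<in> range (\<lambda>n::nat. ball (0::'b) (real n))" for a
        using that by (auto simp: fB emeasure_ball)
    qed (auto simp: sets)
  qed
  interpret M: sigma_finite_measure \<mu> by (rule sf)
  interpret pair_sigma_finite \<mu> "lborel :: 'b measure" ..
  have key: "emeasure \<mu> A * emeasure lborel B = emeasure lborel A * emeasure \<mu> B"
    if [measurable]: "A \<in> sets borel" for A :: "'b set"
  proof -
    have refl: "(\<integral>\<^sup>+y. indicator A (x - y) \<partial>lborel) = emeasure lborel A" for x
    proof -
      have "lborel = distr lborel borel (\<lambda>y. x - y)"
        using lborel_affine[of "-1" x] by (simp add: density_1)
      then have "emeasure lborel A = (\<integral>\<^sup>+y. indicator A y \<partial>distr lborel borel (\<lambda>y. x - y))"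
        by simp
      also have "\<dots> = (\<integral>\<^sup>+y. indicator A (x - y) \<partial>lborel)"
        by (rule nn_integral_distr) auto
      finally show ?thesis by simp
    qed
    \<comment> \<open>The integral of 1_A(x) 1_B(x + y), with \<open>\<mu>\<close> in x and Lebesgue
      measure in y, is evaluated in both orders. In the second order x is first translated by -y
      under \<open>\<mu>\<close>, and \<open>refl\<close> then evaluates the integral over
      y.\<close>
    have "emeasure \<mu> A * emeasure lborel B = (\<integral>\<^sup>+x. indicator A x * emeasure lborel B \<partial>\<mu>)"
      by (subst nn_integral_multc) (auto simp: sets)
    also have "\<dots> = (\<integral>\<^sup>+x. (\<integral>\<^sup>+y. indicator A x * indicator B (x + y) \<partial>lborel) \<partial>\<mu>)"
    proof (intro nn_integral_cong)
      fix x
      have "(\<integral>\<^sup>+y. indicator B (x + y) \<partial>lborel) = emeasure lborel B"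
        by (subst nn_integral_lborel_translate) auto
      then show "indicator A x * emeasure lborel B = (\<integral>\<^sup>+y. indicator A x * indicator B (x + y) \<partial>lborel)"
        by (subst nn_integral_cmult) auto
    qed
    also have "\<dots> = (\<integral>\<^sup>+y. (\<integral>\<^sup>+x. indicator A x * indicator B (x + y) \<partial>\<mu>) \<partial>lborel)"
      by (rule Fubini'[symmetric]) measurable
    also have "\<dots> = (\<integral>\<^sup>+y. (\<integral>\<^sup>+x. indicator A (- y + (y + x)) * indicator B (y + x) \<partial>\<mu>) \<partial>lborel)"
      by (simp add: add.commute)
    also have "\<dots> = (\<integral>\<^sup>+y. (\<integral>\<^sup>+x. indicator A (- y + x) * indicator B x \<partial>\<mu>) \<partial>lborel)"
      by (intro nn_integral_cong trans) measurable
    also have "\<dots> = (\<integral>\<^sup>+x. (\<integral>\<^sup>+y. indicator A (x - y) * indicator B x \<partial>lborel) \<partial>\<mu>)"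
      by (subst Fubini'[symmetric]) (auto intro!: measurable)
    also have "\<dots> = (\<integral>\<^sup>+x. emeasure lborel A * indicator B x \<partial>\<mu>)"
      by (intro nn_integral_cong, subst nn_integral_multc) (auto simp: refl)
    also have "\<dots> = emeasure lborel A * emeasure \<mu> B"
      by (subst nn_integral_cmult) (auto simp: sets)
    finally show ?thesis .
  qed
  have B1: "emeasure \<mu> B = emeasure lborel B" by (simp add: B_def fB)
  have B2: "emeasure lborel B \<noteq> 0" "emeasure lborel B \<noteq> \<infinity>"
    by (simp_all add: B_def emeasure_ball unit_ball_vol_pos less_imp_neq[symmetric] unit_ball_vol_nonneg)
  show ?thesis unfolding \<mu>_def[symmetric]
  proof (rule measure_eqI)
    fix A assume "A \<in> sets \<mu>"
    then have "emeasure \<mu> A * emeasure lborel B = emeasure lborel A * emeasure lborel B"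
      using key B1 by (simp add: sets)
    then show "emeasure \<mu> A = emeasure lborel A"
      using B2 by (metis ennreal_mult_divide_eq infinity_ennreal_def)
  qed (simp add: sets)
qed

lemma distr_gauss_isometry:
  fixes f :: "'a::euclidean_space \<Rightarrow> 'a"
  assumes lin: "linear f" and norm: "\<And>x. norm (f x) = norm x" and surj: "surj f"
  shows "distr gauss borel f = gauss"
proof (rule measure_eqI)
  have [measurable]: "f \<in> borel_measurable borel"
    using lin by (simp add: borel_measurable_continuous_onI linear_continuous_on linear_conv_bounded_linear)
  fix A assume "A \<in> sets (distr gauss borel f)"
  then have [measurable]: "A \<in> sets borel" by simp
  have "emeasure (distr gauss borel f) A = (\<integral>\<^sup>+x. indicator A (f x) \<partial>gauss)"
    by (subst nn_integral_distr[symmetric, of f _ borel "indicator A"]) auto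
  also have "\<dots> = (\<integral>\<^sup>+x. ennreal (gauss_density (f x)) * indicator A (f x) \<partial>lborel)"
    by (subst nn_integral_gauss) (auto simp: gauss_density_def norm)
  also have "\<dots> = (\<integral>\<^sup>+x. ennreal (gauss_density x) * indicator A x \<partial>distr lborel borel f)"
    by (subst nn_integral_distr) auto
  also have "\<dots> = emeasure gauss A"
    unfolding distr_lborel_isometry[OF assms] by (subst nn_integral_gauss[symmetric]) auto
  finally show "emeasure (distr gauss borel f) A = emeasure gauss A" .
qed simp

section \<open>A transport inequality for the Gaussian measure\<close>

lemma std_normal_density_deriv:
  "(std_normal_density has_real_derivative - y * std_normal_density y) (at y)"
  unfolding std_normal_density_def by (auto intro!: derivative_eq_intros simp: field_simps)

lemma std_normal_density_tendsto_0:
  "(std_normal_density \<longlongrightarrow> 0) at_top" "(std_normal_density \<longlongrightarrow> 0) at_bot"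
proof -
  have "((\<lambda>x::real. 1 / sqrt (2 * pi) * exp (- x\<^sup>2 / 2)) \<longlongrightarrow> 0) at_top" 
    by real_asymp
  then show "(std_normal_density \<longlongrightarrow> 0) at_top" by (simp add: std_normal_density_def[abs_def])
  have "((\<lambda>x::real. 1 / sqrt (2 * pi) * exp (- x\<^sup>2 / 2)) \<longlongrightarrow> 0) at_bot" 
    by real_asymp
  then show "(std_normal_density \<longlongrightarrow> 0) at_bot" by (simp add: std_normal_density_def[abs_def])
qed

lemma cdf_std_normal_deriv:
  "(cdf std_normal_distribution has_real_derivative std_normal_density y) (at y)"
proof -
  interpret real_distribution std_normal_distribution by (rule real_dist_normal_dist)
  define a where "a = y - 1"
  define b where "b = y + 1"
  have cont: "continuous_on A std_normal_density" for A
    unfolding std_normal_density_def by (intro continuous_intros) auto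
  have eq: "cdf std_normal_distribution x = cdf std_normal_distribution a + integral {a..x} std_normal_density"
    if "a < x" for x
  proof -
    have int: "set_integrable lborel {a..x} std_normal_density"
      by (intro borel_integrable_atLeastAtMost' cont)
    have "measure std_normal_distribution {a<..x} = measure std_normal_distribution {a..x}"
    proof -
      have "emeasure std_normal_distribution {a<..x} = emeasure std_normal_distribution {a..x}"
        by (rule emeasure_eq_AE) 
          (auto simp: AE_density intro!: eventually_mono[OF AE_lborel_singleton[of a]])
      then show ?thesis by (simp add: measure_def)
    qed
    also have "\<dots> = (LINT t|std_normal_distribution. indicator {a..x} t)" by simp
    also have "\<dots> = (LINT t|lborel. std_normal_density t * indicator {a..x} t)"
      by (subst integral_density) auto
    also have "\<dots> = (LINT t:{a..x}|lborel. std_normal_density t)"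
      by (simp add: set_lebesgue_integral_def mult.commute)
    also have "\<dots> = integral {a..x} std_normal_density"
      by (rule set_borel_integral_eq_integral(2)[OF int])
    finally show ?thesis using cdf_diff_eq[OF that] by simp
  qed
  have "((\<lambda>x. integral {a..x} std_normal_density) has_real_derivative std_normal_density y) (at y within {a..b})"
    by (rule integral_has_real_derivative[OF cont]) (auto simp: a_def b_def)
  then have "((\<lambda>x. integral {a..x} std_normal_density) has_real_derivative std_normal_density y) (at y)"
    by (subst (asm) at_within_interior) (auto simp: a_def b_def)
  then have "((\<lambda>x. cdf std_normal_distribution a + integral {a..x} std_normal_density) has_real_derivative std_normal_density y) (at y)"
    by (auto intro!: derivative_eq_intros)
  then show ?thesis
    by (rule has_field_derivative_transform_within_open[of _ _ _ "{a<..}"])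
      (auto simp: a_def eq[unfolded a_def])
qed

lemma cdf_std_normal_bounds: "0 < cdf std_normal_distribution y" "cdf std_normal_distribution y < 1"
proof -
  interpret real_distribution std_normal_distribution by (rule real_dist_normal_dist)
  have mono: "cdf std_normal_distribution x < cdf std_normal_distribution z" if "x < z" for x z
    using that by (rule DERIV_pos_imp_increasing)
      (auto intro!: exI cdf_std_normal_deriv simp: normal_density_pos)
  show "0 < cdf std_normal_distribution y"
    using mono[of "y - 1" y] cdf_nonneg[of "y - 1"] by linarith
  show "cdf std_normal_distribution y < 1"
    using mono[of y "y + 1"] cdf_bounded_prob[of "y + 1"] by linarith
qed

text \<open>One-dimensional transport-entropy inequality in dual form.  Let \<open>T\<close> be the increasing map
  that pushes the Gaussian to \<open>f / U\<close>.  Taking logarithms in \<open>U \<cdot> \<phi>(y) = f(T y) T'(y)\<close>, using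
  \<open>ln T' \<le> T' - 1\<close> and integrating against the Gaussian gives the claim, because
  \<open>\<integral> T' \<phi> = \<integral> y T(y) \<phi>\<close> by parts.\<close>

lemma gaussian_transport_compact:
  fixes f h :: "real \<Rightarrow> real"
  assumes ab: "a < b" and cont: "continuous_on {a..b} f" and pos: "\<And>x. x \<in> {a..b} \<Longrightarrow> f x > 0"
    and h: "integrable std_normal_distribution h"
    and H: "AE y in std_normal_distribution. \<forall>x\<in>{a..b}. f x \<le> exp (h y - x * y)"
  shows "integral {a..b} f \<le> sqrt (2 * pi / exp 1) * exp (LINT y|std_normal_distribution. h y)"
proof -
  define \<phi> where "\<phi> = std_normal_density"
  define \<Gamma> where "\<Gamma> = cdf std_normal_distribution"
  define F where "F x = integral {a..x} f" for x
  define U where "U = F b"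
  have dF: "(F has_real_derivative f x) (at x within {a..b})" if "x \<in> {a..b}" for x
    unfolding F_def by (rule integral_has_real_derivative[OF cont that])
  have dF': "(F has_real_derivative f x) (at x)" if "x \<in> {a<..<b}" for x
    using dF[of x] that by (simp add: at_within_Icc_at)
  have contF: "continuous_on {a..b} F"
    by (rule DERIV_continuous_on[OF dF])
  have strict: "F x < F y" if "a \<le> x" "x < y" "y \<le> b" for x y
  proof (rule DERIV_pos_imp_increasing_open[OF that(2)])
    show "\<exists>d. (F has_real_derivative d) (at z) \<and> d > 0" if "x < z" "z < y" for z
      using that \<open>a \<le> x\<close> \<open>y \<le> b\<close> dF'[of z] pos[of z] by force
    show "continuous_on {x..y} F" using contF by (rule continuous_on_subset) (use that in auto)
  qed
  have Fa: "F a = 0" by (simp add: F_def)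
  have U: "U > 0" using strict[of a b] ab by (simp add: U_def Fa)
  have inj: "inj_on F {a..b}"
    by (rule linorder_inj_onI) (use strict in force)+
  define G where "G = the_inv_into {a..b} F"
  have GF: "G (F x) = x" if "x \<in> {a..b}" for x
    unfolding G_def by (rule the_inv_into_f_f[OF inj that])
  have img: "F ` {a..b} = {0..U}"
  proof
    show "F ` {a..b} \<subseteq> {0..U}"
    proof clarsimp
      fix x assume "a \<le> x" "x \<le> b"
      then show "0 \<le> F x \<and> F x \<le> U"
        using strict[of a x] strict[of x b] Fa by (cases "a = x"; cases "x = b") (auto simp: U_def)
    qed
    show "{0..U} \<subseteq> F ` {a..b}"
    proof
      fix v assume "v \<in> {0..U}"
      then have "\<exists>x. a \<le> x \<and> x \<le> b \<and> F x = v"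
        using ab contF by (intro IVT') (auto simp: Fa U_def)
      then show "v \<in> F ` {a..b}" by auto
    qed
  qed
  have contG: "continuous_on {0..U} G"
    unfolding img[symmetric] by (rule continuous_on_inv[OF contF compact_Icc]) (simp add: GF)
  have FG: "F (G v) = v" and G_in: "G v \<in> {a..b}" if "v \<in> {0..U}" for v
    using that GF img by (metis imageE)+
  have G_int: "G v \<in> {a<..<b}" if "v \<in> {0<..<U}" for v
  proof -
    have "G v \<noteq> a" "G v \<noteq> b" using that FG[of v] Fa by (auto simp: U_def)
    then show ?thesis using G_in[of v] that by auto
  qed
  have dG: "(G has_real_derivative inverse (f (G v))) (at v)" if v: "v \<in> {0<..<U}" for v
  proof (rule DERIV_inverse_function[where f=F and a=0 and b=U])
    show "(F has_real_derivative f (G v)) (at (G v))" by (rule dF'[OF G_int[OF v]])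
    show "f (G v) \<noteq> 0" using pos[of "G v"] G_in[of v] v by force
    show "isCont G v"
      using contG v continuous_on_interior[of "{0..U}" G v] by (simp add: interior_atLeastAtMost_real)
  qed (use v FG in auto)
  \<comment> \<open>Quantiles are matched: \<open>F (T y) = U * \<Gamma> y\<close>. Differentiating
    this equation yields \<open>T'\<close>.\<close>
  define T where "T y = G (U * \<Gamma> y)" for y
  define T' where "T' y = U * \<phi> y / f (T y)" for y
  have arg: "U * \<Gamma> y \<in> {0<..<U}" for y
    using U cdf_std_normal_bounds[of y] by (simp add: \<Gamma>_def)
  have T_int: "T y \<in> {a<..<b}" for y
    unfolding T_def by (rule G_int[OF arg])
  have fT: "f (T y) > 0" for y using pos[of "T y"] T_int[of y] by simp
  have dT: "(T has_real_derivative T' y) (at y)" for y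
  proof -
    have "((\<lambda>y. U * \<Gamma> y) has_real_derivative U * \<phi> y) (at y)"
      unfolding \<Gamma>_def \<phi>_def by (auto intro!: derivative_eq_intros cdf_std_normal_deriv)
    from DERIV_chain2[OF dG[OF arg] this] show ?thesis
      unfolding T_def[abs_def] T'_def by (simp add: T_def divide_inverse mult.commute)
  qed
  have T'_pos: "T' y > 0" for y
    unfolding T'_def using U fT[of y] by (simp add: \<phi>_def normal_density_pos)
  have contT: "isCont T y" for y using dT by (rule DERIV_isCont)
  have cont\<phi>: "isCont \<phi> y" for y
    unfolding \<phi>_def using std_normal_density_deriv by (rule DERIV_isCont)
  have contfT: "isCont (\<lambda>y. f (T y)) y" for y
  proof (rule isCont_o2[OF contT])
    show "isCont f (T y)"
      using cont T_int[of y] continuous_on_interior[of "{a..b}" f "T y"]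
      by (simp add: interior_atLeastAtMost_real)
  qed
  have contT': "isCont T' y" for y
    unfolding T'_def using fT[of y] by (intro continuous_intros contfT cont\<phi>) auto
  have meas [measurable]: "T \<in> borel_measurable borel" "T' \<in> borel_measurable borel"
    "\<phi> \<in> borel_measurable borel"
    by (auto intro!: borel_measurable_continuous_onI continuous_at_imp_continuous_on contT contT' cont\<phi>)
  \<comment> \<open>Compactness enters here: a positive lower bound for \<open>f\<close> bounds
    \<open>T'\<close>, while the values of \<open>T\<close> stay in the interval. Hence all
    integrals below converge and the boundary terms of the integration by parts vanish.\<close>
  obtain c where c: "c > 0" "\<And>x. x \<in> {a..b} \<Longrightarrow> c \<le> f x"
  proof -
    obtain z where "z \<in> {a..b}" "\<And>x. x \<in> {a..b} \<Longrightarrow> f z \<le> f x"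
      using continuous_attains_inf[of "{a..b}" f] ab cont by auto
    then show ?thesis using that[of "f z"] pos[of z] by blast
  qed
  have \<phi>_le: "\<phi> y \<le> 1" for y
  proof -
    have "1 / sqrt (2 * pi) \<le> 1" using pi_gt3 by simp
    then show ?thesis unfolding \<phi>_def std_normal_density_def
      by (metis exp_le_one_iff divide_nonpos_pos exp_ge_zero mult_le_one neg_le_0_iff_le zero_le_power2 zero_less_numeral)
  qed
  have T'_bound: "norm (T' y) \<le> U / c" for y
  proof -
    have "T' y \<le> U * 1 / c" unfolding T'_def
      by (intro frac_le mult_left_mono \<phi>_le) (use U c T_int[of y] in \<open>auto simp: \<phi>_def less_imp_le\<close>)
    then show ?thesis using T'_pos[of y] by simp
  qed
  have T_bound: "norm (T y) \<le> max \<bar>a\<bar> \<bar>b\<bar>" for y using T_int[of y] by auto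
  have intT': "integrable std_normal_distribution T'"
    by (rule std_normal.integrable_const_bound[of _ "U / c"]) (use T'_bound in auto)
  have id: "integrable std_normal_distribution (\<lambda>y. y)" "(LINT y|std_normal_distribution. y) = 0"
    using integrable_std_normal_distribution_moment[of 1] integral_std_normal_distribution_moment_odd[of 1] by auto
  have intyT: "integrable std_normal_distribution (\<lambda>y. y * T y)"
  proof (rule Bochner_Integration.integrable_bound[OF integrable_mult_right[OF id(1), of "max \<bar>a\<bar> \<bar>b\<bar>"]])
    show "AE y in std_normal_distribution. norm (y * T y) \<le> norm (max \<bar>a\<bar> \<bar>b\<bar> * y)"
      using T_bound by (intro AE_I2) (simp add: abs_mult mult.commute mult_left_mono)
  qed measurable
  have parts: "(LINT y|std_normal_distribution. T' y - y * T y) = 0"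
  proof -
    have int: "integrable std_normal_distribution (\<lambda>y. T' y - y * T y)" using intT' intyT by simp
    then have int': "integrable lborel (\<lambda>y. \<phi> y * (T' y - y * T y))"
      unfolding \<phi>_def by (subst (asm) integrable_density) auto
    have "(LINT y|std_normal_distribution. T' y - y * T y) = (LINT y|lborel. \<phi> y * (T' y - y * T y))"
      unfolding \<phi>_def by (subst integral_density) auto
    also have "\<dots> = (LBINT y=-\<infinity>..\<infinity>. \<phi> y * (T' y - y * T y))"
      by (simp add: interval_lebesgue_integral_def set_lebesgue_integral_def)
    also have "\<dots> = 0 - 0"
    proof (rule interval_integral_FTC_integrable[where F="\<lambda>y. T y * \<phi> y"])
      show "((\<lambda>y. T y * \<phi> y) has_vector_derivative \<phi> x * (T' x - x * T x)) (at x)" for x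
        unfolding has_real_derivative_iff_has_vector_derivative[symmetric] \<phi>_def
        by (rule derivative_eq_intros dT std_normal_density_deriv refl | simp add: algebra_simps)+
      show "isCont (\<lambda>y. \<phi> y * (T' y - y * T y)) x" for x
        by (intro continuous_intros cont\<phi> contT' contT)
      show "set_integrable lborel (einterval (-\<infinity>) \<infinity>) (\<lambda>y. \<phi> y * (T' y - y * T y))"
        using int' by (simp add: set_integrable_def)
      have lim: "((\<lambda>y. T y * \<phi> y) \<longlongrightarrow> 0) F" if "(\<phi> \<longlongrightarrow> 0) F" for F
      proof (rule Lim_null_comparison)
        show "\<forall>\<^sub>F y in F. norm (T y * \<phi> y) \<le> max \<bar>a\<bar> \<bar>b\<bar> * \<phi> y"
          using T_bound by (intro always_eventually) (auto simp: abs_mult \<phi>_def intro!: mult_right_mono)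
        show "((\<lambda>y. max \<bar>a\<bar> \<bar>b\<bar> * \<phi> y) \<longlongrightarrow> 0) F"
          using tendsto_mult_right_zero[OF that] .
      qed
      have "((\<lambda>y. T y * \<phi> y) \<longlongrightarrow> 0) at_bot" "((\<lambda>y. T y * \<phi> y) \<longlongrightarrow> 0) at_top"
        by (rule lim; use std_normal_density_tendsto_0 in \<open>simp add: \<phi>_def\<close>)+
      then show "(((\<lambda>y. T y * \<phi> y) \<circ> real_of_ereal) \<longlongrightarrow> 0) (at_right (-\<infinity>))"
        "(((\<lambda>y. T y * \<phi> y) \<circ> real_of_ereal) \<longlongrightarrow> 0) (at_left \<infinity>)"
        by (simp_all add: ereal_tendsto_simps1)
    qed simp_all
    finally show ?thesis by simp
  qed
  have sq: "integrable std_normal_distribution (\<lambda>y. y\<^sup>2)" "(LINT y|std_normal_distribution. y\<^sup>2) = 1"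
    using std_normal_distribution_even_moments[of 1] by auto
  \<comment> \<open>The 1 comes from ln T' \<le> T' - 1, and y^2/2 has Gaussian mean 1/2. The
    difference 1/2 is what turns sqrt (2 pi) into sqrt (2 pi / e).\<close>
  define C where "C = ln U + 1 - ln (2 * pi) / 2"
  have "(LINT y|std_normal_distribution. C - y\<^sup>2 / 2) \<le> (LINT y|std_normal_distribution. h y + (T' y - y * T y))"
  proof (rule integral_mono_AE)
    show "integrable std_normal_distribution (\<lambda>y. C - y\<^sup>2 / 2)" using sq by simp
    show "integrable std_normal_distribution (\<lambda>y. h y + (T' y - y * T y))" using h intT' intyT by simp
    show "AE y in std_normal_distribution. C - y\<^sup>2 / 2 \<le> h y + (T' y - y * T y)"
      using H
    proof eventually_elim
      case (elim y)
      then have "f (T y) \<le> exp (h y - T y * y)" using T_int[of y] by auto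
      then have "ln (f (T y)) \<le> ln (exp (h y - T y * y))" using fT[of y] by (subst ln_le_cancel_iff) auto
      then have "ln (f (T y)) \<le> h y - T y * y" by simp
      moreover have "ln (T' y) \<le> T' y - 1" using T'_pos[of y] by (rule ln_le_minus_one)
      moreover have "ln (T' y) = ln U + ln (\<phi> y) - ln (f (T y))"
        unfolding T'_def using U fT[of y] by (simp add: ln_div ln_mult \<phi>_def normal_density_pos less_imp_neq[THEN not_sym])
      moreover have "ln (\<phi> y) = - ln (2 * pi) / 2 - y\<^sup>2 / 2"
        by (simp add: \<phi>_def std_normal_density_def ln_mult ln_div ln_sqrt field_simps)
      ultimately show ?case by (simp add: C_def algebra_simps)
    qed
  qed
  also have "\<dots> = (LINT y|std_normal_distribution. h y)"
    using h intT' intyT parts by simp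
  finally have "C - 1/2 \<le> (LINT y|std_normal_distribution. h y)" (is "_ \<le> ?I")
    using sq std_normal.prob_space by simp
  then have "ln U \<le> (ln (2 * pi) - 1) / 2 + ?I" by (simp add: C_def field_simps)
  then have "U \<le> exp ((ln (2 * pi) - 1) / 2 + ?I)"
    using U by (metis exp_le_cancel_iff exp_ln)
  also have "\<dots> = sqrt (2 * pi / exp 1) * exp ?I"
  proof -
    have "exp ((ln (2 * pi) - 1) / 2) = sqrt (exp (ln (2 * pi) - 1))"
      by (rule real_sqrt_unique[symmetric]) (auto simp: power2_eq_square exp_add[symmetric])
    also have "exp (ln (2 * pi) - 1) = 2 * pi / exp 1" by (simp add: exp_diff)
    finally show ?thesis by (simp add: exp_add)
  qed
  finally show ?thesis by (simp add: U_def F_def)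
qed


text \<open>An open interval is exhausted by the compact intervals spanned by the first n terms of
  an enumeration of its rationals. This treats bounded and unbounded endpoints alike.\<close>

lemma nn_integral_open_convex_le:
  fixes f :: "real \<Rightarrow> ennreal"
  assumes I: "open I" "convex I" and [measurable]: "f \<in> borel_measurable borel"
    and bound: "\<And>a b. a < b \<Longrightarrow> {a..b} \<subseteq> I \<Longrightarrow> (\<integral>\<^sup>+x\<in>{a..b}. f x \<partial>lborel) \<le> C"
  shows "(\<integral>\<^sup>+x\<in>I. f x \<partial>lborel) \<le> C"
proof (cases "I = {}")
  case False
  have "I \<inter> \<rat> \<noteq> {}"
  proof -
    obtain x where "x \<in> I" using False by blast
    then obtain e where e: "e > 0" "ball x e \<subseteq> I" using I(1) by (auto simp: open_contains_ball)
    obtain r where r: "r \<in> \<rat>" "x - e < r" "r < x" using Rats_dense_in_real[of "x - e" x] e by auto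
    then have "r \<in> I" using e(2) by (auto simp: subset_iff dist_real_def)
    then show ?thesis using r by auto
  qed
  moreover have "countable (I \<inter> \<rat>)" by (simp add: countable_rat countable_Int2)
  ultimately obtain q :: "nat \<Rightarrow> real" where q: "range q = I \<inter> \<rat>"
    by (metis range_from_nat_into)
  define a where "a n = Min (q ` {..n})" for n
  define b where "b n = Max (q ` {..n})" for n
  have in_I: "{a n..b n} \<subseteq> I" for n
  proof -
    have "a n \<in> q ` {..n}" "b n \<in> q ` {..n}" unfolding a_def b_def by (auto intro!: Min_in Max_in)
    then have "a n \<in> I" "b n \<in> I" using q by auto
    then show ?thesis using I(2)
      by (metis atLeastatMost_empty_iff2 closed_segment_eq_real_ivl convex_contains_segment empty_subsetI linorder_le_cases order.refl)
  qed
  have le: "a n \<le> q k" "q k \<le> b n" if "k \<le> n" for k n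
    using that by (auto simp: a_def b_def)
  have mono: "{a m..b m} \<subseteq> {a n..b n}" if "m \<le> n" for m n
  proof -
    have "a n \<le> a m" "b m \<le> b n"
      unfolding a_def b_def using that by (auto intro!: Min_antimono Max_mono)
    then show ?thesis by auto
  qed
  have union: "(\<Union>n. {a n..b n}) = I"
  proof
    show "I \<subseteq> (\<Union>n. {a n..b n})"
    proof
      fix x assume "x \<in> I"
      then obtain e where e: "e > 0" "ball x e \<subseteq> I" using I(1) by (auto simp: open_contains_ball)
      obtain r where r: "r \<in> \<rat>" "x - e < r" "r < x" using Rats_dense_in_real[of "x - e" x] e by auto
      obtain s where s: "s \<in> \<rat>" "x < s" "s < x + e" using Rats_dense_in_real[of x "x + e"] e by auto
      have "r \<in> I" "s \<in> I" using e(2) r s by (auto simp: subset_iff dist_real_def)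
      then obtain i j where "q i = r" "q j = s" using q r s by (metis IntI imageE)
      then have "x \<in> {a (max i j)..b (max i j)}"
        using le[of i "max i j"] le[of j "max i j"] r s by auto
      then show "x \<in> (\<Union>n. {a n..b n})" by blast
    qed
  qed (use in_I in blast)
  have "(\<integral>\<^sup>+x\<in>I. f x \<partial>lborel) = (\<integral>\<^sup>+x. (SUP n. f x * indicator {a n..b n} x) \<partial>lborel)"
  proof (intro nn_integral_cong)
    fix x
    have "indicator I x = (SUP n. indicator {a n..b n} x :: ennreal)"
      unfolding union[symmetric]
    proof (rule antisym)
      show "indicator (\<Union>n. {a n..b n}) x \<le> (SUP n. indicator {a n..b n} x :: ennreal)"
      proof (cases "x \<in> (\<Union>n. {a n..b n})")
        case True
        then obtain n where "x \<in> {a n..b n}" by blast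
        then show ?thesis by (intro SUP_upper2[of n]) (auto split: split_indicator)
      qed simp
    qed (auto intro!: SUP_least split: split_indicator)
    then show "f x * indicator I x = (SUP n. f x * indicator {a n..b n} x)"
      by (simp add: SUP_mult_left_ennreal)
  qed
  also have "\<dots> = (SUP n. \<integral>\<^sup>+x\<in>{a n..b n}. f x \<partial>lborel)"
  proof (rule nn_integral_monotone_convergence_SUP)
    show "incseq (\<lambda>n x. f x * indicator {a n..b n} x)"
      using mono by (auto simp: incseq_def le_fun_def subset_iff split: split_indicator)
  qed measurable
  also have "\<dots> \<le> C"
  proof (rule SUP_least)
    fix n
    show "(\<integral>\<^sup>+x\<in>{a n..b n}. f x \<partial>lborel) \<le> C"
    proof (cases "a n < b n")
      case True
      then show ?thesis by (rule bound[OF _ in_I])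
    next
      case False
      then have "{a n..b n} \<subseteq> {a n}" by auto
      then have "(\<integral>\<^sup>+x\<in>{a n..b n}. f x \<partial>lborel) \<le> (\<integral>\<^sup>+x\<in>{a n}. f x \<partial>lborel)"
        by (intro nn_integral_mono) (auto simp: subset_iff split: split_indicator)
      also have "\<dots> = 0"
        by (subst nn_integral_0_iff_AE) (auto intro!: eventually_mono[OF AE_lborel_singleton[of "a n"]])
      finally show ?thesis by simp
    qed
  qed
  finally show ?thesis .
qed simp

text \<open>The function \<open>u\<close> is dominated by exp (-w), where w is the Legendre
  transform of \<open>g\<close>. Being convex, w is continuous in the interior of its domain, and
  the frontier of the domain is a null set, so the compact case applies to exp (-w) on compact
  subintervals. Infinite values of \<open>g\<close> are allowed because partial integrals in the
  product argument may be infinite.\<close>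

lemma gaussian_transport_real:
  fixes u g :: "real \<Rightarrow> ennreal"
  assumes [measurable]: "g \<in> borel_measurable borel" "u \<in> borel_measurable borel"
    and H: "\<And>x y. g y \<noteq> \<infinity> \<Longrightarrow> u x \<le> ennreal (exp (enn2real (g y) - x * y))"
    and fin: "(\<integral>\<^sup>+y. g y \<partial>std_normal_distribution) \<noteq> \<infinity>"
  shows "(\<integral>\<^sup>+x. u x \<partial>lborel)
    \<le> ennreal (sqrt (2 * pi / exp 1) * exp (enn2real (\<integral>\<^sup>+y. g y \<partial>std_normal_distribution)))"
    (is "_ \<le> ?C")
proof -
  define D where "D = {y. g y \<noteq> \<infinity>}"
  define h where "h y = enn2real (g y)" for y
  have AE_D: "AE y in std_normal_distribution. y \<in> D"
    using nn_integral_PInf_AE[OF _ fin] unfolding D_def by auto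
  have "D \<noteq> {}"
    using AE_D std_normal.AE_False by auto
  have h: "integrable std_normal_distribution h"
    "(LINT y|std_normal_distribution. h y) = enn2real (\<integral>\<^sup>+y. g y \<partial>std_normal_distribution)"
  proof -
    have [measurable]: "h \<in> borel_measurable borel" unfolding h_def by measurable
    have "(\<integral>\<^sup>+y. ennreal (h y) \<partial>std_normal_distribution) = (\<integral>\<^sup>+y. g y \<partial>std_normal_distribution)"
      using AE_D by (intro nn_integral_cong_AE) (auto elim!: eventually_mono simp: D_def h_def top.not_eq_extremum)
    moreover have "\<dots> = ennreal (enn2real (\<integral>\<^sup>+y. g y \<partial>std_normal_distribution))"
      using fin by (simp add: top.not_eq_extremum)
    ultimately have "has_bochner_integral std_normal_distribution h (enn2real (\<integral>\<^sup>+y. g y \<partial>std_normal_distribution))"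
      by (intro has_bochner_integral_nn_integral) (auto simp: h_def)
    then show "integrable std_normal_distribution h"
      "(LINT y|std_normal_distribution. h y) = enn2real (\<integral>\<^sup>+y. g y \<partial>std_normal_distribution)"
      by (auto simp: has_bochner_integral_iff)
  qed
  \<comment> \<open>\<open>J\<close> is the domain where the Legendre transform \<open>w\<close> is
    finite. Off \<open>J\<close> the hypothesis forces \<open>u\<close> to vanish, since a positive
    value would bound the supremum.\<close>
  define J where "J = {x. bdd_above ((\<lambda>y. x * y - h y) ` D)}"
  define w where "w x = (SUP y\<in>D. x * y - h y)" for x
  have w_ge: "x * y - h y \<le> w x" if "x \<in> J" "y \<in> D" for x y
    unfolding w_def using that by (intro cSUP_upper) (auto simp: J_def)
  have conv: "convex J \<and> convex_on J w"
  proof -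
    have *: "(s * x + t * x') * y - h y \<le> s * w x + t * w x'"
      if "s \<ge> 0" "t \<ge> 0" "s + t = 1" "x \<in> J" "x' \<in> J" "y \<in> D" for s t x x' y
    proof -
      have "(s * x + t * x') * y - h y = s * (x * y - h y) + t * (x' * y - h y) + (s + t - 1) * h y"
        by (simp add: algebra_simps)
      also have "\<dots> \<le> s * w x + t * w x'"
        using that by (simp add: add_mono mult_left_mono w_ge)
      finally show ?thesis .
    qed
    have J: "convex J"
      unfolding convex_def
    proof (intro ballI allI impI)
      fix x x' s t :: real assume "x \<in> J" "x' \<in> J" "0 \<le> s" "0 \<le> t" "s + t = 1"
      then show "s *\<^sub>R x + t *\<^sub>R x' \<in> J"
        using * unfolding J_def by (auto intro!: bdd_aboveI[of _ "s * w x + t * w x'"] simp: J_def)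
    qed
    moreover have "convex_on J w"
      unfolding convex_on_def
    proof (intro conjI ballI allI impI J)
      fix x x' s t :: real assume "x \<in> J" "x' \<in> J" "0 \<le> s" "0 \<le> t" "s + t = 1"
      then show "w (s *\<^sub>R x + t *\<^sub>R x') \<le> s * w x + t * w x'"
        unfolding w_def[of "s *\<^sub>R x + t *\<^sub>R x'"]
        using \<open>D \<noteq> {}\<close> * by (intro cSUP_least) auto
    qed
    ultimately show ?thesis ..
  qed
  define I where "I = interior J"
  have I: "open I" "convex I" "I \<subseteq> J" using conv by (auto simp: I_def convex_interior interior_subset)
  have contw: "continuous_on I w"
    using conv I by (intro convex_on_continuous) (auto intro: convex_on_subset)
  have u_le: "u x \<le> ennreal (exp (- w x))" if x: "x \<in> J" for x
  proof (cases "u x = 0")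
    case False
    have fin_u: "u x \<noteq> \<infinity>"
    proof -
      obtain y where "y \<in> D" using \<open>D \<noteq> {}\<close> by blast
      then have "u x \<le> ennreal (exp (h y - x * y))" using H[of y x] by (auto simp: D_def h_def)
      then show ?thesis by (auto simp: top_unique)
    qed
    define c where "c = enn2real (u x)"
    have c: "u x = ennreal c" "c > 0"
      using fin_u False by (auto simp: c_def top.not_eq_extremum enn2real_positive_iff zero_less_iff_neq_zero)
    have "x * y - h y \<le> - ln c" if "y \<in> D" for y
    proof -
      have "ennreal c \<le> ennreal (exp (h y - x * y))" using H[of y x] that c by (auto simp: D_def h_def)
      then have "c \<le> exp (h y - x * y)" by simp
      then have "ln c \<le> ln (exp (h y - x * y))" using c by (subst ln_le_cancel_iff) auto
      then show ?thesis by simp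
    qed
    then have "w x \<le> - ln c" unfolding w_def using \<open>D \<noteq> {}\<close> by (intro cSUP_least) auto
    then have "exp (ln c) \<le> exp (- w x)" by simp
    then show ?thesis using c by (simp add: ennreal_leI)
  qed simp
  have u_0: "u x = 0" if x: "x \<notin> J" for x
  proof (rule ccontr)
    assume nz: "u x \<noteq> 0"
    obtain c where c: "0 < c" "ennreal c \<le> u x"
    proof (cases "u x")
      case (real r)
      then show ?thesis using nz that[of r] by (auto simp: less_le)
    next
      case top
      then show ?thesis using that[of 1] by simp
    qed
    have "x * y - h y \<le> - ln c" if "y \<in> D" for y
    proof -
      have "u x \<le> ennreal (exp (h y - x * y))"
        using H[of y x] that by (auto simp: D_def h_def)
      with c(2) have "ennreal c \<le> ennreal (exp (h y - x * y))" by (rule order_trans)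
      then have "c \<le> exp (h y - x * y)" by simp
      then have "ln c \<le> ln (exp (h y - x * y))" using c by (subst ln_le_cancel_iff) auto
      then show ?thesis by simp
    qed
    then show False using x by (auto simp: J_def intro!: bdd_aboveI[of _ "- ln c"])
  qed
  have "negligible (frontier J)" using conv by (intro negligible_convex_frontier) auto
  then have "frontier J \<in> null_sets lborel"
    by (simp add: negligible_iff_null_sets null_sets_completion_iff)
  then have AE_fr: "AE x in lborel. x \<notin> frontier J" by (rule AE_not_in)
  define F where "F x = ennreal (exp (- w x)) * indicator I x" for x
  have [measurable]: "F \<in> borel_measurable borel"
  proof -
    have "(\<lambda>x. indicator I x *\<^sub>R exp (- w x)) \<in> borel_measurable borel"
      using contw I(1) by (intro borel_measurable_continuous_on_indicator continuous_intros) auto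
    then have "(\<lambda>x. ennreal (indicator I x *\<^sub>R exp (- w x))) \<in> borel_measurable borel" by measurable
    also have "(\<lambda>x. ennreal (indicator I x *\<^sub>R exp (- w x))) = F"
      by (auto simp: F_def split: split_indicator)
    finally show ?thesis .
  qed
  have "(\<integral>\<^sup>+x. u x \<partial>lborel) \<le> (\<integral>\<^sup>+x\<in>I. F x \<partial>lborel)"
  proof (rule nn_integral_mono_AE)
    show "AE x in lborel. u x \<le> F x * indicator I x"
      using AE_fr
    proof eventually_elim
      case (elim x)
      show ?case
      proof (cases "x \<in> J")
        case True
        then have "x \<in> I" using elim closure_subset[of J] by (auto simp: frontier_def I_def)
        then show ?thesis using u_le[OF True] by (simp add: F_def)
      qed (simp add: u_0)
    qed
  qed
  also have "\<dots> \<le> ?C"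
  proof (rule nn_integral_open_convex_le[OF I(1,2)])
    fix a b :: real assume ab: "a < b" "{a..b} \<subseteq> I"
    have cont: "continuous_on {a..b} (\<lambda>x. exp (- w x))"
      using contw ab(2) by (intro continuous_intros) (auto intro: continuous_on_subset)
    have "(\<integral>\<^sup>+x\<in>{a..b}. F x \<partial>lborel) = (\<integral>\<^sup>+x. ennreal (indicator {a..b} x * exp (- w x)) \<partial>lborel)"
      using ab(2) by (intro nn_integral_cong) (auto simp: F_def split: split_indicator)
    also have "\<dots> = ennreal (LINT x:{a..b}|lborel. exp (- w x))"
      unfolding set_lebesgue_integral_def
      using borel_integrable_atLeastAtMost'[OF cont]
      by (subst nn_integral_eq_integral) (auto simp: set_integrable_def)
    also have "(LINT x:{a..b}|lborel. exp (- w x)) = integral {a..b} (\<lambda>x. exp (- w x))"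
      by (rule set_borel_integral_eq_integral(2)[OF borel_integrable_atLeastAtMost'[OF cont]])
    also have "ennreal \<dots> \<le> ennreal (sqrt (2 * pi / exp 1) * exp (LINT y|std_normal_distribution. h y))"
    proof (intro ennreal_leI gaussian_transport_compact[OF ab(1) cont _ h(1)])
      show "AE y in std_normal_distribution. \<forall>x\<in>{a..b}. exp (- w x) \<le> exp (h y - x * y)"
        using AE_D
      proof eventually_elim
        case (elim y)
        show ?case
        proof
          fix x assume "x \<in> {a..b}"
          then have "x * y - h y \<le> w x" using elim w_ge ab(2) I(3) by blast
          then show "exp (- w x) \<le> exp (h y - x * y)" by simp
        qed
      qed
    qed simp
    finally show "(\<integral>\<^sup>+x\<in>{a..b}. F x \<partial>lborel) \<le> ?C" by (simp add: h(2))
  qed measurable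
  finally show ?thesis .
qed

section \<open>Tensorisation of the transport inequality\<close>

interpretation lborel_prod: product_sigma_finite "\<lambda>_. lborel :: real measure"
  by standard

interpretation std_normal_prod: product_sigma_finite "\<lambda>_. std_normal_distribution"
  using real_dist_normal_dist
  by (auto intro!: product_sigma_finite.intro prob_space_imp_sigma_finite simp: real_distribution_def)

text \<open>Induction on coordinates in the style of the Prekopa-Leindler inequality: the
  one-dimensional case on each slice shows that the partial integrals of \<open>u\<close> and
  \<open>g\<close> satisfy the same hypothesis, up to the one-dimensional constant.\<close>

lemma gaussian_transport_PiM:
  fixes u g :: "('i \<Rightarrow> real) \<Rightarrow> ennreal"
  assumes "finite A"
    and "g \<in> borel_measurable (PiM A (\<lambda>_. borel))" "u \<in> borel_measurable (PiM A (\<lambda>_. borel))"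
    and "\<And>x y. x \<in> extensional A \<Longrightarrow> y \<in> extensional A \<Longrightarrow> g y \<noteq> \<infinity> \<Longrightarrow>
       u x \<le> ennreal (exp (enn2real (g y) - (\<Sum>i\<in>A. x i * y i)))"
    and "(\<integral>\<^sup>+y. g y \<partial>PiM A (\<lambda>_. std_normal_distribution)) \<noteq> \<infinity>"
  shows "(\<integral>\<^sup>+x. u x \<partial>PiM A (\<lambda>_. lborel))
    \<le> ennreal (sqrt (2 * pi / exp 1) ^ card A * exp (enn2real (\<integral>\<^sup>+y. g y \<partial>PiM A (\<lambda>_. std_normal_distribution))))"
  using assms
proof (induction A arbitrary: u g rule: finite_induct)
  case empty
  have "(\<lambda>_. undefined) \<in> extensional {}" by simp
  moreover have "(\<integral>\<^sup>+y. g y \<partial>PiM {} (\<lambda>_. std_normal_distribution)) = g (\<lambda>_. undefined)"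
    "(\<integral>\<^sup>+x. u x \<partial>PiM {} (\<lambda>_. lborel)) = u (\<lambda>_. undefined)"
    by (simp_all add: PiM_empty nn_integral_count_space_finite)
  ultimately show ?case using empty(3,4) by simp
next
  case (insert i A)
  note [measurable] = insert.prems(1,2)
  have sN: "sets std_normal_distribution = sets borel" by simp
  have [measurable_cong]: "sets (PiM B (\<lambda>_. std_normal_distribution)) = sets (PiM B (\<lambda>_. borel))"
    "sets (PiM B (\<lambda>_. lborel :: real measure)) = sets (PiM B (\<lambda>_. borel))" for B :: "'i set"
    by (auto intro!: sets_PiM_cong)
  define c where "c = sqrt (2 * pi / exp 1)"
  have c: "c \<ge> 0" by (simp add: c_def)
  define g' where "g' y = (\<integral>\<^sup>+t. g (y(i := t)) \<partial>std_normal_distribution)" for y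
  define u' where "u' x = (\<integral>\<^sup>+s. u (x(i := s)) \<partial>lborel)" for x
  have [measurable]: "(\<lambda>(x, s). g (x(i := s))) \<in> borel_measurable (PiM A (\<lambda>_. borel) \<Otimes>\<^sub>M borel)"
    "(\<lambda>(x, s). u (x(i := s))) \<in> borel_measurable (PiM A (\<lambda>_. borel) \<Otimes>\<^sub>M borel)"
    by measurable
  have [measurable]: "g' \<in> borel_measurable (PiM A (\<lambda>_. borel))" 
    "u' \<in> borel_measurable (PiM A (\<lambda>_. borel))"
    unfolding g'_def u'_def by measurable
  have ext: "x(i := s) \<in> extensional (insert i A)" if "x \<in> extensional A" for x and s :: real
    using that by (auto simp: extensional_def)
  have Ig: "(\<integral>\<^sup>+y. g y \<partial>PiM (insert i A) (\<lambda>_. std_normal_distribution))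
      = (\<integral>\<^sup>+y. g' y \<partial>PiM A (\<lambda>_. std_normal_distribution))"
    unfolding g'_def using insert by (intro std_normal_prod.product_nn_integral_insert) auto
  have Iu: "(\<integral>\<^sup>+y. u y \<partial>PiM (insert i A) (\<lambda>_. lborel)) = (\<integral>\<^sup>+y. u' y \<partial>PiM A (\<lambda>_. lborel))"
    unfolding u'_def using insert by (intro lborel_prod.product_nn_integral_insert) auto
  have sum: "(\<Sum>j\<in>insert i A. (x(i := s)) j * (y(i := t)) j) = s * t + (\<Sum>j\<in>A. x j * y j)" for x y and s t :: real
    using insert.hyps by (simp, intro sum.cong) auto
  have slice: "u' x \<le> ennreal (c * exp (enn2real (g' y) - (\<Sum>j\<in>A. x j * y j)))"
    if x: "x \<in> extensional A" and y: "y \<in> extensional A" and fin: "g' y \<noteq> \<infinity>" for x y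
  proof -
    define k where "k = (\<Sum>j\<in>A. x j * y j)"
    have xs: "x \<in> space (PiM A (\<lambda>_. borel))" "y \<in> space (PiM A (\<lambda>_. borel))"
      using x y by (auto simp: space_PiM PiE_def)
    have [measurable]: "(\<lambda>s. u (x(i := s))) \<in> borel_measurable borel" "(\<lambda>s. g (y(i := s))) \<in> borel_measurable borel"
      using measurable_comp[OF measurable_component_update insert.prems(2), OF xs(1) insert.hyps(2)]
        measurable_comp[OF measurable_component_update insert.prems(1), OF xs(2) insert.hyps(2)]
      by (auto simp: comp_def fun_upd_def)
    \<comment> \<open>For fixed \<open>x\<close> and \<open>y\<close> the pairing in the remaining
      coordinates is the constant \<open>k\<close>. The factor exp k cancels it and leaves the
      hypothesis of the one-dimensional inequality in coordinate \<open>i\<close>.\<close>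
    have "(\<integral>\<^sup>+s. ennreal (exp k) * u (x(i := s)) \<partial>lborel) \<le> ennreal (c * exp (enn2real (g' y)))"
      unfolding c_def g'_def
    proof (rule gaussian_transport_real)
      fix s t assume t: "g (y(i := t)) \<noteq> \<infinity>"
      have "u (x(i := s)) \<le> ennreal (exp (enn2real (g (y(i := t))) - (s * t + k)))"
        using insert.prems(3)[OF ext[OF x] ext[OF y] t, of s] unfolding sum k_def .
      then have "ennreal (exp k) * u (x(i := s)) \<le> ennreal (exp k) * ennreal (exp (enn2real (g (y(i := t))) - (s * t + k)))"
        by (rule mult_left_mono) simp
      also have "\<dots> = ennreal (exp (enn2real (g (y(i := t))) - s * t))"
        by (simp add: ennreal_mult[symmetric] exp_add[symmetric] algebra_simps)
      finally show "ennreal (exp k) * u (x(i := s)) \<le> ennreal (exp (enn2real (g (y(i := t))) - s * t))" .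
    qed (use fin in \<open>auto simp: g'_def\<close>)
    then have "ennreal (exp k) * u' x \<le> ennreal (c * exp (enn2real (g' y)))"
      by (simp add: u'_def nn_integral_cmult)
    then have "ennreal (exp (- k)) * (ennreal (exp k) * u' x) \<le> ennreal (exp (- k)) * ennreal (c * exp (enn2real (g' y)))"
      by (rule mult_left_mono) simp
    moreover have "ennreal (exp (- k)) * (ennreal (exp k) * u' x) = u' x"
      by (simp add: mult.assoc[symmetric] ennreal_mult[symmetric] exp_add[symmetric])
    moreover have "ennreal (exp (- k)) * ennreal (c * exp (enn2real (g' y))) = ennreal (c * exp (enn2real (g' y) - k))"
      using c by (simp add: ennreal_mult[symmetric] exp_diff exp_minus field_simps)
    ultimately show ?thesis by (simp add: k_def)
  qed
  have "c > 0" by (simp add: c_def)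
  \<comment> \<open>Division by \<open>c\<close> restores the exact form of the hypothesis; the
    factor returns at the end as the contribution of coordinate \<open>i\<close> to the power of
    \<open>c\<close>.\<close>
  have "(\<integral>\<^sup>+x. ennreal (1 / c) * u' x \<partial>PiM A (\<lambda>_. lborel))
     \<le> ennreal (c ^ card A * exp (enn2real (\<integral>\<^sup>+y. g' y \<partial>PiM A (\<lambda>_. std_normal_distribution))))"
    unfolding c_def
  proof (rule insert.IH)
    fix x y :: "'i \<Rightarrow> real" assume xy: "x \<in> extensional A" "y \<in> extensional A" "g' y \<noteq> \<infinity>"
    have "ennreal (1 / c) * u' x \<le> ennreal (1 / c) * ennreal (c * exp (enn2real (g' y) - (\<Sum>j\<in>A. x j * y j)))"
      by (rule mult_left_mono[OF slice[OF xy]]) simp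
    also have "\<dots> = ennreal (exp (enn2real (g' y) - (\<Sum>j\<in>A. x j * y j)))"
      using \<open>c > 0\<close> by (simp add: ennreal_mult[symmetric])
    finally show "ennreal (1 / sqrt (2 * pi / exp 1)) * u' x \<le> ennreal (exp (enn2real (g' y) - (\<Sum>j\<in>A. x j * y j)))"
      by (simp add: c_def)
  qed (use insert.prems(4) in \<open>auto simp: Ig\<close>)
  then have "ennreal (1 / c) * (\<integral>\<^sup>+x. u' x \<partial>PiM A (\<lambda>_. lborel))
     \<le> ennreal (c ^ card A * exp (enn2real (\<integral>\<^sup>+y. g' y \<partial>PiM A (\<lambda>_. std_normal_distribution))))"
    by (subst (asm) nn_integral_cmult) auto
  then have "ennreal c * (ennreal (1 / c) * (\<integral>\<^sup>+x. u' x \<partial>PiM A (\<lambda>_. lborel)))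
     \<le> ennreal c * ennreal (c ^ card A * exp (enn2real (\<integral>\<^sup>+y. g' y \<partial>PiM A (\<lambda>_. std_normal_distribution))))"
    by (rule mult_left_mono) simp
  moreover have "ennreal c * (ennreal (1 / c) * X) = X" for X
    using \<open>c > 0\<close> by (simp add: mult.assoc[symmetric] ennreal_mult[symmetric])
  moreover have "ennreal c * ennreal (c ^ card A * exp r) = ennreal (c ^ card (insert i A) * exp r)" for r
    using \<open>c > 0\<close> insert.hyps by (simp add: ennreal_mult[symmetric] mult.assoc)
  ultimately show ?case by (simp add: Ig Iu c_def)
qed

section \<open>Volume radius\<close>

lemma PiM_density:
  fixes \<phi> :: "'b::euclidean_space \<Rightarrow> real"
  assumes [simp]: "finite A" and [measurable]: "\<phi> \<in> borel_measurable borel" and nn: "\<And>x. 0 \<le> \<phi> x"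
    and prob: "prob_space (density lborel (\<lambda>x. ennreal (\<phi> x)))"
  shows "PiM A (\<lambda>_. density lborel (\<lambda>x. ennreal (\<phi> x)))
    = density (PiM A (\<lambda>_. lborel)) (\<lambda>f. ennreal (\<Prod>i\<in>A. \<phi> (f i)))"
proof -
  define N where "N = density lborel (\<lambda>x. ennreal (\<phi> x))"
  have [simp]: "sets N = sets borel" by (simp add: N_def)
  interpret L: product_sigma_finite "\<lambda>_. lborel :: 'b measure" by standard
  interpret P: product_sigma_finite "\<lambda>_. N"
    using prob by (intro product_sigma_finite.intro prob_space_imp_sigma_finite) (simp add: N_def)
  have "density (PiM A (\<lambda>_. lborel)) (\<lambda>f. ennreal (\<Prod>i\<in>A. \<phi> (f i))) = PiM A (\<lambda>_. N)"
  proof (rule P.PiM_eqI)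
    show "sets (density (PiM A (\<lambda>_. lborel)) (\<lambda>f. ennreal (\<Prod>i\<in>A. \<phi> (f i)))) = sets (PiM A (\<lambda>_. N))"
      by (auto intro!: sets_PiM_cong)
    fix X assume "\<And>i. i \<in> A \<Longrightarrow> X i \<in> sets N"
    then have X [measurable]: "\<And>i. i \<in> A \<Longrightarrow> X i \<in> sets borel" by simp
    have [measurable]: "Pi\<^sub>E A X \<in> sets (PiM A (\<lambda>_. lborel))"
      by (rule sets_PiM_I_finite) (auto simp: X)
    have "emeasure (density (PiM A (\<lambda>_. lborel)) (\<lambda>f. ennreal (\<Prod>i\<in>A. \<phi> (f i)))) (Pi\<^sub>E A X)
       = (\<integral>\<^sup>+f. ennreal (\<Prod>i\<in>A. \<phi> (f i)) * indicator (Pi\<^sub>E A X) f \<partial>PiM A (\<lambda>_. lborel))"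
      by (rule emeasure_density) measurable
    also have "\<dots> = (\<integral>\<^sup>+f. (\<Prod>i\<in>A. ennreal (\<phi> (f i)) * indicator (X i) (f i)) \<partial>PiM A (\<lambda>_. lborel))"
    proof (intro nn_integral_cong)
      fix f assume f: "f \<in> space (PiM A (\<lambda>_. lborel :: 'b measure))"
      have "indicator (Pi\<^sub>E A X) f = (\<Prod>i\<in>A. indicator (X i) (f i) :: ennreal)"
      proof (cases "f \<in> Pi\<^sub>E A X")
        case False
        then obtain i where "i \<in> A" "f i \<notin> X i" using f by (auto simp: space_PiM PiE_def)
        then have "(\<Prod>i\<in>A. indicator (X i) (f i) :: ennreal) = 0" by (intro prod_zero bexI[of _ i]) auto
        then show ?thesis using False by simp
      qed (auto simp: PiE_def Pi_def intro!: prod.neutral[symmetric])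
      then show "ennreal (\<Prod>i\<in>A. \<phi> (f i)) * indicator (Pi\<^sub>E A X) f
          = (\<Prod>i\<in>A. ennreal (\<phi> (f i)) * indicator (X i) (f i))"
        by (simp add: prod.distrib prod_ennreal nn)
    qed
    also have "\<dots> = (\<Prod>i\<in>A. \<integral>\<^sup>+t. ennreal (\<phi> t) * indicator (X i) t \<partial>lborel)"
      by (rule L.product_nn_integral_prod) auto
    also have "\<dots> = (\<Prod>i\<in>A. emeasure N (X i))"
      by (intro prod.cong refl) (auto simp: emeasure_density N_def)
    finally show "emeasure (density (PiM A (\<lambda>_. lborel)) (\<lambda>f. ennreal (\<Prod>i\<in>A. \<phi> (f i)))) (Pi\<^sub>E A X)
        = (\<Prod>i\<in>A. emeasure N (X i))" .
  qed simp
  then show ?thesis by (simp add: N_def)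
qed

lemma Basis_sum_inner:
  "b \<in> Basis \<Longrightarrow> (\<Sum>c\<in>Basis. f c *\<^sub>R c) \<bullet> b = f (b :: 'a::euclidean_space)"
  by (simp add: inner_sum_left inner_Basis if_distrib cong: if_cong)

lemma nn_integral_gauss_PiM:
  fixes g :: "'a::euclidean_space \<Rightarrow> ennreal"
  assumes [measurable]: "g \<in> borel_measurable borel"
  shows "(\<integral>\<^sup>+x. g x \<partial>gauss) = (\<integral>\<^sup>+f. g (\<Sum>b\<in>Basis. f b *\<^sub>R b) \<partial>PiM Basis (\<lambda>_. std_normal_distribution))"
proof -
  have "(\<integral>\<^sup>+x. g x \<partial>gauss) = (\<integral>\<^sup>+f. ennreal (gauss_density (\<Sum>b\<in>Basis. f b *\<^sub>R b :: 'a)) * g (\<Sum>b\<in>Basis. f b *\<^sub>R b)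
      \<partial>PiM Basis (\<lambda>_. lborel))"
    by (subst nn_integral_gauss, simp, subst lborel_eq, subst nn_integral_distr) auto
  also have "\<dots> = (\<integral>\<^sup>+f. g (\<Sum>b\<in>Basis. f b *\<^sub>R b) \<partial>PiM Basis (\<lambda>_. std_normal_distribution))"
    by (subst PiM_density, simp, simp, simp, rule prob_space_std_normal, subst nn_integral_density) (auto simp: gauss_density_prod Basis_sum_inner)
  finally show ?thesis .
qed

text \<open>Equality holds for g(y) = |y|^2 / 2 and u(x) = exp (-|x|^2 / 2): both sides are then (2
  pi)^(m/2) in dimension m. This explains the constant and why the volume bound below is sharp for
  balls.\<close>

lemma gaussian_transport:
  fixes u g :: "'a::euclidean_space \<Rightarrow> ennreal"
  assumes [measurable]: "g \<in> borel_measurable borel" "u \<in> borel_measurable borel"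
    and H: "\<And>x y. g y \<noteq> \<infinity> \<Longrightarrow> u x \<le> ennreal (exp (enn2real (g y) - x \<bullet> y))"
    and fin: "(\<integral>\<^sup>+y. g y \<partial>gauss) \<noteq> \<infinity>"
  shows "(\<integral>\<^sup>+x. u x \<partial>lborel)
    \<le> ennreal (sqrt (2 * pi / exp 1) ^ DIM('a) * exp (enn2real (\<integral>\<^sup>+y. g y \<partial>gauss)))"
proof -
  define S where "S f = (\<Sum>b\<in>Basis. f b *\<^sub>R b :: 'a)" for f
  have [measurable]: "S \<in> borel_measurable (PiM Basis (\<lambda>_. borel))"
    unfolding S_def by measurable
  have inner: "S x \<bullet> S y = (\<Sum>b\<in>Basis. x b * y b)" for x y
    by (subst euclidean_inner) (simp add: S_def Basis_sum_inner)
  have "(\<integral>\<^sup>+x. u x \<partial>lborel) = (\<integral>\<^sup>+f. u (S f) \<partial>PiM Basis (\<lambda>_. lborel))"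
    by (subst lborel_eq, subst nn_integral_distr) (auto simp: S_def)
  also have "\<dots> \<le> ennreal (sqrt (2 * pi / exp 1) ^ DIM('a) *
     exp (enn2real (\<integral>\<^sup>+f. g (S f) \<partial>PiM Basis (\<lambda>_. std_normal_distribution))))"
    by (rule gaussian_transport_PiM)
      (use H fin in \<open>auto simp: inner[symmetric] nn_integral_gauss_PiM S_def[symmetric]\<close>)
  finally show ?thesis by (simp add: nn_integral_gauss_PiM S_def)
qed

section \<open>Volume through a mixture of dilates\<close>

text \<open>If \<open>K\<close> is star-shaped about the origin with gauge \<open>p\<close>, this is \<open>exp (- p\<^sup>2 / 2)\<close> almost everywhere.\<close>

definition dilation_mass :: "'a::euclidean_space set \<Rightarrow> 'a \<Rightarrow> ennreal" where
  "dilation_mass K x = (\<integral>\<^sup>+t. ennreal (t * exp (- t\<^sup>2 / 2)) * indicator {0<..} t * indicator K ((1 / t) *\<^sub>R x) \<partial>lborel)"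

text \<open>The weight t exp (-t^2 / 2) is the derivative of -exp (-t^2 / 2), so the dilations
  beyond a threshold a carry total weight exp (-a^2 / 2). This is what produces a Gaussian function
  of the gauge.\<close>

lemma gaussian_tail:
  assumes a: "a \<ge> 0"
  shows "(\<integral>\<^sup>+t. ennreal (t * exp (- t\<^sup>2 / 2)) * indicator {a<..} t \<partial>lborel) = ennreal (exp (- a\<^sup>2 / 2))"
proof -
  have "(\<integral>\<^sup>+t. ennreal (t * exp (- t\<^sup>2 / 2)) * indicator {a<..} t \<partial>lborel)
      = (\<integral>\<^sup>+t. ennreal (t * exp (- t\<^sup>2 / 2)) * indicator {a..} t \<partial>lborel)"
    by (intro nn_integral_cong_AE eventually_mono[OF AE_lborel_singleton[of a]])
      (auto split: split_indicator)
  also have "\<dots> = ennreal (0 - (- exp (- a\<^sup>2 / 2)))"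
  proof (rule nn_integral_FTC_atLeast)
    show "DERIV (\<lambda>t. - exp (- t\<^sup>2 / 2)) t :> t * exp (- t\<^sup>2 / 2)" for t
      by (auto intro!: derivative_eq_intros)
    show "((\<lambda>t. - exp (- t\<^sup>2 / 2)) \<longlongrightarrow> (0::real)) at_top"
      by real_asymp
  qed (use a in auto)
  finally show ?thesis by simp
qed

lemma measurable_dilation_mass [measurable]:
  fixes K :: "'a::euclidean_space set"
  assumes [measurable]: "K \<in> sets borel"
  shows "dilation_mass K \<in> borel_measurable borel"
proof -
  have "(\<lambda>(x, t). ennreal (t * exp (- t\<^sup>2 / 2)) * indicator {0<..} t * indicator K ((1 / t) *\<^sub>R x))
     \<in> borel_measurable (borel \<Otimes>\<^sub>M (lborel :: real measure))"
    by measurable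
  then show ?thesis unfolding dilation_mass_def by measurable
qed

lemma nn_integral_dilation_mass_scale:
  fixes K :: "'a::euclidean_space set"
  assumes [measurable]: "K \<in> sets borel" and s: "s > 0"
  shows "(\<integral>\<^sup>+x. dilation_mass K ((1 / s) *\<^sub>R x) \<partial>lborel) = ennreal (s ^ DIM('a)) * (\<integral>\<^sup>+x. dilation_mass K x \<partial>lborel)"
  by (subst lborel_affine[of s 0])
    (use s in \<open>auto simp: nn_integral_density nn_integral_distr nn_integral_cmult\<close>)

text \<open>By Fubini the dilates can be integrated first, and the dilate by t has volume t^m
  vol(K). The remaining one-dimensional integral is the same for all \<open>K\<close>; polar
  coordinates are avoided.\<close>

lemma nn_integral_dilation_mass:
  fixes K :: "'a::euclidean_space set"
  assumes [measurable]: "K \<in> sets borel"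
  shows "(\<integral>\<^sup>+x. dilation_mass K x \<partial>lborel)
     = emeasure lborel K * (\<integral>\<^sup>+t. ennreal (t * exp (- t\<^sup>2 / 2)) * indicator {0<..} t * ennreal (t ^ DIM('a)) \<partial>lborel)"
proof -
  have "(\<integral>\<^sup>+x. dilation_mass K x \<partial>lborel)
     = (\<integral>\<^sup>+t. \<integral>\<^sup>+x. ennreal (t * exp (- t\<^sup>2 / 2)) * indicator {0<..} t * indicator K ((1 / t) *\<^sub>R x) \<partial>lborel \<partial>lborel)"
    unfolding dilation_mass_def by (rule lborel_pair.Fubini'[symmetric]) measurable
  also have "\<dots> = (\<integral>\<^sup>+t. ennreal (t * exp (- t\<^sup>2 / 2)) * indicator {0<..} t * (ennreal (t ^ DIM('a)) * emeasure lborel K) \<partial>lborel)"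
  proof (intro nn_integral_cong)
    fix t :: real
    show "(\<integral>\<^sup>+x. ennreal (t * exp (- t\<^sup>2 / 2)) * indicator {0<..} t * indicator K ((1 / t) *\<^sub>R x) \<partial>lborel)
       = ennreal (t * exp (- t\<^sup>2 / 2)) * indicator {0<..} t * (ennreal (t ^ DIM('a)) * emeasure lborel K)"
    proof (cases "t > 0")
      case True
      have "(\<integral>\<^sup>+x. indicator K ((1 / t) *\<^sub>R x) \<partial>lborel) = ennreal (t ^ DIM('a)) * (\<integral>\<^sup>+x. indicator K x \<partial>lborel)"
        by (subst lborel_affine[of t 0])
          (use True in \<open>auto simp: nn_integral_density nn_integral_distr nn_integral_cmult simp del: nn_integral_indicator\<close>)
      then show ?thesis by (subst nn_integral_cmult) auto
    qed simp
  qed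
  also have "\<dots> = emeasure lborel K * (\<integral>\<^sup>+t. ennreal (t * exp (- t\<^sup>2 / 2)) * indicator {0<..} t * ennreal (t ^ DIM('a)) \<partial>lborel)"
    by (subst nn_integral_cmult[symmetric]) (auto intro!: nn_integral_cong simp: mult_ac)
  finally show ?thesis .
qed

text \<open>Membership of all sufficiently large dilates bounds the mass from below; the companion
  \<open>dilation_mass_le\<close> bounds it from above when small dilates are excluded. The gauge
  supplies the first kind of information, the support function the second.\<close>

lemma dilation_mass_ge:
  assumes a: "a \<ge> 0" and K: "\<And>t. t > a \<Longrightarrow> (1 / t) *\<^sub>R x \<in> K"
  shows "ennreal (exp (- a\<^sup>2 / 2)) \<le> dilation_mass K x"
  unfolding gaussian_tail[OF a, symmetric] dilation_mass_def
  using assms by (intro nn_integral_mono) (auto split: split_indicator)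

lemma dilation_mass_le:
  assumes a: "a \<ge> 0" and K: "\<And>t. t > 0 \<Longrightarrow> (1 / t) *\<^sub>R x \<in> K \<Longrightarrow> t \<ge> a"
  shows "dilation_mass K x \<le> ennreal (exp (- a\<^sup>2 / 2))"
proof -
  have "dilation_mass K x \<le> (\<integral>\<^sup>+t. ennreal (t * exp (- t\<^sup>2 / 2)) * indicator {a<..} t \<partial>lborel)"
    unfolding dilation_mass_def
  proof (intro nn_integral_mono_AE eventually_mono[OF AE_lborel_singleton[of a]])
    fix t :: real assume "t \<noteq> a"
    then show "ennreal (t * exp (- t\<^sup>2 / 2)) * indicator {0<..} t * indicator K ((1 / t) *\<^sub>R x)
      \<le> ennreal (t * exp (- t\<^sup>2 / 2)) * indicator {a<..} t"
      using K[of t] by (auto split: split_indicator)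
  qed
  then show ?thesis unfolding gaussian_tail[OF a] .
qed

lemma nn_integral_dilation_mass_ball:
  "(\<integral>\<^sup>+x. dilation_mass (ball (0 :: 'a::euclidean_space) 1) x \<partial>lborel) = ennreal (sqrt (2 * pi) ^ DIM('a))"
proof -
  have "dilation_mass (ball (0 :: 'a) 1) x = ennreal (sqrt (2 * pi) ^ DIM('a)) * ennreal (gauss_density x)" for x
  proof -
    have "dilation_mass (ball (0 :: 'a) 1) x = ennreal (exp (- (norm x)\<^sup>2 / 2))"
    proof (rule antisym)
      show "dilation_mass (ball 0 1) x \<le> ennreal (exp (- (norm x)\<^sup>2 / 2))"
        by (rule dilation_mass_le) (auto simp: field_simps)
      show "ennreal (exp (- (norm x)\<^sup>2 / 2)) \<le> dilation_mass (ball 0 1) x"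
      proof (rule dilation_mass_ge)
        fix t assume "norm x < t"
        moreover from this have "t > 0" using norm_ge_zero[of x] by linarith
        ultimately show "(1 / t) *\<^sub>R x \<in> ball 0 1" by simp
      qed simp
    qed
    also have "exp (- (norm x)\<^sup>2 / 2) = sqrt (2 * pi) ^ DIM('a) * gauss_density x"
      by (simp add: gauss_density_def mult.assoc[symmetric] power_mult_distrib[symmetric] del: power_mult_distrib)
    finally show ?thesis by (simp add: ennreal_mult)
  qed
  then have "(\<integral>\<^sup>+x. dilation_mass (ball (0 :: 'a) 1) x \<partial>lborel)
     = ennreal (sqrt (2 * pi) ^ DIM('a)) * (\<integral>\<^sup>+x. ennreal (gauss_density (x :: 'a)) \<partial>lborel)"
    by (simp add: nn_integral_cmult)
  also have "(\<integral>\<^sup>+x. ennreal (gauss_density (x :: 'a)) \<partial>lborel) = 1"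
    using nn_integral_gauss[of "\<lambda>_::'a. 1"] gauss.emeasure_space_1[where 'a='a] by simp
  finally show ?thesis by simp
qed

text \<open>The unknown radial constant \<open>J\<close> is eliminated by comparison with the unit
  ball, whose dilation mass is an unnormalised Gaussian density.\<close>

lemma dilation_mass_volume:
  fixes K :: "'a::euclidean_space set"
  assumes K [measurable]: "K \<in> sets borel" and fin: "emeasure lborel K \<noteq> \<infinity>"
  shows "(\<integral>\<^sup>+x. dilation_mass K x \<partial>lborel)
    = ennreal (measure lebesgue K / measure lebesgue (ball (0 :: 'a) 1) * sqrt (2 * pi) ^ DIM('a))"
proof -
  define J where "J = (\<integral>\<^sup>+t. ennreal (t * exp (- t\<^sup>2 / 2)) * indicator {0<..} t * ennreal (t ^ DIM('a)) \<partial>lborel)"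
  define B where "B = ball (0 :: 'a) 1"
  have [measurable]: "B \<in> sets borel" by (simp add: B_def)
  define b where "b = measure lebesgue B"
  have b: "b > 0" "emeasure lborel B = ennreal b"
    unfolding b_def B_def
    by (auto simp: emeasure_ball measure_def unit_ball_vol_nonneg unit_ball_vol_pos)
  have J: "ennreal b * J = ennreal (sqrt (2 * pi) ^ DIM('a))"
    using nn_integral_dilation_mass[of B] nn_integral_dilation_mass_ball[where 'a='a] b
    by (simp add: B_def J_def)
  have "J = ennreal (1 / b) * (ennreal b * J)"
    using b by (simp add: mult.assoc[symmetric] ennreal_mult[symmetric])
  then have J': "J = ennreal (sqrt (2 * pi) ^ DIM('a) / b)"
    using b unfolding J by (simp add: ennreal_mult[symmetric])
  have "emeasure lborel K = ennreal (measure lebesgue K)"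
    using fin by (simp add: measure_def top.not_eq_extremum)
  then show ?thesis
    using b nn_integral_dilation_mass[OF K]
    unfolding J_def[symmetric] J' B_def[symmetric] b_def[symmetric]
    by (simp add: ennreal_mult[symmetric])
qed

text \<open>With p the gauge of \<open>K\<close>, x . y \<le> p(x) h(y) \<le> p(x)^2 / (2 s^2) + s^2
  h(y)^2 / 2. So the dilation mass at x / s, which plays the role of exp (-p(x)^2 / (2 s^2)), and
  s^2 h^2 / 2 form a pair for the transport inequality.\<close>

lemma vol_radius_le:
  fixes K :: "(real^'m) set"
  assumes fin: "emeasure lebesgue K \<noteq> \<infinity>"
    and h [measurable]: "h \<in> borel_measurable borel" and h0: "\<And>y. 0 \<le> h y"
    and supp: "\<And>x y. x \<in> K \<Longrightarrow> x \<bullet> y \<le> h y"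
    and int: "integrable gauss (\<lambda>y. (h y)\<^sup>2)" and V: "(\<integral>y. (h y)\<^sup>2 \<partial>gauss) \<le> V" "V > 0"
  shows "vol_radius K \<le> sqrt (V / CARD('m))"
proof (cases "K \<in> sets lebesgue")
  \<comment> \<open>By convention \<open>measure\<close> is 0 on sets that are not Lebesgue
    measurable.\<close>
  case False
  then have "measure lebesgue K = 0" by (simp add: measure_notin_sets)
  then show ?thesis using V by (simp add: vol_radius_def)
next
  case True
  \<comment> \<open>A Borel subset of the same measure: the dilation mass becomes measurable and the
    bound by \<open>h\<close> is inherited.\<close>
  define K' where "K' = main_part lborel K"
  have K' [measurable]: "K' \<in> sets borel" and "emeasure lborel K' = emeasure lebesgue K"
    using True main_part_sets[of K lborel] by (auto simp: K'_def emeasure_completion)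
  moreover have "K' \<subseteq> K" using main_part_null_part_Un[OF True] unfolding K'_def by blast
  ultimately have K': "K' \<in> sets borel" "K' \<subseteq> K" "emeasure lborel K' = emeasure lebesgue K" by auto
  define m where "m = real CARD('m)"
  have m: "m > 0" by (simp add: m_def)
  \<comment> \<open>This scale makes the exponent s^2 E h^2 / 2 at most m/2, which cancels the
    factor e^(-m/2) of the transport inequality.\<close>
  define s where "s = sqrt (m / V)"
  have s: "s > 0" "s\<^sup>2 = m / V" using m V by (auto simp: s_def)
  define r where "r = measure lebesgue K / measure lebesgue (ball (0 :: real^'m) 1)"
  have r: "r \<ge> 0" by (simp add: r_def)
  have bound: "dilation_mass K' ((1 / s) *\<^sub>R x) \<le> ennreal (exp (s\<^sup>2 * (h y)\<^sup>2 / 2 - x \<bullet> y))" for x y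
  proof (cases "x \<bullet> y \<le> 0")
    case True
    have "dilation_mass K' ((1 / s) *\<^sub>R x) \<le> ennreal (exp (- 0\<^sup>2 / 2))"
      by (rule dilation_mass_le) auto
    also have "\<dots> \<le> ennreal (exp (s\<^sup>2 * (h y)\<^sup>2 / 2 - x \<bullet> y))"
    proof -
      have "0 \<le> s\<^sup>2 * (h y)\<^sup>2" by simp
      then have "0 \<le> s\<^sup>2 * (h y)\<^sup>2 / 2 - x \<bullet> y" using True by linarith
      then have "- 0\<^sup>2 / 2 \<le> s\<^sup>2 * (h y)\<^sup>2 / 2 - x \<bullet> y" by simp
      then show ?thesis by (intro ennreal_leI) (simp only: exp_le_cancel_iff)
    qed
    finally show ?thesis .
  next
    case False
    have *: "x \<bullet> y / s \<le> t * h y" if "t > 0" "(1 / t) *\<^sub>R (1 / s) *\<^sub>R x \<in> K'" for t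
    proof -
      have "((1 / t) *\<^sub>R (1 / s) *\<^sub>R x) \<bullet> y \<le> h y" using that K' by (intro supp) auto
      then have "(x \<bullet> y / s) / t \<le> h y" by (simp add: mult.commute)
      then show ?thesis by (simp only: pos_divide_le_eq[OF that(1)] mult.commute)
    qed
    show ?thesis
    proof (cases "h y = 0")
      case True
      \<comment> \<open>Here x . y > 0, while a dilate containing the point would force x . y \<le>
        0.\<close>
      then have "dilation_mass K' ((1 / s) *\<^sub>R x) = 0"
        using * False s(1) unfolding dilation_mass_def
        by (intro nn_integral_zero') (fastforce simp: not_le divide_le_0_iff split: split_indicator)
      then show ?thesis by simp
    next
      case hy: False
      then have hy: "h y > 0" using h0[of y] by simp
      define a where "a = x \<bullet> y / (s * h y)"
      have a: "a \<ge> 0" using False hy s by (simp add: a_def)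
      have "dilation_mass K' ((1 / s) *\<^sub>R x) \<le> ennreal (exp (- a\<^sup>2 / 2))"
        by (rule dilation_mass_le[OF a]) (use * hy s in \<open>auto simp: a_def field_simps\<close>)
      also have "\<dots> \<le> ennreal (exp (s\<^sup>2 * (h y)\<^sup>2 / 2 - x \<bullet> y))"
      proof (intro ennreal_leI, simp)
        \<comment> \<open>The product of \<open>a\<close> and \<open>s * h y\<close> is x . y, so
          this is the inequality between arithmetic and geometric mean.\<close>
        have "0 \<le> (a - s * h y)\<^sup>2" by simp
        also have "\<dots> = a\<^sup>2 - 2 * (x \<bullet> y) + s\<^sup>2 * (h y)\<^sup>2"
          using hy s by (simp add: power2_diff power_mult_distrib a_def)
        finally show "- (a\<^sup>2 / 2) \<le> s\<^sup>2 * (h y)\<^sup>2 / 2 - x \<bullet> y" by simp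
      qed
      finally show ?thesis .
    qed
  qed
  have I: "(\<integral>\<^sup>+y. ennreal (s\<^sup>2 * (h y)\<^sup>2 / 2) \<partial>gauss) = ennreal (s\<^sup>2 / 2 * (\<integral>y. (h y)\<^sup>2 \<partial>gauss))"
    using int by (subst nn_integral_eq_integral) auto
  have "(\<integral>\<^sup>+x. dilation_mass K' ((1 / s) *\<^sub>R x) \<partial>lborel)
     \<le> ennreal (sqrt (2 * pi / exp 1) ^ DIM(real^'m) * exp (enn2real (\<integral>\<^sup>+y. ennreal (s\<^sup>2 * (h y)\<^sup>2 / 2) \<partial>gauss)))"
    by (rule gaussian_transport) (use bound in \<open>auto simp: I\<close>)
  also have "\<dots> \<le> ennreal (sqrt (2 * pi / exp 1) ^ CARD('m) * exp (m / 2))"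
  proof -
    have "s\<^sup>2 / 2 * (\<integral>y. (h y)\<^sup>2 \<partial>gauss) \<le> s\<^sup>2 / 2 * V" using V by (intro mult_left_mono) auto
    also have "\<dots> = m / 2" using s V by simp
    finally show ?thesis unfolding I
      by (intro ennreal_leI mult_mono) (auto simp: integral_nonneg_AE)
  qed
  also have "sqrt (2 * pi / exp 1) ^ CARD('m) * exp (m / 2) = sqrt (2 * pi) ^ CARD('m)"
  proof -
    have "exp (m / 2) = exp (1 / 2) ^ CARD('m)" by (simp add: m_def exp_of_nat_mult[symmetric])
    moreover have "exp (1 / 2 :: real) = sqrt (exp 1)"
      by (rule real_sqrt_unique[symmetric]) (auto simp: power2_eq_square exp_add[symmetric])
    ultimately show ?thesis
      by (simp add: real_sqrt_divide power_divide)
  qed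
  also have "(\<integral>\<^sup>+x. dilation_mass K' ((1 / s) *\<^sub>R x) \<partial>lborel) = ennreal (s ^ CARD('m) * (r * sqrt (2 * pi) ^ CARD('m)))"
  proof -
    have "measure lebesgue K' = measure lebesgue K" using K' by (simp add: measure_def)
    then have "(\<integral>\<^sup>+x. dilation_mass K' x \<partial>lborel) = ennreal (r * sqrt (2 * pi) ^ CARD('m))"
      using dilation_mass_volume[OF K'(1)] fin K'(3) unfolding r_def by simp
    then show ?thesis
      using nn_integral_dilation_mass_scale[OF K'(1) s(1)] r s by (simp add: ennreal_mult)
  qed
  finally have "s ^ CARD('m) * (r * sqrt (2 * pi) ^ CARD('m)) \<le> sqrt (2 * pi) ^ CARD('m)"
    by simp
  then have "(s ^ CARD('m) * r) * sqrt (2 * pi) ^ CARD('m) \<le> 1 * sqrt (2 * pi) ^ CARD('m)"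
    by (simp add: mult.assoc)
  then have "s ^ CARD('m) * r \<le> 1" by (subst (asm) mult_le_cancel_right_pos) auto
  then have "r \<le> (1 / s) ^ CARD('m)" using s(1) by (simp add: field_simps power_divide)
  then have "r powr (1 / m) \<le> ((1 / s) ^ CARD('m)) powr (1 / m)"
    using r m by (intro powr_mono2) auto
  also have "\<dots> = 1 / s"
    using s(1) m by (simp add: powr_realpow[symmetric] powr_powr m_def)
  also have "1 / s = sqrt (V / m)" by (simp add: s_def real_sqrt_divide)
  finally show ?thesis by (simp add: vol_radius_def r_def m_def)
qed

text \<open>The integral of exp (-p^2 / (2 s^2)) equals (2 pi)^(m/2) times the Gaussian mean of exp
  (|Z|^2 / 2 - p(Z)^2 / (2 s^2)). Jensen's inequality bounds that mean below by the exponential of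
  the mean exponent, and the dilation mass dominates the integrand.\<close>

lemma vol_radius_ge:
  fixes K :: "(real^'m) set"
  assumes K [measurable]: "K \<in> sets borel" and bdd: "bounded K"
    and p [measurable]: "p \<in> borel_measurable borel" and p0: "\<And>x. 0 \<le> p x"
    and gauge: "\<And>x t. p x < t \<Longrightarrow> (1 / t) *\<^sub>R x \<in> K"
    and int: "integrable gauss (\<lambda>x. (p x)\<^sup>2)" and V: "(\<integral>x. (p x)\<^sup>2 \<partial>gauss) \<le> V" "V > 0"
  shows "sqrt (CARD('m) / V) \<le> vol_radius K"
proof -
  define m where "m = real CARD('m)"
  have m: "m > 0" by (simp add: m_def)
  \<comment> \<open>With this scale the mean exponent m/2 - E p^2 / (2 s^2), called \<open>c\<close>
    below, is nonnegative.\<close>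
  define s where "s = sqrt (V / m)"
  have s: "s > 0" "s\<^sup>2 = V / m" using m V by (auto simp: s_def)
  define r where "r = measure lebesgue K / measure lebesgue (ball (0 :: real^'m) 1)"
  have r: "r \<ge> 0" by (simp add: r_def)
  define E where "E = (\<integral>x. (p x)\<^sup>2 \<partial>gauss)"
  define c where "c = m / 2 - E / (2 * s\<^sup>2)"
  have c: "c \<ge> 0"
  proof -
    have "E / (2 * s\<^sup>2) \<le> V / (2 * s\<^sup>2)" using V s(1) by (intro divide_right_mono) (auto simp: E_def)
    also have "\<dots> = m / 2" using s(2) V m by simp
    finally show ?thesis by (simp add: c_def)
  qed
  \<comment> \<open>The tangent line of exp at the mean exponent \<open>c\<close>, evaluated at the
    random exponent. Using its positive part keeps Jensen's inequality within nonnegative integrals,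
    so integrability of the exponential is not presupposed.\<close>
  define q where "q x = exp c * (1 + ((norm x)\<^sup>2 / 2 - (p x)\<^sup>2 / (2 * s\<^sup>2)) - c)" for x
  have q: "integrable gauss q" "(\<integral>x. q x \<partial>gauss) = exp c"
  proof -
    have 1: "integrable gauss (\<lambda>x :: real^'m. (norm x)\<^sup>2 / 2 - (p x)\<^sup>2 / (2 * s\<^sup>2))"
      using int gauss_norm_square(1) by auto
    show "integrable gauss q" unfolding q_def using 1 by auto
    have "(\<integral>x. (norm x)\<^sup>2 / 2 - (p x)\<^sup>2 / (2 * s\<^sup>2) \<partial>gauss) = c"
      using int gauss_norm_square[where 'a="real^'m"] by (simp add: c_def E_def m_def)
    then show "(\<integral>x. q x \<partial>gauss) = exp c"
      unfolding q_def using 1 gauss.prob_space[where 'a="real^'m"] by (simp del: space_gauss)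
  qed
  have "ennreal 1 \<le> ennreal (exp c)" using c by (intro ennreal_leI) simp
  also have "\<dots> \<le> (\<integral>\<^sup>+x. ennreal (max 0 (q x)) \<partial>gauss)"
  proof -
    have "exp c \<le> (\<integral>x. max 0 (q x) \<partial>gauss)"
      unfolding q(2)[symmetric] using q(1) by (intro integral_mono) auto
    then show ?thesis using q(1) by (subst nn_integral_eq_integral) (auto intro: ennreal_leI)
  qed
  also have "\<dots> \<le> (\<integral>\<^sup>+x. ennreal (exp ((norm x)\<^sup>2 / 2 - (p x)\<^sup>2 / (2 * s\<^sup>2))) \<partial>gauss)"
  proof (intro nn_integral_mono ennreal_leI)
    fix x
    define z where "z = (norm x)\<^sup>2 / 2 - (p x)\<^sup>2 / (2 * s\<^sup>2)"
    have "exp c * (1 + (z - c)) \<le> exp c * exp (z - c)"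
      by (intro mult_left_mono exp_ge_add_one_self) auto
    then have "q x \<le> exp z" by (simp add: q_def z_def exp_add[symmetric] algebra_simps)
    then show "max 0 (q x) \<le> exp z" by simp
  qed
  also have "\<dots> = (\<integral>\<^sup>+x. ennreal ((1 / sqrt (2 * pi)) ^ CARD('m)) * ennreal (exp (- (p x / s)\<^sup>2 / 2)) \<partial>lborel)"
    by (subst nn_integral_gauss)
      (auto intro!: nn_integral_cong simp: gauss_density_def ennreal_mult[symmetric] mult.assoc
         exp_add[symmetric] power_divide)
  also have "\<dots> = ennreal ((1 / sqrt (2 * pi)) ^ CARD('m)) * (\<integral>\<^sup>+x. ennreal (exp (- (p x / s)\<^sup>2 / 2)) \<partial>lborel)"
    by (rule nn_integral_cmult) measurable
  also have "\<dots> \<le> ennreal ((1 / sqrt (2 * pi)) ^ CARD('m)) * (\<integral>\<^sup>+x. dilation_mass K ((1 / s) *\<^sub>R x) \<partial>lborel)"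
  proof (intro mult_left_mono nn_integral_mono)
    fix x
    show "ennreal (exp (- (p x / s)\<^sup>2 / 2)) \<le> dilation_mass K ((1 / s) *\<^sub>R x)"
    proof (rule dilation_mass_ge)
      fix t assume "t > p x / s"
      then have "p x < t * s" using s(1) by (simp add: field_simps)
      from gauge[OF this] show "(1 / t) *\<^sub>R (1 / s) *\<^sub>R x \<in> K" by simp
    qed (use p0 s in auto)
  qed simp
  also have "(\<integral>\<^sup>+x. dilation_mass K ((1 / s) *\<^sub>R x) \<partial>lborel) = ennreal (s ^ CARD('m) * (r * sqrt (2 * pi) ^ CARD('m)))"
  proof -
    have "(\<integral>\<^sup>+x. dilation_mass K x \<partial>lborel) = ennreal (r * sqrt (2 * pi) ^ CARD('m))"
      using dilation_mass_volume[OF K] emeasure_bounded_finite[OF bdd] unfolding r_def by simp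
    then show ?thesis
      using nn_integral_dilation_mass_scale[OF K s(1)] r s by (simp add: ennreal_mult)
  qed
  also have "ennreal ((1 / sqrt (2 * pi)) ^ CARD('m)) * \<dots> = ennreal (s ^ CARD('m) * r)"
    using r s by (simp add: ennreal_mult[symmetric] field_simps power_divide)
  finally have "1 \<le> s ^ CARD('m) * r" using r s by (subst (asm) ennreal_le_iff) auto
  then have "(1 / s) ^ CARD('m) \<le> r" using s(1) by (simp add: field_simps power_divide)
  then have "((1 / s) ^ CARD('m)) powr (1 / m) \<le> r powr (1 / m)"
    using s m by (intro powr_mono2) auto
  moreover have "((1 / s) ^ CARD('m)) powr (1 / m) = 1 / s"
    using s(1) m by (simp add: powr_realpow[symmetric] powr_powr m_def)
  moreover have "1 / s = sqrt (m / V)" by (simp add: s_def real_sqrt_divide)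
  ultimately show ?thesis by (simp add: vol_radius_def r_def m_def)
qed

section \<open>Support functions and mean width\<close>

lemma support_function_bound:
  fixes S :: "'a::real_inner set"
  assumes "bounded S"
  obtains B where "B \<ge> 0" "\<And>x u. x \<in> S \<Longrightarrow> u \<bullet> x \<le> B * norm u"
proof -
  obtain B where B: "B > 0" "\<And>x. x \<in> S \<Longrightarrow> norm x \<le> B"
    using assms by (auto simp: bounded_pos)
  have "u \<bullet> x \<le> B * norm u" if "x \<in> S" for x u
  proof -
    have "u \<bullet> x \<le> norm u * norm x" by (rule norm_cauchy_schwarz)
    also have "\<dots> \<le> norm u * B" using B(2)[OF that] by (intro mult_left_mono) auto
    finally show ?thesis by (simp add: mult.commute)
  qed
  then show ?thesis using that[of B] B by auto
qed

lemma bdd_above_support: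
  fixes S :: "'a::real_inner set"
  assumes "bounded S"
  shows "bdd_above ((\<lambda>x. u \<bullet> x) ` S)"
proof -
  obtain B where "\<And>x u. x \<in> S \<Longrightarrow> u \<bullet> x \<le> B * norm u"
    using support_function_bound[OF assms] by metis
  then show ?thesis by (auto intro!: bdd_aboveI[of _ "B * norm u"])
qed

lemma support_function_upper:
  fixes S :: "'a::real_inner set"
  assumes "bounded S" "x \<in> S"
  shows "u \<bullet> x \<le> (SUP x\<in>S. u \<bullet> x)"
  by (rule cSUP_upper[OF assms(2) bdd_above_support[OF assms(1)]])

text \<open>The Lipschitz bound gives measurability, and applied against the origin it gives linear
  growth, hence Gaussian integrability.\<close>

lemma support_function_lipschitz:
  fixes S :: "'a::real_inner set"
  assumes S: "bounded S" "S \<noteq> {}"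
  obtains B where "B \<ge> 0" "\<And>u v. \<bar>(SUP x\<in>S. u \<bullet> x) - (SUP x\<in>S. v \<bullet> x)\<bar> \<le> B * norm (u - v)"
proof -
  obtain B where B: "B \<ge> 0" "\<And>x u. x \<in> S \<Longrightarrow> u \<bullet> x \<le> B * norm u"
    using support_function_bound[OF S(1)] by metis
  have *: "(SUP x\<in>S. u \<bullet> x) \<le> (SUP x\<in>S. v \<bullet> x) + B * norm (u - v)" for u v
  proof (rule cSUP_least[OF S(2)])
    fix x assume "x \<in> S"
    have "u \<bullet> x = v \<bullet> x + (u - v) \<bullet> x" by (simp add: inner_diff_left)
    also have "\<dots> \<le> (SUP x\<in>S. v \<bullet> x) + B * norm (u - v)"
      using B(2)[OF \<open>x \<in> S\<close>] support_function_upper[OF S(1) \<open>x \<in> S\<close>] by (intro add_mono) auto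
    finally show "u \<bullet> x \<le> (SUP x\<in>S. v \<bullet> x) + B * norm (u - v)" .
  qed
  have "\<bar>(SUP x\<in>S. u \<bullet> x) - (SUP x\<in>S. v \<bullet> x)\<bar> \<le> B * norm (u - v)" for u v
    using *[of u v] *[of v u] by (simp add: norm_minus_commute[of v u] abs_le_iff)
  then show ?thesis using that B(1) by blast
qed

lemma continuous_support_function:
  fixes S :: "'a::real_inner set"
  assumes S: "bounded S" "S \<noteq> {}"
  shows "continuous_on UNIV (\<lambda>u. SUP x\<in>S. u \<bullet> x)"
proof -
  obtain B where B: "B \<ge> 0" "\<And>u v. \<bar>(SUP x\<in>S. u \<bullet> x) - (SUP x\<in>S. v \<bullet> x)\<bar> \<le> B * norm (u - v)"
    using support_function_lipschitz[OF S] by metis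
  have "B-lipschitz_on UNIV (\<lambda>u. SUP x\<in>S. u \<bullet> x)"
    using B by (intro lipschitz_onI) (auto simp: dist_norm dist_real_def)
  then show ?thesis by (rule lipschitz_on_continuous_on)
qed

lemma support_function_scale:
  fixes S :: "'a::real_inner set"
  assumes S: "bounded S" "S \<noteq> {}" and t: "t \<ge> 0"
  shows "(SUP x\<in>S. (t *\<^sub>R u) \<bullet> x) = t * (SUP x\<in>S. u \<bullet> x)"
proof (cases "t = 0")
  case True
  then show ?thesis using S by simp
next
  case False
  have le: "(SUP x\<in>S. (t *\<^sub>R u) \<bullet> x) \<le> t * (SUP x\<in>S. u \<bullet> x)" if "t > 0" for t u
    using that S by (intro cSUP_least) (auto intro: support_function_upper)
  have "t > 0" using t False by simp
  have "(SUP x\<in>S. ((1/t) *\<^sub>R t *\<^sub>R u) \<bullet> x) \<le> (1/t) * (SUP x\<in>S. (t *\<^sub>R u) \<bullet> x)"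
    using \<open>t > 0\<close> by (intro le) auto
  then have "t * (SUP x\<in>S. u \<bullet> x) \<le> (SUP x\<in>S. (t *\<^sub>R u) \<bullet> x)"
    using \<open>t > 0\<close> by (simp add: field_simps)
  with le[OF \<open>t > 0\<close>] show ?thesis by (intro antisym)
qed

lemma integrable_gauss_support_function:
  fixes S :: "'a::euclidean_space set"
  assumes S: "bounded S" "S \<noteq> {}"
  shows "integrable gauss (\<lambda>u. SUP x\<in>S. u \<bullet> x)"
proof -
  obtain B where B: "B \<ge> 0" "\<And>u v. \<bar>(SUP x\<in>S. u \<bullet> x) - (SUP x\<in>S. v \<bullet> x)\<bar> \<le> B * norm (u - v)"
    using support_function_lipschitz[OF S] by metis
  show ?thesis
  proof (rule Bochner_Integration.integrable_bound)
    show "integrable gauss (\<lambda>u :: 'a. B * norm u)" using integrable_gauss_norm[where 'a='a] by simp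
    show "(\<lambda>u. SUP x\<in>S. u \<bullet> x) \<in> borel_measurable gauss"
      unfolding measurable_cong_sets[OF sets_gauss refl]
      by (rule borel_measurable_continuous_onI[OF continuous_support_function[OF S]])
    show "AE u in gauss. norm (SUP x\<in>S. u \<bullet> x) \<le> norm (B * norm u)"
      using B(2)[of _ 0] B(1) S(2) by (intro AE_I2) simp
  qed
qed

text \<open>The direction of a Gaussian vector, weighted by its norm, has a rotation-invariant law
  and hence the law \<open>sphere_measure\<close> by uniqueness. The weight replaces an independence
  argument for norm and direction.\<close>

lemma mean_width_gauss:
  fixes S :: "(real^'m::{finite,wellorder}) set"
  assumes S: "bounded S" "S \<noteq> {}"
  shows "mean_width S * (\<integral>x. norm (x :: real^'m::{finite,wellorder}) \<partial>gauss) = (\<integral>u. (SUP x\<in>S. u \<bullet> x) \<partial>gauss)"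
proof -
  define h where "h u = (SUP x\<in>S. u \<bullet> x)" for u
  have h [measurable]: "h \<in> borel_measurable borel"
    unfolding h_def using continuous_support_function[OF S] by (rule borel_measurable_continuous_onI)
  define c where "c = (\<integral>x. norm (x :: (real, 'm) vec) \<partial>gauss)"
  have c: "c > 0"
  proof -
    have "0 < sqrt (2 / pi) * sqrt (real DIM((real, 'm) vec))" by simp
    also have "\<dots> \<le> c" unfolding c_def by (rule gauss_norm_lower)
    finally show ?thesis .
  qed
  \<comment> \<open>By positive homogeneity of the support function this weight turns its value at
    the direction into its value at the vector itself, divided by \<open>c\<close>.\<close>
  define \<delta> where "\<delta> z = norm (z :: (real, 'm) vec) / c" for z
  have \<delta>: "\<delta> z \<ge> 0" for z using c by (simp add: \<delta>_def)
  have [measurable]: "\<delta> \<in> borel_measurable borel" unfolding \<delta>_def by measurable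
  define dir where "dir z = z /\<^sub>R norm z" for z :: "(real, 'm) vec"
  have [measurable]: "dir \<in> borel_measurable borel" unfolding dir_def by measurable
  define G where "G = density gauss (\<lambda>z. ennreal (\<delta> z))"
  have [measurable_cong]: "sets G = sets borel" by (simp add: G_def)
  define \<nu> where "\<nu> = distr G borel dir"
  have int: "integrable gauss \<delta>" "(\<integral>z. \<delta> z \<partial>gauss) = 1"
  proof -
    show "integrable gauss \<delta>"
      unfolding \<delta>_def using integrable_gauss_norm[where 'a="(real, 'm) vec"] by simp
    show "(\<integral>z. \<delta> z \<partial>gauss) = 1"
      unfolding \<delta>_def using c by (simp add: c_def)
  qed
  interpret G: prob_space G
  proof
    have "emeasure G (space G) = (\<integral>\<^sup>+z. ennreal (\<delta> z) \<partial>gauss)"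
      by (simp add: G_def emeasure_density)
    then show "emeasure G (space G) = 1"
      using int \<delta> by (simp add: nn_integral_eq_integral)
  qed
  have "rotation_invariant_on_sphere \<nu>"
    unfolding rotation_invariant_on_sphere_def
  proof (intro conjI allI impI)
    show "sets \<nu> = sets borel" by (simp add: \<nu>_def)
    show "prob_space \<nu>" unfolding \<nu>_def by (rule G.prob_space_distr) measurable
    have "inverse (norm x) * norm x = 1" if "0 < norm x / c" for x :: "(real, 'm) vec"
      using that by (cases "norm x = 0") auto
    then have "AE z in G. z \<in> dir -` sphere 0 1 \<inter> space G"
      unfolding G_def by (subst AE_density) (auto simp: \<delta>_def dir_def intro!: AE_I2)
    then have "emeasure G (dir -` sphere 0 1 \<inter> space G) = 1"
      by (intro G.emeasure_eq_1_AE) auto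
    then show "emeasure \<nu> (sphere 0 1) = 1"
      unfolding \<nu>_def by (subst emeasure_distr) auto
  next
    fix f :: "(real, 'm) vec \<Rightarrow> (real, 'm) vec" assume f: "orthogonal_transformation f"
    have lin: "linear f" and norm: "norm (f x) = norm x" for x
      using f by (auto simp: orthogonal_transformation_linear orthogonal_transformation_norm)
    have surj: "surj f" using f by (rule orthogonal_transformation_surj)
    have f_meas [measurable]: "f \<in> borel_measurable borel"
      using lin by (simp add: borel_measurable_continuous_onI linear_continuous_on linear_conv_bounded_linear)
    have fdir: "f (dir z) = dir (f z)" for z
      by (simp add: dir_def norm linear_scale[OF lin])
    show "distr \<nu> borel f = \<nu>"
    proof (rule measure_eqI)
      fix A assume "A \<in> sets (distr \<nu> borel f)"
      then have [measurable]: "A \<in> sets borel" by simp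
      have \<nu>A: "(\<integral>\<^sup>+z. indicator X z \<partial>\<nu>) = (\<integral>\<^sup>+z. ennreal (\<delta> z) * indicator X (dir z) \<partial>gauss)"
        if [measurable]: "X \<in> sets borel" for X
        unfolding \<nu>_def G_def by (subst nn_integral_distr, simp, simp, subst nn_integral_density) auto
      have "emeasure (distr \<nu> borel f) A = (\<integral>\<^sup>+z. indicator (f -` A) z \<partial>\<nu>)"
        using measurable_sets_borel[OF f_meas, of A] by (subst emeasure_distr) (auto simp: \<nu>_def)
      also have "\<dots> = (\<integral>\<^sup>+z. ennreal (\<delta> (f z)) * indicator A (dir (f z)) \<partial>gauss)"
        using measurable_sets_borel[OF f_meas, of A]
        by (subst \<nu>A) (auto intro!: nn_integral_cong simp: fdir \<delta>_def norm indicator_def)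
      also have "\<dots> = (\<integral>\<^sup>+z. ennreal (\<delta> z) * indicator A (dir z) \<partial>distr gauss borel f)"
        by (subst nn_integral_distr) auto
      also have "\<dots> = emeasure \<nu> A"
        unfolding distr_gauss_isometry[OF lin norm surj] by (subst \<nu>A[symmetric]) (auto simp: \<nu>_def)
      finally show "emeasure (distr \<nu> borel f) A = emeasure \<nu> A" .
    qed (simp add: \<nu>_def)
  qed
  then have "sphere_measure = \<nu>"
    using rotation_invariant_on_sphere_unique sphere_measure by blast
  then have "mean_width S = (\<integral>u. h u \<partial>\<nu>)"
    by (simp add: mean_width_def h_def)
  also have "\<dots> = (\<integral>z. \<delta> z * h (dir z) \<partial>gauss)"
    unfolding \<nu>_def G_def
    by (subst integral_distr, simp, simp, subst integral_density) (auto simp: \<delta>)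
  also have "\<dots> = (\<integral>z. h z / c \<partial>gauss)"
  proof (rule Bochner_Integration.integral_cong[OF refl])
    fix z
    have "h (norm z *\<^sub>R dir z) = norm z * h (dir z)"
      unfolding h_def by (rule support_function_scale[OF S]) simp
    moreover have "norm z *\<^sub>R dir z = z" by (cases "z = 0") (simp_all add: dir_def)
    ultimately show "\<delta> z * h (dir z) = h z / c" by (simp add: \<delta>_def)
  qed
  finally show ?thesis using c by (simp add: h_def c_def)
qed

section \<open>From cosh bounds to second moments\<close>

lemma measurable_cosh_real [measurable]: "(cosh :: real \<Rightarrow> real) \<in> borel_measurable borel"
  by (intro borel_measurable_continuous_onI continuous_intros)

text \<open>Both parts say that sinh s / s is increasing, which follows from convexity of sinh on
  the half line and sinh 0 = 0. It gives the sign of the derivative in the tangent inequality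
  below.\<close>

lemma sinh_secant:
  fixes s s0 :: real
  assumes "s0 > 0"
  shows "0 \<le> s \<Longrightarrow> s \<le> s0 \<Longrightarrow> sinh s \<le> s * (sinh s0 / s0)"
    and "s0 \<le> s \<Longrightarrow> s * (sinh s0 / s0) \<le> sinh s"
proof -
  have conv: "convex_on {0..} (sinh :: real \<Rightarrow> real)"
  proof (rule convex_on_realI)
    show "(sinh has_real_derivative cosh x) (at x)" if "x \<in> {0..}" for x :: real
      by (auto intro!: derivative_eq_intros)
    show "cosh x \<le> cosh y" if "x \<in> {0..}" "y \<in> {0..}" "x \<le> y" for x y :: real
      using that cosh_real_nonneg_le_iff[of x y] by simp
  qed simp
  have star: "sinh a \<le> a / b * sinh b" if "0 \<le> a" "a \<le> b" "b > 0" for a b :: real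
    using convex_onD[OF conv, of "a / b" 0 b] that by simp
  show "sinh s \<le> s * (sinh s0 / s0)" if "0 \<le> s" "s \<le> s0"
    using star[of s s0] that assms by simp
  show "s * (sinh s0 / s0) \<le> sinh s" if "s0 \<le> s"
    using star[of s0 s] that assms by (simp add: field_simps)
qed

text \<open>The function \<open>cosh \<circ> sqrt\<close> is convex; this is its tangent line at \<open>s0\<^sup>2\<close>.\<close>

lemma cosh_tangent_square:
  fixes s s0 :: real
  assumes s0: "s0 > 0" and s: "s \<ge> 0"
  shows "cosh s0 + sinh s0 / s0 / 2 * (s\<^sup>2 - s0\<^sup>2) \<le> cosh s"
proof -
  define k where "k = sinh s0 / s0"
  define f where "f x = cosh x - k * x\<^sup>2 / 2" for x
  have df: "(f has_real_derivative (sinh x - x * k)) (at x)" for x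
    unfolding f_def by (auto intro!: derivative_eq_intros simp: algebra_simps)
  have "f s0 \<le> f s"
  proof (cases "s \<le> s0")
    case True
    show ?thesis
      by (rule DERIV_nonpos_imp_nonincreasing[OF True])
        (use df sinh_secant(1)[OF s0] s in \<open>force simp: k_def\<close>)
  next
    case False
    show ?thesis
      by (rule DERIV_nonneg_imp_nondecreasing)
        (use df sinh_secant(2)[OF s0] False in \<open>force simp: k_def\<close>)+
  qed
  then show ?thesis by (simp add: f_def k_def algebra_simps diff_divide_distrib)
qed

text \<open>The bound is that for a maximum of \<open>1 / \<eta>\<close> standard Gaussian variables.\<close>

lemma (in prob_space) gauss_second_moment_le:
  fixes F :: "'v::euclidean_space \<Rightarrow> real"
  assumes F [measurable]: "F \<in> borel_measurable borel" and F0: "\<And>Z. 0 \<le> F Z"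
    and T [measurable]: "T \<in> M \<rightarrow>\<^sub>M borel" and T1: "\<And>w. norm (T w) \<le> 1"
    and \<eta>: "0 < \<eta>" "\<eta> \<le> 1" and c: "c > 0"
    and H: "\<And>t Z. t > 0 \<Longrightarrow> \<eta> * cosh (t * (c * F Z)) \<le> (\<integral>w. cosh (t * (Z \<bullet> T w)) \<partial>M)"
  shows "integrable gauss (\<lambda>Z. (F Z)\<^sup>2)"
    and "(\<integral>Z. (F Z)\<^sup>2 \<partial>gauss) \<le> 2 * (ln (1 / \<eta>) + ln 2) / c\<^sup>2"
proof -
  interpret P: pair_sigma_finite "gauss :: 'v measure" M ..
  \<comment> \<open>Here exp B = 2 / \<eta>. With \<open>t\<^sup>2 = 2 * B\<close> the bound exp
    (t^2 / 2) / \<eta> becomes exp (2 B) / 2 \<le> cosh (2 B), so the mean of cosh (t c F) is at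
    most cosh (2 B).\<close>
  define B where "B = ln (1 / \<eta>) + ln 2"
  have "ln (1 / \<eta>) \<ge> 0" using \<eta> by (intro ln_ge_zero) auto
  then have B: "B > 0" by (simp add: B_def add_nonneg_pos)
  define t where "t = sqrt (2 * B)"
  have t: "t > 0" "t\<^sup>2 = 2 * B" using B by (auto simp: t_def)
  have mono: "cosh (t * (Z \<bullet> T w)) \<le> cosh (t * norm Z)" for Z w
  proof -
    have "\<bar>Z \<bullet> T w\<bar> \<le> norm Z * norm (T w)" by (rule Cauchy_Schwarz_ineq2)
    also have "\<dots> \<le> norm Z" using T1[of w] by (simp add: mult_left_le)
    finally have "\<bar>t * (Z \<bullet> T w)\<bar> \<le> t * norm Z" using t by (simp add: abs_mult)
    then show ?thesis
      by (metis abs_ge_zero cosh_real_abs cosh_real_nonneg_le_iff order_trans)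
  qed
  have "ennreal \<eta> * (\<integral>\<^sup>+Z. ennreal (cosh (t * (c * F Z))) \<partial>gauss)
      = (\<integral>\<^sup>+Z. ennreal (\<eta> * cosh (t * (c * F Z))) \<partial>gauss)"
    using \<eta> by (subst nn_integral_cmult[symmetric]) (auto simp: ennreal_mult)
  also have "\<dots> \<le> (\<integral>\<^sup>+Z. (\<integral>\<^sup>+w. ennreal (cosh (t * (Z \<bullet> T w))) \<partial>M) \<partial>gauss)"
  proof (intro nn_integral_mono)
    fix Z :: 'v
    have "integrable M (\<lambda>w. cosh (t * (Z \<bullet> T w)))"
      by (rule integrable_const_bound[of _ "cosh (t * norm Z)"]) (use mono in auto)
    then show "ennreal (\<eta> * cosh (t * (c * F Z))) \<le> (\<integral>\<^sup>+w. ennreal (cosh (t * (Z \<bullet> T w))) \<partial>M)"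
      using H[OF t(1), of Z] by (subst nn_integral_eq_integral) (auto intro!: ennreal_leI)
  qed
  also have "\<dots> = (\<integral>\<^sup>+w. (\<integral>\<^sup>+Z. ennreal (cosh (t * (Z \<bullet> T w))) \<partial>gauss) \<partial>M)"
    by (rule P.Fubini'[symmetric]) measurable
  also have "\<dots> \<le> (\<integral>\<^sup>+w. ennreal (exp (t\<^sup>2 / 2)) \<partial>M)"
    by (intro nn_integral_mono gauss_cosh T1)
  also have "\<dots> = ennreal (exp B)" using t by (simp add: emeasure_space_1)
  finally have "ennreal (1 / \<eta>) * (ennreal \<eta> * (\<integral>\<^sup>+Z. ennreal (cosh (t * (c * F Z))) \<partial>gauss)) \<le> ennreal (1 / \<eta>) * ennreal (exp B)"
    by (rule mult_left_mono) simp
  then have "(\<integral>\<^sup>+Z. ennreal (cosh (t * (c * F Z))) \<partial>gauss) \<le> ennreal (exp B / \<eta>)"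
    using \<eta> by (simp add: mult.assoc[symmetric] ennreal_mult[symmetric])
  also have "exp B / \<eta> = exp (2 * B) / 2"
  proof -
    have eB: "exp B = 2 / \<eta>" using \<eta> by (simp add: B_def exp_add)
    have "exp (2 * B) = exp B * exp B" by (simp add: exp_add[symmetric])
    then show ?thesis by (simp add: eB)
  qed
  also have "ennreal (exp (2 * B) / 2) \<le> ennreal (cosh (2 * B))"
    by (intro ennreal_leI) (simp add: cosh_def)
  finally have E: "(\<integral>\<^sup>+Z. ennreal (cosh (t * (c * F Z))) \<partial>gauss) \<le> ennreal (cosh (2 * B))" .
  define k where "k = sinh (2 * B) / (2 * B) / 2"
  have k: "k > 0" using B by (simp add: k_def)
  \<comment> \<open>Convexity of cosh after the square root, in tangent form at (2 B)^2. Taking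
    means yields E (t c F)^2 \<le> (2 B)^2, which is E F^2 \<le> 2 B / c^2.\<close>
  have pointwise: "cosh (2 * B) + k * (t * (c * F Z))\<^sup>2 \<le> cosh (t * (c * F Z)) + k * (2 * B)\<^sup>2" for Z
    using cosh_tangent_square[of "2 * B" "t * (c * F Z)"] B t c F0[of Z]
    by (simp add: k_def algebra_simps)
  have "ennreal (cosh (2 * B)) + ennreal (k * (t * c)\<^sup>2) * (\<integral>\<^sup>+Z. ennreal ((F Z)\<^sup>2) \<partial>gauss)
      = (\<integral>\<^sup>+Z. ennreal (cosh (2 * B) + k * (t * (c * F Z))\<^sup>2) \<partial>gauss)"
    using k gauss.emeasure_space_1[where 'a='v]
    by (simp add: ennreal_plus nn_integral_add nn_integral_cmult[symmetric] power_mult_distrib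
        ennreal_mult[symmetric] mult.assoc)
  also have "\<dots> \<le> (\<integral>\<^sup>+Z. ennreal (cosh (t * (c * F Z)) + k * (2 * B)\<^sup>2) \<partial>gauss)"
    by (intro nn_integral_mono ennreal_leI pointwise)
  also have "\<dots> = (\<integral>\<^sup>+Z. ennreal (cosh (t * (c * F Z))) \<partial>gauss) + ennreal (k * (2 * B)\<^sup>2)"
    using k gauss.emeasure_space_1[where 'a='v] by (simp add: ennreal_plus nn_integral_add)
  also have "\<dots> \<le> ennreal (cosh (2 * B)) + ennreal (k * (2 * B)\<^sup>2)"
    using E by (rule add_right_mono)
  finally have "ennreal (k * (t * c)\<^sup>2) * (\<integral>\<^sup>+Z. ennreal ((F Z)\<^sup>2) \<partial>gauss) \<le> ennreal (k * (2 * B)\<^sup>2)"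
    by (simp add: ennreal_add_left_cancel_le)
  then have "ennreal (1 / (k * (t * c)\<^sup>2)) * (ennreal (k * (t * c)\<^sup>2) * (\<integral>\<^sup>+Z. ennreal ((F Z)\<^sup>2) \<partial>gauss))
      \<le> ennreal (1 / (k * (t * c)\<^sup>2)) * ennreal (k * (2 * B)\<^sup>2)"
    by (rule mult_left_mono) simp
  then have "(\<integral>\<^sup>+Z. ennreal ((F Z)\<^sup>2) \<partial>gauss) \<le> ennreal (1 / (k * (t * c)\<^sup>2) * (k * (2 * B)\<^sup>2))"
    using k t c by (simp add: mult.assoc[symmetric] ennreal_mult[symmetric])
  also have "1 / (k * (t * c)\<^sup>2) * (k * (2 * B)\<^sup>2) = 2 * B / c\<^sup>2"
  proof -
    have "1 / (k * (t * c)\<^sup>2) * (k * (2 * B)\<^sup>2) = (2 * B)\<^sup>2 / (t\<^sup>2 * c\<^sup>2)"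
      using k by (simp add: power_mult_distrib)
    also have "\<dots> = 2 * B / c\<^sup>2"
      unfolding t(2) using B c by (simp add: power2_eq_square)
    finally show ?thesis .
  qed
  finally have fin: "(\<integral>\<^sup>+Z. ennreal ((F Z)\<^sup>2) \<partial>gauss) \<le> ennreal (2 * B / c\<^sup>2)" .
  show int: "integrable gauss (\<lambda>Z. (F Z)\<^sup>2)"
    by (rule integrableI_bounded) (use fin in \<open>auto simp: less_top[symmetric] top_unique\<close>)
  show "(\<integral>Z. (F Z)\<^sup>2 \<partial>gauss) \<le> 2 * (ln (1 / \<eta>) + ln 2) / c\<^sup>2"
    using fin B by (simp add: nn_integral_eq_integral[OF int] B_def)
qed

section \<open>Gaussian caps in complex space\<close>

lemma measurable_vec_lambda [measurable]:
  "(\<lambda>f. (\<chi> i. f i) :: 'b::euclidean_space^'n) \<in> borel_measurable (PiM UNIV (\<lambda>_. borel))"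
proof -
  have "(\<lambda>f. ((\<chi> i. f i) :: 'b^'n) \<bullet> b) \<in> borel_measurable (PiM UNIV (\<lambda>_. borel))" if b: "b \<in> Basis" for b :: "'b^'n"
  proof -
    obtain i u where "b = axis i u" "u \<in> Basis" using b by (auto simp: Basis_vec_def)
    then have "(\<lambda>f. ((\<chi> i. f i) :: 'b^'n) \<bullet> b) = (\<lambda>f. f i \<bullet> u)"
      by (auto simp: inner_axis)
    then show ?thesis by simp
  qed
  then show ?thesis by (subst borel_measurable_euclidean_space) auto
qed

lemma prod_Basis_vec:
  "(\<Prod>b\<in>(Basis :: ('b::euclidean_space^'n) set). f b) = (\<Prod>i\<in>UNIV. \<Prod>u\<in>Basis. f (axis i u))"
proof -
  have "(\<Prod>b\<in>(Basis :: ('b^'n) set). f b) = (\<Prod>b\<in>(\<lambda>(i, u). axis i u) ` (UNIV \<times> Basis). f b)"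
    by (rule prod.cong) (auto simp: Basis_vec_def)
  also have "\<dots> = (\<Prod>p\<in>UNIV \<times> Basis. f (case p of (i, u) \<Rightarrow> axis i u))"
    by (subst prod.reindex) (auto simp: inj_on_def axis_eq_axis nonzero_Basis comp_def)
  finally show ?thesis by (simp add: prod.cartesian_product case_prod_unfold)
qed

lemma lborel_vec:
  "(lborel :: ('b::euclidean_space^'n) measure) = distr (PiM UNIV (\<lambda>_. lborel)) borel (\<lambda>f. \<chi> i. f i)"
proof (rule lborel_eqI)
  interpret L: product_sigma_finite "\<lambda>_::'n. lborel :: 'b measure" by standard
  have [measurable]: "(\<lambda>f. (\<chi> i. f i) :: 'b^'n) \<in> borel_measurable (PiM UNIV (\<lambda>_. lborel))"
    using measurable_vec_lambda by (simp cong: measurable_cong_sets sets_PiM_cong)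
  fix l u :: "'b^'n"
  assume le: "\<And>b. b \<in> Basis \<Longrightarrow> l \<bullet> b \<le> u \<bullet> b"
  have le': "l $ i \<bullet> v \<le> u $ i \<bullet> v" if "v \<in> Basis" for i v
    using le[of "axis i v"] that by (simp add: inner_axis axis_in_Basis_iff)
  have "(\<lambda>f. \<chi> i. f i) -` box l u \<inter> space (PiM UNIV (\<lambda>_. lborel)) = Pi\<^sub>E UNIV (\<lambda>i. box (l $ i) (u $ i))"
    by (auto simp: space_PiM mem_box Basis_vec_def inner_axis PiE_def Pi_def)
  then have "emeasure (distr (PiM UNIV (\<lambda>_. lborel)) borel (\<lambda>f. \<chi> i. f i)) (box l u)
     = emeasure (PiM UNIV (\<lambda>_. lborel)) (Pi\<^sub>E UNIV (\<lambda>i. box (l $ i) (u $ i)))"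
    by (subst emeasure_distr) auto
  also have "\<dots> = (\<Prod>i\<in>UNIV. emeasure lborel (box (l $ i) (u $ i)))"
    by (rule L.emeasure_PiM) auto
  also have "\<dots> = (\<Prod>i\<in>UNIV. ennreal (\<Prod>v\<in>Basis. (u $ i - l $ i) \<bullet> v))"
    by (intro prod.cong refl) (simp add: emeasure_lborel_box_eq le' inner_diff_left)
  also have "\<dots> = ennreal (\<Prod>b\<in>Basis. (u - l) \<bullet> b)"
    unfolding prod_Basis_vec by (subst prod_ennreal) (auto intro!: prod_nonneg simp: le' inner_diff_left inner_axis)
  finally show "emeasure (distr (PiM UNIV (\<lambda>_. lborel)) borel (\<lambda>f. \<chi> i. f i)) (box l u)
     = ennreal (\<Prod>b\<in>Basis. (u - l) \<bullet> b)" .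
qed simp

lemma norm_sq_vec: "(norm (x :: 'b::euclidean_space^'n))\<^sup>2 = (\<Sum>i\<in>UNIV. (norm (x $ i))\<^sup>2)"
  by (simp add: norm_vec_def L2_set_def sum_nonneg)

lemma gauss_density_vec: "gauss_density (x :: 'b::euclidean_space^'n) = (\<Prod>i\<in>UNIV. gauss_density (x $ i))"
proof -
  have "(\<Prod>i\<in>UNIV. gauss_density (x $ i))
     = (\<Prod>i\<in>(UNIV :: 'n set). (1 / sqrt (2 * pi)) ^ DIM('b)) * (\<Prod>i\<in>UNIV. exp (- (norm (x $ i))\<^sup>2 / 2))"
    unfolding gauss_density_def by (rule prod.distrib)
  also have "(\<Prod>i\<in>UNIV. exp (- (norm (x $ i))\<^sup>2 / 2)) = exp (- (norm x)\<^sup>2 / 2)"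
    by (simp add: exp_sum[symmetric] norm_sq_vec sum_negf sum_divide_distrib)
  also have "(\<Prod>i\<in>(UNIV :: 'n set). (1 / sqrt (2 * pi)) ^ DIM('b)) = (1 / sqrt (2 * pi)) ^ DIM('b^'n)"
    by (simp add: power_mult[symmetric] mult.commute)
  finally show ?thesis by (simp add: gauss_density_def)
qed

lemma nn_integral_gauss_vec:
  fixes g :: "'b::euclidean_space^'n \<Rightarrow> ennreal"
  assumes [measurable]: "g \<in> borel_measurable borel"
  shows "(\<integral>\<^sup>+x. g x \<partial>gauss) = (\<integral>\<^sup>+f. g (\<chi> i. f i) \<partial>PiM UNIV (\<lambda>_. gauss))"
proof -
  have [measurable]: "(\<lambda>f. (\<chi> i. f i) :: 'b^'n) \<in> borel_measurable (PiM UNIV (\<lambda>_. lborel))"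
    using measurable_vec_lambda by (simp cong: measurable_cong_sets sets_PiM_cong)
  have *: "PiM UNIV (\<lambda>_::'n. gauss :: 'b measure)
    = density (PiM UNIV (\<lambda>_. lborel)) (\<lambda>f. ennreal (\<Prod>i\<in>UNIV. gauss_density (f i)))"
    unfolding gauss_def
    by (rule PiM_density) (use prob_space_gauss in \<open>auto simp: gauss_def\<close>)
  have "(\<integral>\<^sup>+x. g x \<partial>gauss) = (\<integral>\<^sup>+f. ennreal (gauss_density ((\<chi> i. f i) :: 'b^'n)) * g (\<chi> i. f i) \<partial>PiM UNIV (\<lambda>_. lborel))"
    by (subst nn_integral_gauss, simp, subst lborel_vec, subst nn_integral_distr) auto
  then show ?thesis
    unfolding * by (subst nn_integral_density) (auto simp: gauss_density_vec)
qed

text \<open>Writing exp (-|y|^2 / 2) as the integral of t exp (-t^2 / 2) over t > |y| and exchanging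
  the integrals reduces everything to the area pi (t^2 - r^2) of an annulus.\<close>

lemma gauss_complex_tail:
  assumes a: "a \<ge> 0"
  shows "(\<integral>\<^sup>+y. indicator {y. a \<le> (norm y)\<^sup>2} y \<partial>(gauss :: complex measure)) = ennreal (exp (- a / 2))"
proof -
  define r where "r = sqrt a"
  have r: "r \<ge> 0" "r\<^sup>2 = a" using a by (auto simp: r_def)
  have iff: "a \<le> (norm y)\<^sup>2 \<longleftrightarrow> r \<le> norm y" for y :: complex
    using r by (metis norm_ge_zero power2_le_imp_le power_mono)
  have area: "emeasure lborel (ball (0 :: complex) t - ball 0 r) = ennreal (pi * (t\<^sup>2 - r\<^sup>2))" if "t > r" for t
  proof -
    have "emeasure lborel (ball (0 :: complex) t - ball 0 r)
        = emeasure lborel (ball (0 :: complex) t) - emeasure lborel (ball (0 :: complex) r)"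
      by (rule emeasure_Diff) (use that r in \<open>auto simp: emeasure_ball\<close>)
    also have "\<dots> = ennreal (pi * t\<^sup>2) - ennreal (pi * r\<^sup>2)"
      using that r by (simp add: emeasure_ball unit_ball_vol_2)
    also have "\<dots> = ennreal (pi * t\<^sup>2 - pi * r\<^sup>2)" by (rule ennreal_minus) simp
    finally show ?thesis by (simp add: algebra_simps)
  qed
  have "(\<integral>\<^sup>+y. indicator {y. a \<le> (norm y)\<^sup>2} y \<partial>(gauss :: complex measure))
     = (\<integral>\<^sup>+y. ennreal (gauss_density y) * indicator {y. a \<le> (norm y)\<^sup>2} y \<partial>(lborel :: complex measure))"
    by (rule nn_integral_gauss) measurable
  also have "\<dots> = (\<integral>\<^sup>+y. (\<integral>\<^sup>+t. ennreal (1 / (2 * pi)) * (ennreal (t * exp (- t\<^sup>2 / 2)) * indicator {r<..} t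
      * indicator {p. r \<le> norm (fst p) \<and> norm (fst p) < snd p} (y, t)) \<partial>(lborel :: real measure)) \<partial>(lborel :: complex measure))"
  proof (intro nn_integral_cong)
    fix y :: complex
    have "(\<integral>\<^sup>+t. ennreal (1 / (2 * pi)) * (ennreal (t * exp (- t\<^sup>2 / 2)) * indicator {r<..} t
      * indicator {p. r \<le> norm (fst p) \<and> norm (fst p) < snd p} (y, t)) \<partial>(lborel :: real measure))
      = (\<integral>\<^sup>+t. (ennreal (1 / (2 * pi)) * indicator {y. a \<le> (norm y)\<^sup>2} y) * (ennreal (t * exp (- t\<^sup>2 / 2)) * indicator {norm y<..} t) \<partial>lborel)"
      by (intro nn_integral_cong) (auto simp: iff split: split_indicator)
    also have "\<dots> = (ennreal (1 / (2 * pi)) * indicator {y. a \<le> (norm y)\<^sup>2} y) * ennreal (exp (- (norm y)\<^sup>2 / 2))"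
      by (subst nn_integral_cmult) (simp_all only: gaussian_tail norm_ge_zero, auto)
    also have "\<dots> = ennreal (gauss_density y) * indicator {y. a \<le> (norm y)\<^sup>2} y"
      by (auto simp: gauss_density_def ennreal_mult[symmetric] power_divide split: split_indicator)
    finally show "ennreal (gauss_density y) * indicator {y. a \<le> (norm y)\<^sup>2} y
      = (\<integral>\<^sup>+t. ennreal (1 / (2 * pi)) * (ennreal (t * exp (- t\<^sup>2 / 2)) * indicator {r<..} t
      * indicator {p. r \<le> norm (fst p) \<and> norm (fst p) < snd p} (y, t)) \<partial>(lborel :: real measure))" ..
  qed
  also have "\<dots> = (\<integral>\<^sup>+t. (\<integral>\<^sup>+y. ennreal (1 / (2 * pi)) * (ennreal (t * exp (- t\<^sup>2 / 2)) * indicator {r<..} t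
      * indicator {p. r \<le> norm (fst p) \<and> norm (fst p) < snd p} (y, t)) \<partial>(lborel :: complex measure)) \<partial>(lborel :: real measure))"
    by (rule lborel_pair.Fubini'[symmetric]) measurable
  also have "\<dots> = (\<integral>\<^sup>+t. ennreal ((t * (t\<^sup>2 - r\<^sup>2) / 2) * exp (- t\<^sup>2 / 2)) * indicator {r..} t \<partial>lborel)"
  proof (intro nn_integral_cong)
    fix t :: real
    show "(\<integral>\<^sup>+y. ennreal (1 / (2 * pi)) * (ennreal (t * exp (- t\<^sup>2 / 2)) * indicator {r<..} t
      * indicator {p. r \<le> norm (fst p) \<and> norm (fst p) < snd p} (y, t)) \<partial>(lborel :: complex measure))
      = ennreal ((t * (t\<^sup>2 - r\<^sup>2) / 2) * exp (- t\<^sup>2 / 2)) * indicator {r..} t"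
    proof (cases "t > r")
      case True
      have *: "ennreal (1 / (2 * pi) * (t * exp (- t\<^sup>2 / 2))) = ennreal (1 / (2 * pi)) * ennreal (t * exp (- t\<^sup>2 / 2))"
        by (rule ennreal_mult) (use True r in auto)
      have "(\<integral>\<^sup>+y. ennreal (1 / (2 * pi)) * (ennreal (t * exp (- t\<^sup>2 / 2)) * indicator {r<..} t
        * indicator {p. r \<le> norm (fst p) \<and> norm (fst p) < snd p} (y, t)) \<partial>(lborel :: complex measure))
        = (\<integral>\<^sup>+y. ennreal (1 / (2 * pi) * (t * exp (- t\<^sup>2 / 2))) * indicator (ball 0 t - ball 0 r) y \<partial>(lborel :: complex measure))"
        unfolding * using True r by (intro nn_integral_cong) (auto split: split_indicator)
      also have "\<dots> = ennreal (1 / (2 * pi) * (t * exp (- t\<^sup>2 / 2))) * ennreal (pi * (t\<^sup>2 - r\<^sup>2))"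
        by (subst nn_integral_cmult_indicator) (auto simp: area[OF True])
      also have "\<dots> = ennreal (1 / (2 * pi) * (t * exp (- t\<^sup>2 / 2)) * (pi * (t\<^sup>2 - r\<^sup>2)))"
        using True r by (intro ennreal_mult[symmetric]) (auto intro!: power_mono mult_nonneg_nonneg)
      also have "1 / (2 * pi) * (t * exp (- t\<^sup>2 / 2)) * (pi * (t\<^sup>2 - r\<^sup>2)) = (t * (t\<^sup>2 - r\<^sup>2) / 2) * exp (- t\<^sup>2 / 2)"
        by simp
      finally show ?thesis using True by simp
    next
      case False
      then show ?thesis by (cases "t = r") auto
    qed
  qed
  also have "\<dots> = ennreal (0 - - ((r\<^sup>2 + 2 - r\<^sup>2) / 2 * exp (- r\<^sup>2 / 2)))"
  \<comment> \<open>The antiderivative comes from integration by parts; at t = r its value is -exp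
    (-r^2 / 2).\<close>
  proof (rule nn_integral_FTC_atLeast[where F="\<lambda>t. - ((t\<^sup>2 + 2 - r\<^sup>2) / 2 * exp (- t\<^sup>2 / 2))"])
    show "DERIV (\<lambda>t. - ((t\<^sup>2 + 2 - r\<^sup>2) / 2 * exp (- t\<^sup>2 / 2))) t :> (t * (t\<^sup>2 - r\<^sup>2) / 2) * exp (- t\<^sup>2 / 2)" for t
      by (auto intro!: derivative_eq_intros simp: field_simps power2_eq_square)
    show "0 \<le> (t * (t\<^sup>2 - r\<^sup>2) / 2) * exp (- t\<^sup>2 / 2)" if "r \<le> t" for t
      using that r by (auto intro!: mult_nonneg_nonneg power_mono)
    show "((\<lambda>t. - ((t\<^sup>2 + 2 - r\<^sup>2) / 2 * exp (- t\<^sup>2 / 2))) \<longlongrightarrow> (0::real)) at_top"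
      by real_asymp
  qed measurable
  finally show ?thesis using r by simp
qed

text \<open>Rescaling by sqrt (1 + \<kappa>) absorbs the factor into the density; the exponent is 1
  because the real dimension is 2.\<close>

lemma gauss_complex_exp:
  assumes \<kappa>: "\<kappa> \<ge> 0"
  shows "(\<integral>\<^sup>+y. ennreal (exp (- (\<kappa> * (norm y)\<^sup>2) / 2)) \<partial>(gauss :: complex measure)) = ennreal (1 / (1 + \<kappa>))"
proof -
  define c where "c = sqrt (1 + \<kappa>)"
  have c: "c > 0" "c\<^sup>2 = 1 + \<kappa>" using \<kappa> by (auto simp: c_def)
  have "(\<integral>\<^sup>+y. ennreal (exp (- (\<kappa> * (norm y)\<^sup>2) / 2)) \<partial>(gauss :: complex measure))
     = (\<integral>\<^sup>+y. ennreal (gauss_density (c *\<^sub>R y)) \<partial>(lborel :: complex measure))"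
    using c by (subst nn_integral_gauss)
      (auto intro!: nn_integral_cong simp: gauss_density_def ennreal_mult[symmetric] power_mult_distrib
          mult.assoc exp_add[symmetric] ring_distribs add_divide_distrib)
  also have "\<dots> = ennreal (1 / (1 + \<kappa>)) * (\<integral>\<^sup>+y. ennreal (gauss_density y) \<partial>(lborel :: complex measure))"
    using c by (subst lborel_affine[of "1 / c" 0])
      (auto simp: nn_integral_density nn_integral_distr nn_integral_cmult power_divide)
  also have "(\<integral>\<^sup>+y. ennreal (gauss_density y) \<partial>(lborel :: complex measure)) = 1"
    using nn_integral_gauss[of "\<lambda>_::complex. 1"] gauss.emeasure_space_1[where 'a=complex] by simp
  finally show ?thesis by simp
qed

interpretation gauss_prod: product_sigma_finite "\<lambda>_. gauss :: 'a::euclidean_space measure"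
  by (intro product_sigma_finite.intro prob_space_imp_sigma_finite prob_space_gauss)

text \<open>The condition says |z_i|^2 \<ge> \<kappa> S, where \<kappa> = \<rho> / (1 - \<rho>) and
  S is the sum of |z_j|^2 over j distinct from i. Given the other coordinates its probability is exp
  (-\<kappa> S / 2), a product of n - 1 factors with mean 1 / (1 + \<kappa>) = 1 - \<rho>
  each.\<close>

lemma gauss_cap_axis:
  fixes i :: "'n::finite"
  assumes \<rho>: "0 < \<rho>" "\<rho> < 1"
  shows "measure gauss {z :: complex^'n. \<rho> * (norm z)\<^sup>2 \<le> (norm (z $ i))\<^sup>2} = (1 - \<rho>) ^ (CARD('n) - 1)"
proof -
  define \<kappa> where "\<kappa> = \<rho> / (1 - \<rho>)"
  have \<kappa>: "\<kappa> \<ge> 0" using \<rho> by (simp add: \<kappa>_def)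
  define C where "C = {z :: complex^'n. \<rho> * (norm z)\<^sup>2 \<le> (norm (z $ i))\<^sup>2}"
  have [measurable]: "C \<in> sets borel" unfolding C_def by (intro borel_closed closed_Collect_le continuous_intros)
  define I where "I = UNIV - {i}"
  have I: "finite I" "i \<notin> I" "insert i I = UNIV" by (auto simp: I_def)
  have C_iff: "(\<chi> j. (x(i := y)) j) \<in> C \<longleftrightarrow> (\<Sum>j\<in>I. \<kappa> * (norm (x j))\<^sup>2) \<le> (norm y)\<^sup>2" for x and y :: complex
  proof -
    have "(\<Sum>j\<in>UNIV. (norm ((x(i := y)) j))\<^sup>2) = (norm y)\<^sup>2 + (\<Sum>j\<in>I. (norm (x j))\<^sup>2)"
      by (subst sum.remove[of UNIV i]) (auto simp: I_def intro!: sum.cong)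
    moreover have "\<rho> * (Y + S) \<le> Y \<longleftrightarrow> \<kappa> * S \<le> Y" for Y S
      using \<rho> by (simp add: \<kappa>_def field_simps)
    ultimately show ?thesis
      by (simp add: C_def norm_sq_vec sum_distrib_left[symmetric])
  qed
  have "emeasure gauss C = (\<integral>\<^sup>+x. (\<integral>\<^sup>+y. indicator C (\<chi> j. (x(i := y)) j) \<partial>gauss) \<partial>PiM I (\<lambda>_. gauss))"
  proof -
    have [measurable]: "(\<lambda>f. indicator C (\<chi> j. f j) :: ennreal) \<in> borel_measurable (PiM UNIV (\<lambda>_::'n. gauss))"
    proof -
      have [measurable]: "(\<lambda>f. (\<chi> i. f i) :: complex^'n) \<in> borel_measurable (PiM UNIV (\<lambda>_. gauss))"
        using measurable_vec_lambda by (simp cong: measurable_cong_sets sets_PiM_cong)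
      show ?thesis by measurable
    qed
    have "emeasure gauss C = (\<integral>\<^sup>+z. indicator C z \<partial>gauss)" by simp
    also have "\<dots> = (\<integral>\<^sup>+f. indicator C (\<chi> j. f j) \<partial>PiM (insert i I) (\<lambda>_. gauss))"
      unfolding I(3) by (rule nn_integral_gauss_vec) measurable
    also have "\<dots> = (\<integral>\<^sup>+x. (\<integral>\<^sup>+y. indicator C (\<chi> j. (x(i := y)) j) \<partial>gauss) \<partial>PiM I (\<lambda>_. gauss))"
      using I by (intro gauss_prod.product_nn_integral_insert) auto
    finally show ?thesis .
  qed
  also have "\<dots> = (\<integral>\<^sup>+x. (\<Prod>j\<in>I. ennreal (exp (- (\<kappa> * (norm (x j))\<^sup>2) / 2))) \<partial>PiM I (\<lambda>_. gauss :: complex measure))"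
  proof (intro nn_integral_cong)
    fix x :: "'n \<Rightarrow> complex"
    have "(\<integral>\<^sup>+y. indicator C (\<chi> j. (x(i := y)) j) \<partial>gauss)
       = (\<integral>\<^sup>+y. indicator {y. (\<Sum>j\<in>I. \<kappa> * (norm (x j))\<^sup>2) \<le> (norm y)\<^sup>2} y \<partial>(gauss :: complex measure))"
      by (intro nn_integral_cong) (use C_iff in \<open>auto split: split_indicator\<close>)
    also have "\<dots> = ennreal (exp (- (\<Sum>j\<in>I. \<kappa> * (norm (x j))\<^sup>2) / 2))"
      using \<kappa> by (intro gauss_complex_tail sum_nonneg) auto
    also have "exp (- (\<Sum>j\<in>I. \<kappa> * (norm (x j))\<^sup>2) / 2) = (\<Prod>j\<in>I. exp (- (\<kappa> * (norm (x j))\<^sup>2) / 2))"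
      using I(1) by (simp add: exp_sum[symmetric] sum_negf sum_divide_distrib)
    finally show "(\<integral>\<^sup>+y. indicator C (\<chi> j. (x(i := y)) j) \<partial>gauss) = (\<Prod>j\<in>I. ennreal (exp (- (\<kappa> * (norm (x j))\<^sup>2) / 2)))"
      by (simp add: prod_ennreal)
  qed
  also have "\<dots> = (\<Prod>j\<in>I. \<integral>\<^sup>+y. ennreal (exp (- (\<kappa> * (norm y)\<^sup>2) / 2)) \<partial>(gauss :: complex measure))"
    using I by (intro gauss_prod.product_nn_integral_prod) auto
  also have "\<dots> = ennreal ((1 / (1 + \<kappa>)) ^ (CARD('n) - 1))"
    using \<kappa> unfolding gauss_complex_exp[OF \<kappa>] by (simp add: ennreal_power I_def)
  also have "1 / (1 + \<kappa>) = 1 - \<rho>" using \<rho> by (simp add: \<kappa>_def field_simps)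
  finally show ?thesis using \<rho> by (simp add: C_def measure_def)
qed


section \<open>Caps and the mean of the projections over a cap\<close>

lemma integral_gauss_isometry:
  fixes f :: "'a::euclidean_space \<Rightarrow> 'a" and g :: "'a \<Rightarrow> 'b::{banach, second_countable_topology}"
  assumes "linear f" "\<And>x. norm (f x) = norm x" "surj f" and [measurable]: "g \<in> borel_measurable borel"
  shows "(\<integral>x. g (f x) \<partial>gauss) = (\<integral>x. g x \<partial>gauss)"
proof -
  have [measurable]: "f \<in> borel_measurable borel"
    using assms(1) by (simp add: borel_measurable_continuous_onI linear_continuous_on linear_conv_bounded_linear)
  show ?thesis
    by (subst (2) distr_gauss_isometry[OF assms(1-3), symmetric], subst integral_distr) auto
qed

lemma AE_gauss_nonzero: "AE x in (gauss :: 'a::euclidean_space measure). x \<noteq> 0"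
  unfolding gauss_def by (subst AE_density) (auto intro: eventually_mono[OF AE_lborel_singleton[of 0]])

definition hinner :: "complex^'n \<Rightarrow> complex^'n \<Rightarrow> complex" where
  "hinner x y = (\<Sum>i\<in>UNIV. cnj (x $ i) * y $ i)"

text \<open>The projection onto the line through \<open>z\<close>, normalised so that a Gaussian
  vector can be inserted directly. At 0 it is the zero matrix, by division by 0.\<close>

definition pure :: "complex^'n \<Rightarrow> complex^'n^'n" where
  "pure z = (\<chi> i j. z $ i * cnj (z $ j) / (norm z)\<^sup>2)"

text \<open>A cone in place of a spherical cap: by homogeneity its Gaussian measure is the uniform
  measure of the cap.\<close>

definition cap :: "complex^'n \<Rightarrow> real \<Rightarrow> (complex^'n) set" where
  "cap x \<rho> = {z. \<rho> * (norm z)\<^sup>2 \<le> (norm (hinner x z))\<^sup>2}"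

lemma hinner_axis: "hinner (axis i 1) z = z $ i"
  by (simp add: hinner_def axis_def if_distrib if_distribR cong: if_cong)

lemma hinner_self: "hinner z z = of_real ((norm z)\<^sup>2)"
  by (simp add: hinner_def norm_sq_vec mult.commute complex_norm_square[symmetric] del: of_real_power)

lemma closed_cap: "closed (cap x \<rho>)"
  unfolding cap_def hinner_def by (intro closed_Collect_le continuous_intros)

lemma cap_borel [measurable]: "cap x \<rho> \<in> sets borel"
  by (rule borel_closed[OF closed_cap])

lemma measurable_vec_nth [measurable]: "(\<lambda>z :: 'b::euclidean_space^'n. z $ i) \<in> borel_measurable borel"
  by (intro borel_measurable_continuous_onI continuous_intros)

lemma measurable_pure_nth [measurable]: "(\<lambda>z :: complex^'n. pure z $ i $ j) \<in> borel_measurable borel"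
proof -
  have [measurable]: "(\<lambda>z :: complex^'n. z $ i * cnj (z $ j)) \<in> borel_measurable borel"
    by (intro borel_measurable_continuous_onI continuous_intros)
  have [measurable]: "(\<lambda>z :: complex^'n. complex_of_real ((norm z)\<^sup>2)) \<in> borel_measurable borel"
    by (intro borel_measurable_continuous_onI continuous_intros)
  show ?thesis unfolding pure_def by simp
qed

lemma pure_nth_diag: "pure z $ a $ a = of_real ((norm (z $ a))\<^sup>2 / (norm z)\<^sup>2)"
  by (simp add: pure_def complex_norm_square[symmetric] del: of_real_power)

lemma norm_pure_nth_le: "norm (pure z $ i $ j) \<le> 1"
proof (cases "z = 0")
  case False
  have "norm (z $ i) * norm (z $ j) \<le> norm z * norm z"
    by (intro mult_mono Finite_Cartesian_Product.norm_nth_le) auto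
  then show ?thesis using False
    by (simp add: pure_def norm_mult norm_divide norm_power power2_eq_square divide_le_eq)
qed (simp add: pure_def)

text \<open>The cap about an axis is invariant under a sign change of one coordinate, which kills
  the off-diagonal means, and under exchanging two coordinates other than \<open>i\<close>, which
  makes the other diagonal means equal. The trace fixes them in terms of the mean \<open>s\<close>
  of |z_i|^2 / |z|^2, which is only located between \<rho> and 1.\<close>

lemma gauss_cap_mean_axis:
  fixes i :: "'n::finite"
  assumes \<rho>: "0 < \<rho>" "\<rho> < 1" and n: "CARD('n) \<ge> 2"
  shows "\<exists>s. \<rho> \<le> s \<and> s \<le> 1 \<and> (\<forall>a b. (\<integral>z. indicator (cap (axis i 1) \<rho>) z *\<^sub>R (pure (z :: complex^'n) $ a $ b) \<partial>gauss)
    = of_real ((1 - \<rho>) ^ (CARD('n) - 1) * (if a = b then if a = i then s else (1 - s) / (real CARD('n) - 1) else 0)))"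
proof -
  define C where "C = cap (axis i (1 :: complex)) \<rho>"
  have C: "C = {z. \<rho> * (norm z)\<^sup>2 \<le> (norm (z $ i))\<^sup>2}" by (simp add: C_def cap_def hinner_axis)
  have [measurable]: "C \<in> sets borel" by (simp add: C_def)
  define P where "P = (1 - \<rho>) ^ (CARD('n) - 1)"
  have P: "P > 0" "measure gauss C = P"
    using \<rho> gauss_cap_axis[OF \<rho>, of i] by (auto simp: P_def C)
  define Q where "Q a b = (\<integral>z. indicator C z *\<^sub>R (pure z $ a $ b) \<partial>gauss)" for a b
  define R where "R a = (\<integral>z. indicator C z * ((norm (z $ a))\<^sup>2 / (norm z)\<^sup>2) \<partial>gauss)" for a
  have le1: "(norm (z $ a))\<^sup>2 / (norm z)\<^sup>2 \<le> 1" for z :: "complex^'n" and a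
    using Finite_Cartesian_Product.norm_nth_le[of z a] by (simp add: divide_le_eq power_mono)
  have intR: "integrable gauss (\<lambda>z :: complex^'n. indicator C z * ((norm (z $ a))\<^sup>2 / (norm z)\<^sup>2))" for a
    by (rule gauss.integrable_const_bound[of _ 1])
      (use le1 in \<open>auto split: split_indicator\<close>)
  have QR: "Q a a = of_real (R a)" for a
    unfolding Q_def R_def by (simp add: pure_nth_diag scaleR_conv_of_real flip: integral_complex_of_real)
  have off: "Q a b = 0" if "a \<noteq> b" for a b
  proof -
    define F where "F z = (\<chi> j. if j = a then - z $ j else z $ j)" for z :: "complex^'n"
    have lin: "linear F" by (rule linearI) (auto simp: F_def vec_eq_iff)
    have nrm: "norm (F z) = norm z" for z
      unfolding norm_vec_def by (rule arg_cong2[where f=L2_set]) (auto simp: F_def fun_eq_iff)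
    have "F (F z) = z" for z by (simp add: F_def vec_eq_iff)
    then have surj: "surj F" by (metis surjI)
    have "Q a b = (\<integral>z. indicator C (F z) *\<^sub>R (pure (F z) $ a $ b) \<partial>gauss)"
      unfolding Q_def by (rule integral_gauss_isometry[OF lin nrm surj, symmetric]) measurable
    also have "\<dots> = (\<integral>z. - (indicator C z *\<^sub>R (pure z $ a $ b)) \<partial>gauss)"
    proof (rule Bochner_Integration.integral_cong[OF refl])
      fix z :: "complex^'n"
      have "F z \<in> C \<longleftrightarrow> z \<in> C" by (simp add: C nrm) (simp add: F_def)
      moreover have "pure (F z) $ a $ b = - (pure z $ a $ b)"
        using that by (simp add: pure_def nrm) (simp add: F_def)
      ultimately show "indicator C (F z) *\<^sub>R (pure (F z) $ a $ b) = - (indicator C z *\<^sub>R (pure z $ a $ b))"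
        by (simp add: indicator_def)
    qed
    also have "\<dots> = - Q a b" by (simp add: Q_def)
    finally show ?thesis by simp
  qed
  have diag: "R a = R b" if "a \<noteq> i" "b \<noteq> i" for a b
  proof -
    define \<tau> where "\<tau> = Transposition.transpose a b"
    define F where "F z = (\<chi> j. z $ \<tau> j)" for z :: "complex^'n"
    have \<tau>: "\<tau> (\<tau> j) = j" "\<tau> i = i" "\<tau> a = b" for j
      using that by (auto simp: \<tau>_def transpose_def)
    have lin: "linear F" by (rule linearI) (auto simp: F_def vec_eq_iff)
    have nrm: "norm (F z) = norm z" for z
    proof -
      have "(\<Sum>j\<in>UNIV. (norm (z $ \<tau> j))\<^sup>2) = (\<Sum>j\<in>UNIV. (norm (z $ j))\<^sup>2)"
        by (rule sum.reindex_bij_witness[of _ \<tau> \<tau>]) (auto simp: \<tau>)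
      then have "(norm (F z))\<^sup>2 = (norm z)\<^sup>2" by (simp add: norm_sq_vec F_def)
      then show ?thesis by simp
    qed
    have "F (F z) = z" for z by (simp add: F_def vec_eq_iff \<tau>)
    then have surj: "surj F" by (metis surjI)
    have "R a = (\<integral>z. indicator C (F z) * ((norm (F z $ a))\<^sup>2 / (norm (F z))\<^sup>2) \<partial>gauss)"
      unfolding R_def by (rule integral_gauss_isometry[OF lin nrm surj, symmetric]) measurable
    also have "\<dots> = R b"
      unfolding R_def by (rule Bochner_Integration.integral_cong[OF refl])
        (simp add: C nrm indicator_def, simp add: F_def \<tau>)
    finally show ?thesis .
  qed
  have total: "(\<Sum>a\<in>UNIV. R a) = P"
  proof -
    have "(\<Sum>a\<in>UNIV. R a) = (\<integral>z. (\<Sum>a\<in>UNIV. indicator C z * ((norm (z $ a))\<^sup>2 / (norm z)\<^sup>2)) \<partial>gauss)"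
      unfolding R_def by (rule Bochner_Integration.integral_sum[symmetric]) (rule intR)
    also have "\<dots> = (\<integral>z. indicator C z \<partial>gauss)"
    proof (rule integral_cong_AE)
      show "AE z in gauss. (\<Sum>a\<in>UNIV. indicator C z * ((norm (z $ a))\<^sup>2 / (norm z)\<^sup>2)) = indicator C z"
        using AE_gauss_nonzero
      proof eventually_elim
        case (elim z)
        have "(\<Sum>a\<in>UNIV. indicator C z * ((norm (z $ a))\<^sup>2 / (norm z)\<^sup>2)) = indicator C z * ((norm z)\<^sup>2 / (norm z)\<^sup>2)"
          unfolding sum_distrib_left[symmetric] sum_divide_distrib[symmetric] norm_sq_vec[symmetric] ..
        then show ?case using elim by simp
      qed
    qed measurable
    finally show ?thesis using P by simp
  qed
  have Ri: "\<rho> * P \<le> R i" "R i \<le> P"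
  proof -
    have "\<rho> * P = (\<integral>z. indicator C z * \<rho> \<partial>gauss)" using P by simp
    also have "\<dots> \<le> R i" unfolding R_def
    proof (rule integral_mono_AE[OF _ intR])
      show "AE z in gauss. indicator C z * \<rho> \<le> indicator C z * ((norm (z $ i))\<^sup>2 / (norm z)\<^sup>2)"
        using AE_gauss_nonzero
        by eventually_elim (auto simp: C field_simps split: split_indicator)
      show "integrable gauss (\<lambda>z :: complex^'n. indicator C z * \<rho>)"
        by (rule gauss.integrable_const_bound[of _ "\<bar>\<rho>\<bar>"]) (auto split: split_indicator)
    qed
    finally show "\<rho> * P \<le> R i" .
    have "R a \<ge> 0" for a unfolding R_def by (rule integral_nonneg_AE) auto
    then have "R i \<le> (\<Sum>a\<in>UNIV. R a)" by (intro member_le_sum) auto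
    then show "R i \<le> P" by (simp add: total)
  qed
  define s where "s = R i / P"
  have other: "R a = P * ((1 - s) / (real CARD('n) - 1))" if "a \<noteq> i" for a
  proof -
    have "P = R i + (\<Sum>b\<in>UNIV - {i}. R b)" unfolding total[symmetric] by (simp add: sum.remove)
    also have "(\<Sum>b\<in>UNIV - {i}. R b) = (\<Sum>b\<in>UNIV - {i}. R a)"
      by (intro sum.cong refl diag) (use that in auto)
    also have "\<dots> = (real CARD('n) - 1) * R a" using n by (simp add: of_nat_diff)
    finally have eq: "P = R i + (real CARD('n) - 1) * R a" .
    have "P * (1 - s) = P - R i" using P by (simp add: s_def right_diff_distrib)
    then have "P * (1 - s) = (real CARD('n) - 1) * R a" using eq by linarith
    moreover have "real CARD('n) - 1 \<noteq> 0" using n by simp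
    ultimately show ?thesis by simp
  qed
  have "Q a b = of_real (P * (if a = b then if a = i then s else (1 - s) / (real CARD('n) - 1) else 0))" for a b
    using off[of a b] other[of a] P by (auto simp: QR s_def)
  moreover have "\<rho> \<le> s" "s \<le> 1" using Ri P by (auto simp: s_def field_simps)
  ultimately show ?thesis unfolding Q_def C_def P_def by blast
qed


section \<open>Unitary invariance\<close>

definition unitary :: "complex^'n^'n \<Rightarrow> bool" where
  "unitary U \<longleftrightarrow> (\<forall>a b. (\<Sum>c\<in>UNIV. U $ a $ c * cnj (U $ b $ c)) = (if a = b then 1 else 0)) \<and>
                 (\<forall>a b. (\<Sum>c\<in>UNIV. cnj (U $ c $ a) * U $ c $ b) = (if a = b then 1 else 0))"

lemma unitary_hinner:
  assumes "unitary U"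
  shows "hinner (U *v x) (U *v y) = hinner x y"
proof -
  have "hinner (U *v x) (U *v y) = (\<Sum>c\<in>UNIV. \<Sum>a\<in>UNIV. \<Sum>b\<in>UNIV. (cnj (U $ c $ a) * cnj (x $ a)) * (U $ c $ b * y $ b))"
    by (simp add: hinner_def matrix_vector_mult_def sum_product cnj_sum)
  also have "\<dots> = (\<Sum>a\<in>UNIV. \<Sum>b\<in>UNIV. \<Sum>c\<in>UNIV. (cnj (U $ c $ a) * cnj (x $ a)) * (U $ c $ b * y $ b))"
    by (subst sum.swap, rule sum.cong, rule refl, rule sum.swap)
  also have "\<dots> = (\<Sum>a\<in>UNIV. \<Sum>b\<in>UNIV. cnj (x $ a) * y $ b * (\<Sum>c\<in>UNIV. cnj (U $ c $ a) * U $ c $ b))"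
    by (simp add: sum_distrib_left mult_ac)
  also have "\<dots> = hinner x y"
  proof -
    have *: "(\<Sum>c\<in>UNIV. cnj (U $ c $ a) * U $ c $ b) = (if a = b then 1 else 0)" for a b
      using assms unfolding unitary_def by blast
    show ?thesis unfolding * by (simp add: hinner_def if_distrib cong: if_cong)
  qed
  finally show ?thesis .
qed

lemma unitary_norm: "unitary U \<Longrightarrow> norm (U *v x) = norm x"
  using unitary_hinner[of U x x] by (simp add: hinner_self del: of_real_power)

lemma linear_complex_matrix: "linear (\<lambda>x. U *v (x :: complex^'n))"
  by (rule linearI)
    (auto simp: matrix_vector_mult_def vec_eq_iff ring_distribs sum.distrib scaleR_sum_right)

lemma unitary_surj:
  assumes "unitary U"
  shows "surj (\<lambda>x. U *v (x :: complex^'n))"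
proof (rule linear_inj_imp_surj[OF linear_complex_matrix])
  have "x = 0" if "U *v x = 0" for x using unitary_norm[OF assms, of x] that by simp
  then show "inj (\<lambda>x. U *v (x :: complex^'n))"
    using linear_injective_0[OF linear_complex_matrix, of U] by blast
qed

text \<open>Householder reflection in the hyperplane orthogonal to \<open>e\<^sub>i - \<theta> x\<close>, where the phase \<open>\<theta>\<close>
  makes \<open>\<theta> x\<^sub>i\<close> real.\<close>

lemma unitary_transitive:
  fixes x :: "complex^'n"
  assumes x: "norm x = 1"
  obtains U \<theta> where "unitary U" "norm \<theta> = 1" "U *v axis i 1 = (\<chi> j. \<theta> * x $ j)"
proof -
  define \<theta> where "\<theta> = (if x $ i = 0 then 1 else cnj (sgn (x $ i)))"
  have \<theta>: "norm \<theta> = 1" by (simp add: \<theta>_def norm_sgn)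
  have \<theta>x: "\<theta> * x $ i = of_real (norm (x $ i))"
  proof (cases "x $ i = 0")
    case False
    then have "cnj (sgn (x $ i)) * x $ i = of_real (norm (x $ i))"
      by (simp add: sgn_eq complex_norm_square[symmetric] mult.commute power2_eq_square del: of_real_power)
    then show ?thesis using False by (simp add: \<theta>_def)
  qed simp
  define v where "v = (\<chi> j. (if j = i then 1 else 0) - \<theta> * x $ j)"
  define U where "U = (\<chi> a b. (if a = b then 1 else 0) - 2 / (norm v)\<^sup>2 * (v $ a * cnj (v $ b)))"
  \<comment> \<open>Because \<theta> x_i is real, |v|^2 = 2 v_i. Hence the reflection subtracts
    exactly \<open>v\<close> from the axis vector.\<close>
  have vnorm: "(norm v)\<^sup>2 = 2 - 2 * norm (x $ i)"
  proof -
    have \<theta>\<theta>: "\<theta> * cnj \<theta> = 1" using complex_norm_square[of \<theta>] \<theta> by simp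
    have "complex_of_real ((norm v)\<^sup>2) = (\<Sum>j\<in>UNIV. v $ j * cnj (v $ j))"
      by (simp add: norm_sq_vec complex_norm_square[symmetric] del: of_real_power)
    also have "\<dots> = (\<Sum>j\<in>UNIV. (if j = i then 1 - \<theta> * x $ j - cnj (\<theta> * x $ j) else 0) + (\<theta> * cnj \<theta>) * (x $ j * cnj (x $ j)))"
      by (intro sum.cong refl) (auto simp: v_def algebra_simps)
    also have "\<dots> = 1 - \<theta> * x $ i - cnj (\<theta> * x $ i) + of_real ((norm x)\<^sup>2)"
      by (simp add: sum.distrib \<theta> norm_sq_vec complex_norm_square[symmetric] del: of_real_power complex_cnj_mult)
    also have "\<dots> = of_real (2 - 2 * norm (x $ i))" by (simp add: \<theta>x x)
    finally show ?thesis by (simp only: of_real_eq_iff)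
  qed
  have herm: "cnj (U $ b $ a) = U $ a $ b" for a b
    by (simp add: U_def mult.commute)
  have row: "(\<Sum>c\<in>UNIV. U $ a $ c * U $ c $ b) = (if a = b then 1 else 0)" for a b
  proof -
    define k where "k = complex_of_real (2 / (norm v)\<^sup>2)"
    have k: "k * k * of_real ((norm v)\<^sup>2) = 2 * k"
      by (simp add: k_def power2_eq_square)
    have "(\<Sum>c\<in>UNIV. U $ a $ c * U $ c $ b)
      = (\<Sum>c\<in>UNIV. (if c = a then (if a = b then 1 else 0) - k * (v $ a * cnj (v $ b)) else 0)
           + (if c = b then - k * (v $ a * cnj (v $ b)) else 0) + k * k * (v $ a * cnj (v $ b)) * (v $ c * cnj (v $ c)))"
      by (intro sum.cong refl) (auto simp: U_def k_def algebra_simps)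
    also have "\<dots> = (if a = b then 1 else 0) - k * (v $ a * cnj (v $ b)) - k * (v $ a * cnj (v $ b))
        + k * k * (v $ a * cnj (v $ b)) * of_real ((norm v)\<^sup>2)"
      by (simp add: sum.distrib sum_distrib_left[symmetric] norm_sq_vec complex_norm_square[symmetric] del: of_real_power)
    also have "\<dots> = (if a = b then 1 else 0) + (k * k * of_real ((norm v)\<^sup>2) - 2 * k) * (v $ a * cnj (v $ b))"
      by (simp add: algebra_simps)
    finally show ?thesis by (simp only: k) simp
  qed
  have "unitary U"
    unfolding unitary_def herm by (simp add: row)
  moreover have "U *v axis i 1 = (\<chi> j. \<theta> * x $ j)"
  proof -
    have "(U *v axis i 1) $ j = U $ j $ i" for j
      by (simp add: matrix_vector_mult_def axis_def if_distrib cong: if_cong)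
    moreover have "U $ j $ i = \<theta> * x $ j" for j
    proof (cases "v = 0")
      \<comment> \<open>Then \<theta> x is already the axis vector, and \<open>U\<close> is the
        identity because the quotient by |v|^2 = 0 is 0.\<close>
      case True
      then have "(if j = i then 1 else 0) - \<theta> * x $ j = 0" by (metis v_def vec_lambda_beta zero_index)
      then show ?thesis using True by (auto simp: U_def)
    next
      case False
      have "v $ i = of_real (1 - norm (x $ i))" by (simp add: v_def \<theta>x)
      moreover have "2 / (norm v)\<^sup>2 * (1 - norm (x $ i)) = 1"
      proof -
        have "(norm v)\<^sup>2 \<noteq> 0" using False by simp
        then show ?thesis using vnorm False by (simp add: field_simps)
      qed
      then have "complex_of_real (2 / (norm v)\<^sup>2 * (1 - norm (x $ i))) = 1" by (simp only: of_real_1)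
      ultimately have "2 / (norm v)\<^sup>2 * cnj (v $ i) = 1" by simp
      then have "U $ j $ i = (if j = i then 1 else 0) - v $ j"
        unfolding U_def by (simp add: mult.left_commute[of _ "v $ j"]) 
      then show ?thesis by (simp add: v_def)
    qed
    ultimately show ?thesis by (simp add: vec_eq_iff)
  qed
  ultimately show ?thesis using that \<theta> by blast
qed

lemma pure_unitary:
  assumes "unitary U"
  shows "pure (U *v z) $ a $ b = (\<Sum>k\<in>UNIV. \<Sum>l\<in>UNIV. U $ a $ k * cnj (U $ b $ l) * pure z $ k $ l)"
  by (simp add: pure_def unitary_norm[OF assms])
    (simp add: matrix_vector_mult_def cnj_sum sum_product sum_divide_distrib mult_ac)

text \<open>A unitary taking an axis to a multiple of \<open>x\<close> by a phase preserves the
  Gaussian measure and maps cap to cap, so the axis case is conjugated to \<open>x\<close>. One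
  \<open>s\<close> works for all \<open>x\<close>, which is what lets the caps be multiplied
  later.\<close>

lemma gauss_cap_mean:
  assumes \<rho>: "0 < \<rho>" "\<rho> < 1" and n: "CARD('n) \<ge> 2"
  obtains s where "\<rho> \<le> s" "s \<le> 1"
    "\<And>x :: complex^'n. norm x = 1 \<Longrightarrow> measure gauss (cap x \<rho>) = (1 - \<rho>) ^ (CARD('n) - 1)"
    "\<And>(x :: complex^'n) a b. norm x = 1 \<Longrightarrow> (\<integral>z. indicator (cap x \<rho>) z *\<^sub>R (pure (z :: complex^'n) $ a $ b) \<partial>gauss)
      = of_real ((1 - \<rho>) ^ (CARD('n) - 1)) * (of_real s * pure x $ a $ b
          + of_real ((1 - s) / (real CARD('n) - 1)) * ((if a = b then 1 else 0) - pure x $ a $ b))"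
proof -
  define P where "P = (1 - \<rho>) ^ (CARD('n) - 1)"
  define i :: 'n where "i = undefined"
  define e where "e = axis i (1 :: complex)"
  obtain s where s: "\<rho> \<le> s" "s \<le> 1"
    and Q: "\<And>a b. (\<integral>z. indicator (cap e \<rho>) z *\<^sub>R (pure z $ a $ b) \<partial>gauss)
        = of_real (P * (if a = b then if a = i then s else (1 - s) / (real CARD('n) - 1) else 0))"
    using gauss_cap_mean_axis[OF assms, of i] unfolding P_def e_def by blast
  define r where "r = (1 - s) / (real CARD('n) - 1)"
  have "measure gauss (cap x \<rho>) = P \<and> (\<integral>z. indicator (cap x \<rho>) z *\<^sub>R (pure z $ a $ b) \<partial>gauss)
      = of_real P * (of_real s * pure x $ a $ b + of_real r * ((if a = b then 1 else 0) - pure x $ a $ b))"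
    if x: "norm x = 1" for x :: "complex^'n" and a b
  proof -
    obtain U \<theta> where U: "unitary U" "norm \<theta> = 1" "U *v e = (\<chi> j. \<theta> * x $ j)"
      using unitary_transitive[OF x, of i] unfolding e_def by blast
    note iso = linear_complex_matrix[of U] unitary_norm[OF U(1)] unitary_surj[OF U(1)]
    have \<theta>: "\<theta> * cnj \<theta> = 1" using complex_norm_square[of \<theta>] U(2) by simp
    have cap: "U *v z \<in> cap x \<rho> \<longleftrightarrow> z \<in> cap e \<rho>" for z
    proof -
      have "hinner e z = hinner (U *v e) (U *v z)" by (simp add: unitary_hinner[OF U(1)])
      also have "\<dots> = cnj \<theta> * hinner x (U *v z)" by (simp add: U(3) hinner_def sum_distrib_left mult_ac)
      finally have "norm (hinner e z) = norm (hinner x (U *v z))" using U(2) by (simp add: norm_mult)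
      then show ?thesis by (simp add: cap_def unitary_norm[OF U(1)])
    qed
    have "measure gauss (cap x \<rho>) = (\<integral>z. indicator (cap x \<rho>) z \<partial>gauss)" by simp
    also have "\<dots> = (\<integral>z. indicator (cap x \<rho>) (U *v z) \<partial>gauss)"
      by (rule integral_gauss_isometry[OF iso, symmetric]) measurable
    also have "\<dots> = (\<integral>z. indicator (cap e \<rho>) z \<partial>gauss)"
      by (intro Bochner_Integration.integral_cong refl) (simp add: indicator_def cap)
    also have "\<dots> = P"
      using gauss_cap_axis[OF \<rho>, of i] by (simp add: cap_def e_def hinner_axis P_def)
    finally have meas: "measure gauss (cap x \<rho>) = P" .
    have ent: "pure x $ a $ b = U $ a $ i * cnj (U $ b $ i)" for a b
    proof -
      have "U $ j $ i = \<theta> * x $ j" for j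
      proof -
        have "(U *v e) $ j = U $ j $ i"
          by (simp add: matrix_vector_mult_def axis_def e_def if_distrib cong: if_cong)
        then show ?thesis using U(3) by simp
      qed
      then have "U $ a $ i * cnj (U $ b $ i) = (\<theta> * cnj \<theta>) * (x $ a * cnj (x $ b))" by (simp add: mult_ac)
      then show ?thesis by (simp add: \<theta> pure_def x)
    qed
    define g where "g k l z = indicator (cap e \<rho>) z *\<^sub>R (pure z $ k $ l)" for k l z
    have int: "integrable gauss (g k l)" for k l
      unfolding g_def by (rule gauss.integrable_const_bound[of _ 1])
        (use norm_pure_nth_le in \<open>auto split: split_indicator\<close>)
    have "(\<integral>z. indicator (cap x \<rho>) z *\<^sub>R (pure z $ a $ b) \<partial>gauss)
       = (\<integral>z. indicator (cap x \<rho>) (U *v z) *\<^sub>R (pure (U *v z) $ a $ b) \<partial>gauss)"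
      by (rule integral_gauss_isometry[OF iso, symmetric]) measurable
    also have "\<dots> = (\<integral>z. (\<Sum>k\<in>UNIV. \<Sum>l\<in>UNIV. U $ a $ k * cnj (U $ b $ l) * g k l z) \<partial>gauss)"
    proof (intro Bochner_Integration.integral_cong refl)
      fix z :: "complex^'n"
      show "indicator (cap x \<rho>) (U *v z) *\<^sub>R (pure (U *v z) $ a $ b)
        = (\<Sum>k\<in>UNIV. \<Sum>l\<in>UNIV. U $ a $ k * cnj (U $ b $ l) * g k l z)"
        by (cases "z \<in> cap e \<rho>") (simp_all add: pure_unitary[OF U(1)] cap g_def)
    qed
    also have "\<dots> = (\<Sum>k\<in>UNIV. \<Sum>l\<in>UNIV. U $ a $ k * cnj (U $ b $ l) * (\<integral>z. g k l z \<partial>gauss))"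
      by (simp add: Bochner_Integration.integral_sum int)
    also have "\<dots> = (\<Sum>k\<in>UNIV. U $ a $ k * cnj (U $ b $ k) * of_real (P * (if k = i then s else r)))"
    proof -
      define t where "t k = complex_of_real (P * (if k = i then s else r))" for k
      have *: "(\<integral>z. g k l z \<partial>gauss) = (if l = k then t k else 0)" for k l
        unfolding g_def Q t_def r_def by simp
      show ?thesis unfolding * t_def[symmetric] by (simp add: if_distrib cong: if_cong)
    qed
    also have "\<dots> = (\<Sum>k\<in>UNIV. of_real (P * r) * (U $ a $ k * cnj (U $ b $ k))
        + (if k = i then of_real (P * (s - r)) * (U $ a $ k * cnj (U $ b $ k)) else 0))"
      by (intro sum.cong refl) (auto simp: algebra_simps)
    also have "\<dots> = of_real (P * r) * (if a = b then 1 else 0) + of_real (P * (s - r)) * pure x $ a $ b"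
      using U(1) by (simp add: sum.distrib sum_distrib_left[symmetric] unitary_def ent)
    finally show ?thesis using meas by (simp add: algebra_simps)
  qed
  then show ?thesis using that[OF s] unfolding P_def r_def by blast
qed

section \<open>Positive semidefinite matrices\<close>

definition outer :: "complex^'n \<Rightarrow> complex^'n^'n" where
  "outer z = (\<chi> i j. z $ i * cnj (z $ j))"

lemma outer_pure: "outer z = (norm z)\<^sup>2 *\<^sub>R pure z"
  by (cases "z = 0") (simp_all add: outer_def pure_def vec_eq_iff scaleR_conv_of_real[where 'a=complex])

lemma pure_sgn: "pure (sgn z) = pure z"
proof (cases "z = 0")
  case False
  define N where "N = complex_of_real (norm z)"
  have "sgn z $ i = z $ i / N" for i
    by (simp add: sgn_div_norm N_def scaleR_conv_of_real[where 'a=complex] divide_inverse mult.commute)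
  moreover have "cnj N = N" by (simp add: N_def)
  moreover have "norm (sgn z) = 1" using False by (simp add: norm_sgn)
  ultimately show ?thesis
    by (simp add: pure_def vec_eq_iff power2_eq_square N_def[symmetric])
qed simp

lemma pure_outer: "norm z = 1 \<Longrightarrow> pure z = outer z"
  by (simp add: outer_pure)

lemma inner_matrix: "A \<bullet> B = Re (\<Sum>i\<in>UNIV. \<Sum>j\<in>UNIV. cnj (A $ i $ j) * B $ i $ j)"
  for A B :: "complex^'n^'m"
  by (simp add: inner_vec_def inner_complex_def)

lemma self_adjointD: "self_adjoint A \<Longrightarrow> cnj (A $ i $ j) = A $ j $ i"
  unfolding self_adjoint_def by (metis complex_cnj_cnj)

lemma inner_outer:
  assumes "self_adjoint A"
  shows "A \<bullet> outer z = Re (hinner z (A *v z))"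
proof -
  have "A \<bullet> outer z = Re (\<Sum>i\<in>UNIV. \<Sum>j\<in>UNIV. cnj (z $ j) * (A $ j $ i * z $ i))"
    by (simp add: inner_matrix outer_def self_adjointD[OF assms] mult_ac)
  also have "(\<Sum>i\<in>UNIV. \<Sum>j\<in>UNIV. cnj (z $ j) * (A $ j $ i * z $ i)) = hinner z (A *v z)"
    by (subst sum.swap) (simp add: hinner_def matrix_vector_mult_def sum_distrib_left)
  finally show ?thesis .
qed

lemma psd_iff_inner: "psd A \<longleftrightarrow> self_adjoint A \<and> (\<forall>z. 0 \<le> A \<bullet> outer z)"
  unfolding psd_def by (auto simp: inner_outer hinner_def)

lemma self_adjoint_outer: "self_adjoint (outer z)"
  by (simp add: self_adjoint_def outer_def mult.commute)

lemma self_adjoint_diff: "self_adjoint A \<Longrightarrow> self_adjoint B \<Longrightarrow> self_adjoint (A - B)"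
  using subspace_diff[OF subspace_self_adjoint, of A B] by simp

lemma self_adjoint_add: "self_adjoint A \<Longrightarrow> self_adjoint B \<Longrightarrow> self_adjoint (A + B)"
  using subspace_add[OF subspace_self_adjoint, of A B] by simp

lemma self_adjoint_scaleR: "self_adjoint A \<Longrightarrow> self_adjoint (c *\<^sub>R A)"
  using subspace_scale[OF subspace_self_adjoint, of A c] by simp

lemma self_adjoint_mat: "self_adjoint (mat 1)"
  by (simp add: self_adjoint_def mat_def)

lemma outer_inner_outer: "outer y \<bullet> outer z = (norm (hinner y z))\<^sup>2"
proof -
  have "outer y \<bullet> outer z = Re (\<Sum>i\<in>UNIV. \<Sum>j\<in>UNIV. (cnj (y $ i) * z $ i) * cnj (cnj (y $ j) * z $ j))"
    by (simp add: inner_matrix outer_def mult_ac)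
  also have "(\<Sum>i\<in>UNIV. \<Sum>j\<in>UNIV. (cnj (y $ i) * z $ i) * cnj (cnj (y $ j) * z $ j)) = hinner y z * cnj (hinner y z)"
    by (simp add: hinner_def sum_product cnj_sum)
  finally show ?thesis by (simp add: complex_norm_square[symmetric] del: of_real_power)
qed

lemma psd_outer: "psd (outer z)"
  by (simp add: psd_iff_inner self_adjoint_outer outer_inner_outer)

lemma trace_outer: "trace (outer z) = of_real ((norm z)\<^sup>2)"
  by (simp add: trace_def outer_def norm_sq_vec complex_norm_square[symmetric] del: of_real_power)

lemma inner_mat_one: "mat 1 \<bullet> A = Re (trace A)"
  using self_adjoint_inner[OF self_adjoint_mat, of A] by simp

lemma inner_mat_outer: "mat 1 \<bullet> outer z = (norm z)\<^sup>2"
  by (simp add: inner_mat_one trace_outer)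

lemma hinner_add: "hinner (x + y) z = hinner x z + hinner y z" "hinner x (y + z) = hinner x y + hinner x z"
  by (simp_all add: hinner_def ring_distribs sum.distrib)

lemma outer_axis_nth: "A \<bullet> outer (axis i 1) = Re (A $ i $ i)"
proof -
  have "(\<Sum>b\<in>UNIV. cnj (A $ a $ b) * outer (axis i 1) $ a $ b) = (if a = i then cnj (A $ i $ i) else 0)" for a
  proof -
    have "cnj (A $ a $ b) * outer (axis i 1) $ a $ b = (if b = i then if a = i then cnj (A $ i $ i) else 0 else 0)" for b
      by (simp add: outer_def axis_def)
    then show ?thesis by simp
  qed
  then show ?thesis by (simp add: inner_matrix)
qed

text \<open>Perturbing the test vector in one coordinate is the only variation needed below: it
  recovers single entries of a matrix and completes the square in one variable.\<close>

lemma inner_outer_add_axis: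
  assumes A: "self_adjoint A"
  shows "A \<bullet> outer (y + axis i t) = A \<bullet> outer y + 2 * Re (cnj t * (A *v y) $ i) + (norm t)\<^sup>2 * Re (A $ i $ i)"
proof -
  have h1: "hinner (axis i t) z = cnj t * z $ i" for z :: "complex^'a"
  proof -
    have "cnj (axis i t $ a) * z $ a = (if a = i then cnj t * z $ i else 0)" for a
      by (simp add: axis_def)
    then show ?thesis by (simp add: hinner_def)
  qed
  have col: "(A *v axis i t) $ j = A $ j $ i * t" for j
  proof -
    have "A $ j $ a * axis i t $ a = (if a = i then A $ j $ i * t else 0)" for a
      by (simp add: axis_def)
    then show ?thesis by (simp add: matrix_vector_mult_def)
  qed
  have h2: "hinner y (A *v axis i t) = cnj (cnj t * (A *v y) $ i)"
    by (simp add: hinner_def col) (simp add: matrix_vector_mult_def sum_distrib_left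
        cnj_sum self_adjointD[OF A] mult_ac)
  have h3: "(A *v axis i t) $ i = A $ i $ i * t" by (rule col)
  have "Im (A $ i $ i) = 0" using arg_cong[OF self_adjointD[OF A, of i i], of Im] by simp
  then have h4: "Re (cnj t * (A $ i $ i * t)) = (norm t)\<^sup>2 * Re (A $ i $ i)"
    by (simp add: cmod_power2) (simp add: power2_eq_square algebra_simps)
  show ?thesis
    unfolding inner_outer[OF A] matrix_vector_right_distrib hinner_add h1 h2
    using h4 by (simp add: h3)
qed

text \<open>Testing with e_i - A_ji e_j gives -2 |A_ji|^2, which must be nonnegative.\<close>

lemma psd_diag_zero:
  assumes A: "psd A" and diag: "\<And>i. A $ i $ i = 0"
  shows "A = 0"
proof -
  have sa: "self_adjoint A" using A by (simp add: psd_iff_inner)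
  have "A $ j $ i = 0" for i j
  proof -
    define t where "t = - (A $ j $ i)"
    have "0 \<le> A \<bullet> outer (axis i 1 + axis j t)" using A by (simp add: psd_iff_inner)
    also have "\<dots> = 2 * Re (cnj t * (A *v axis i 1) $ j)"
      unfolding inner_outer_add_axis[OF sa] by (simp add: outer_axis_nth diag)
    also have "(A *v axis i 1) $ j = - t"
      by (simp add: t_def matrix_vector_mult_def axis_def if_distrib cong: if_cong)
    also have "Re (cnj t * - t) = - (norm t)\<^sup>2"
      by (simp add: cmod_power2) (simp add: power2_eq_square)
    finally show ?thesis by (simp add: t_def)
  qed
  then show ?thesis by (simp add: vec_eq_iff)
qed

text \<open>\<open>A - outer w\<close> is the Schur complement of the \<open>i\<close>-th diagonal entry, padded with zeros.\<close>

lemma psd_schur: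
  assumes A: "psd A" and a: "Re (A $ i $ i) > 0"
  defines "w \<equiv> (1 / sqrt (Re (A $ i $ i))) *\<^sub>R (\<chi> j. A $ j $ i)"
  shows "psd (A - outer w)" and "(A - outer w) $ i $ i = 0"
proof -
  define \<alpha> where "\<alpha> = Re (A $ i $ i)"
  have \<alpha>: "\<alpha> > 0" using a by (simp add: \<alpha>_def)
  have sa: "self_adjoint A" using A by (simp add: psd_iff_inner)
  have Aii: "A $ i $ i = of_real \<alpha>"
    using arg_cong[OF self_adjointD[OF sa, of i i], of Im] by (simp add: complex_eq_iff \<alpha>_def)
  have "0 \<le> (A - outer w) \<bullet> outer y" for y
  proof -
    define s where "s = (A *v y) $ i"
    \<comment> \<open>The minimiser of the quadratic form in the direction of the axis; its minimum
      is the form of the Schur complement.\<close>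
    define t where "t = - s / of_real \<alpha>"
    have "hinner w y = (\<Sum>j\<in>UNIV. cnj (A $ j $ i) * y $ j) / of_real (sqrt \<alpha>)"
      by (simp add: hinner_def w_def \<alpha>_def scaleR_conv_of_real[where 'a=complex] sum_divide_distrib)
    also have "(\<Sum>j\<in>UNIV. cnj (A $ j $ i) * y $ j) = s"
      by (simp add: s_def matrix_vector_mult_def self_adjointD[OF sa])
    finally have hw: "(norm (hinner w y))\<^sup>2 = (norm s)\<^sup>2 / \<alpha>"
      using \<alpha> by (simp add: norm_divide power_divide)
    have "0 \<le> A \<bullet> outer (y + axis i t)" using A by (simp add: psd_iff_inner)
    also have "\<dots> = A \<bullet> outer y + 2 * Re (cnj t * s) + (norm t)\<^sup>2 * \<alpha>"
      unfolding inner_outer_add_axis[OF sa] s_def by (simp add: Aii)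
    also have "Re (cnj t * s) = - ((norm s)\<^sup>2 / \<alpha>)"
      by (simp add: t_def cmod_power2 add_divide_distrib) (simp add: power2_eq_square)
    also have "(norm t)\<^sup>2 * \<alpha> = (norm s)\<^sup>2 / \<alpha>"
      using \<alpha> by (simp add: t_def norm_divide power_divide power2_eq_square)
    finally show ?thesis by (simp add: inner_diff_left outer_inner_outer hw)
  qed
  then show "psd (A - outer w)"
    using sa by (simp add: psd_iff_inner self_adjoint_diff self_adjoint_outer)
  have "outer w $ i $ i = of_real \<alpha>"
    using \<alpha> by (simp add: outer_def w_def Aii scaleR_conv_of_real[where 'a=complex] flip: of_real_mult of_real_divide)
  then show "(A - outer w) $ i $ i = 0" by (simp add: Aii)
qed

lemma psd_diag_nonneg: "psd A \<Longrightarrow> Re (A $ i $ i) \<ge> 0 \<and> Im (A $ i $ i) = 0"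
  using arg_cong[OF self_adjointD[of A i i], of Im] outer_axis_nth[of A i]
  by (auto simp: psd_iff_inner) metis

text \<open>A Cholesky decomposition in place of the spectral theorem: each Schur complement clears
  one nonzero diagonal entry, and the process ends when none is left.\<close>

lemma psd_sum_outer:
  assumes "psd A"
  shows "\<exists>(N::nat) v. A = (\<Sum>a<N. outer (v a))"
  using assms
proof (induction "card {i. A $ i $ i \<noteq> 0}" arbitrary: A rule: less_induct)
  case less
  show ?case
  proof (cases "\<exists>i. A $ i $ i \<noteq> 0")
    case False
    then have "A = 0" using psd_diag_zero[OF less.prems] by blast
    then show ?thesis by (intro exI[of _ 0]) simp
  next
    case True
    then obtain i where i: "A $ i $ i \<noteq> 0" by blast
    then have pos: "Re (A $ i $ i) > 0"
      using psd_diag_nonneg[OF less.prems, of i] by (auto simp: complex_eq_iff less_le)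
    define w where "w = (1 / sqrt (Re (A $ i $ i))) *\<^sub>R (\<chi> j. A $ j $ i)"
    define B where "B = A - outer w"
    have B: "psd B" "B $ i $ i = 0"
      using psd_schur[OF less.prems pos] by (simp_all add: B_def w_def)
    \<comment> \<open>Diagonal entries that vanish stay zero: the new entry is -|w_j|^2 and must be
      nonnegative. This makes the count strictly decrease.\<close>
    have "B $ j $ j = 0" if j: "A $ j $ j = 0" for j
    proof -
      have "B $ j $ j = - of_real ((norm (w $ j))\<^sup>2)"
        by (simp add: B_def outer_def j complex_norm_square[symmetric] del: of_real_power)
      then show ?thesis using psd_diag_nonneg[OF B(1), of j] by simp
    qed
    then have "{j. B $ j $ j \<noteq> 0} \<subset> {j. A $ j $ j \<noteq> 0}" using i B(2) by blast
    then have "card {j. B $ j $ j \<noteq> 0} < card {j. A $ j $ j \<noteq> 0}" by (intro psubset_card_mono) auto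
    from less.hyps[OF this B(1)] obtain N :: nat and v where v: "B = (\<Sum>a<N. outer (v a))" by blast
    have "A = (\<Sum>a<Suc N. outer ((v(N := w)) a))"
      using v by (simp add: B_def algebra_simps)
    then show ?thesis by blast
  qed
qed

lemma psd_inner_nonneg:
  assumes "psd A" "psd B"
  shows "0 \<le> A \<bullet> B"
proof -
  obtain N v where v: "B = (\<Sum>a<(N::nat). outer (v a))" using psd_sum_outer[OF assms(2)] by blast
  show ?thesis using assms(1) by (simp add: v inner_sum_right psd_iff_inner sum_nonneg)
qed

section \<open>Tensor products of matrices\<close>

lemma kronecker_sum:
  assumes "\<And>k. finite (S k)"
  shows "kronecker (\<lambda>k. \<Sum>a\<in>S k. X k a) = (\<Sum>g\<in>Pi\<^sub>E UNIV S. kronecker (\<lambda>k. X k (g k)))"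
proof -
  have "(\<Prod>k\<in>UNIV. \<Sum>a\<in>S k. X k a $ i k $ j k) = (\<Sum>g\<in>Pi\<^sub>E UNIV S. \<Prod>k\<in>UNIV. X k (g k) $ i k $ j k)" for i j
    by (rule prod_sum_PiE) (auto simp: assms)
  then show ?thesis by (simp add: kronecker_def vec_eq_iff)
qed

lemma kronecker_add:
  "kronecker (\<lambda>k. X k + Y k) = (\<Sum>S\<in>Pow UNIV. kronecker (\<lambda>k. if k \<in> S then X k else Y k))"
proof -
  have "(\<Prod>k\<in>UNIV. (if k \<in> S then X k else Y k) $ i k $ j k)
      = (\<Prod>k\<in>S. X k $ i k $ j k) * (\<Prod>k\<in>UNIV - S. Y k $ i k $ j k)" for S i j
  proof -
    have "(\<Prod>k\<in>UNIV. (if k \<in> S then X k else Y k) $ i k $ j k) =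
      (\<Prod>k\<in>UNIV. if k \<in> S then X k $ i k $ j k else Y k $ i k $ j k)" by (intro prod.cong refl) simp
    also have "\<dots> = (\<Prod>k\<in>S. X k $ i k $ j k) * (\<Prod>k\<in>UNIV - S. Y k $ i k $ j k)"
      by (subst prod.If_cases) (auto simp: Collect_neg_eq Compl_eq_Diff_UNIV)
    finally show ?thesis .
  qed
  then show ?thesis by (simp add: kronecker_def vec_eq_iff prod_add)
qed

lemma kronecker_scaleR: "kronecker (\<lambda>k. c k *\<^sub>R X k) = (\<Prod>k\<in>UNIV. c k) *\<^sub>R kronecker X"
  by (simp add: kronecker_def vec_eq_iff scaleR_conv_of_real[where 'a=complex] prod.distrib)

lemma norm_kronecker: "norm (kronecker X) = (\<Prod>k\<in>UNIV. norm (X k))"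
proof -
  have "(norm (kronecker X))\<^sup>2 = (\<Sum>i\<in>UNIV. \<Sum>j\<in>UNIV. \<Prod>k\<in>UNIV. (norm (X k $ i k $ j k))\<^sup>2)"
    by (simp add: norm_sq_vec kronecker_def prod_norm[symmetric] prod_power_distrib)
  also have "\<dots> = (\<Sum>i\<in>UNIV. \<Prod>k\<in>UNIV. \<Sum>b\<in>UNIV. (norm (X k $ i k $ b))\<^sup>2)"
    by (subst prod_sum_PiE) (simp_all add: PiE_UNIV_domain)
  also have "\<dots> = (\<Prod>k\<in>UNIV. \<Sum>a\<in>UNIV. \<Sum>b\<in>UNIV. (norm (X k $ a $ b))\<^sup>2)"
    by (subst prod_sum_PiE) (simp_all add: PiE_UNIV_domain)
  also have "\<dots> = (\<Prod>k\<in>UNIV. norm (X k))\<^sup>2"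
    by (simp add: norm_sq_vec prod_power_distrib)
  finally show ?thesis by (simp add: prod_nonneg)
qed

lemma norm_pure_le: "norm (pure z) \<le> 1"
proof (cases "z = 0")
  case False
  have "(norm (outer z))\<^sup>2 = ((norm z)\<^sup>2)\<^sup>2"
    by (simp add: power2_norm_eq_inner outer_inner_outer hinner_self norm_power del: of_real_power)
  then have "(norm (outer z)) = (norm z)\<^sup>2" by (rule power2_eq_imp_eq) auto
  then show ?thesis using False by (simp add: outer_pure)
qed (simp add: pure_def zero_vec_def[symmetric])

lemma norm_kronecker_pure_le: "norm (kronecker (\<lambda>k. pure (z k))) \<le> 1"
  unfolding norm_kronecker by (intro prod_le_1) (simp add: norm_pure_le)

lemma trace_sum: "trace (\<Sum>a\<in>S. X a) = (\<Sum>a\<in>S. trace (X a :: 'a::comm_ring_1^'n^'n))"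
  unfolding trace_def sum_component by (rule sum.swap)

lemma trace_scaleR: "trace (c *\<^sub>R X) = c *\<^sub>R trace (X :: complex^'n^'n)"
  by (simp add: trace_def scaleR_sum_right)

lemma trace_kronecker: "trace (kronecker X) = (\<Prod>k\<in>UNIV. trace (X k))"
  unfolding trace_def kronecker_def
  by (subst prod_sum_PiE) (simp_all add: PiE_UNIV_domain)

text \<open>Decomposing every factor into rank-one terms exhibits the tensor product as a
  nonnegative combination of product projections, whose weights sum to the product of the
  traces.\<close>

lemma kronecker_psd_bound:
  fixes X :: "'k::finite \<Rightarrow> complex^'d::finite^'d"
  assumes bound: "\<And>z :: 'k \<Rightarrow> complex^'d. (\<And>k. norm (z k) = 1) \<Longrightarrow> \<bar>W \<bullet> kronecker (\<lambda>k. pure (z k))\<bar> \<le> M"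
    and M: "M \<ge> 0" and X: "\<And>k. psd (X k)"
  shows "\<bar>W \<bullet> kronecker X\<bar> \<le> M * (\<Prod>k\<in>UNIV. Re (trace (X k)))"
proof -
  have outer: "\<bar>W \<bullet> kronecker (\<lambda>k. outer (u k))\<bar> \<le> M * (\<Prod>k\<in>UNIV. (norm (u k))\<^sup>2)" for u
  proof (cases "\<exists>k. u k = 0")
    case True
    then have "(\<Prod>k\<in>UNIV. (norm (u k))\<^sup>2) = 0" by (auto intro!: prod_zero)
    then have "kronecker (\<lambda>k. outer (u k)) = 0" by (simp only: outer_pure kronecker_scaleR) simp
    then show ?thesis using M by (simp add: prod_nonneg)
  next
    case False
    define z where "z k = sgn (u k)" for k
    have z: "norm (z k) = 1" for k using False by (simp add: z_def norm_sgn)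
    have "outer (u k) = (norm (u k))\<^sup>2 *\<^sub>R pure (z k)" for k
      by (simp add: outer_pure z_def pure_sgn)
    then have "\<bar>W \<bullet> kronecker (\<lambda>k. outer (u k))\<bar> = (\<Prod>k\<in>UNIV. (norm (u k))\<^sup>2) * \<bar>W \<bullet> kronecker (\<lambda>k. pure (z k))\<bar>"
      by (simp add: kronecker_scaleR abs_mult prod_nonneg)
    also have "\<dots> \<le> (\<Prod>k\<in>UNIV. (norm (u k))\<^sup>2) * M"
      by (intro mult_left_mono bound z prod_nonneg) auto
    finally show ?thesis by (simp add: mult.commute)
  qed
  have "\<forall>k. \<exists>N v. X k = (\<Sum>a<(N::nat). outer (v a))" using psd_sum_outer X by blast
  then obtain N v where v: "\<And>k. X k = (\<Sum>a<(N k::nat). outer (v k a))" by metis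
  have tr: "Re (trace (X k)) = (\<Sum>a<N k. (norm (v k a))\<^sup>2)" for k
    by (simp add: v trace_sum trace_outer del: of_real_power)
  have "\<bar>W \<bullet> kronecker X\<bar> = \<bar>\<Sum>g\<in>Pi\<^sub>E UNIV (\<lambda>k. {..<N k}). W \<bullet> kronecker (\<lambda>k. outer (v k (g k)))\<bar>"
    using kronecker_sum[of "\<lambda>k. {..<N k}" "\<lambda>k a. outer (v k a)"] by (simp add: v[symmetric] inner_sum_right)
  also have "\<dots> \<le> (\<Sum>g\<in>Pi\<^sub>E UNIV (\<lambda>k. {..<N k}). M * (\<Prod>k\<in>UNIV. (norm (v k (g k)))\<^sup>2))"
    by (rule order_trans[OF sum_abs]) (intro sum_mono outer)
  also have "\<dots> = M * (\<Prod>k\<in>UNIV. \<Sum>a<N k. (norm (v k a))\<^sup>2)"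
    by (subst prod_sum_PiE) (auto simp: sum_distrib_left)
  finally show ?thesis by (simp add: tr)
qed

lemma psd_scaleR: "psd A \<Longrightarrow> c \<ge> 0 \<Longrightarrow> psd (c *\<^sub>R A)"
  by (simp add: psd_iff_inner self_adjoint_scaleR)

lemma psd_pure: "psd (pure z)"
proof (cases "z = 0")
  case False
  then have "pure z = (1 / (norm z)\<^sup>2) *\<^sub>R outer z" by (simp add: outer_pure)
  then show ?thesis by (simp add: psd_scaleR psd_outer)
next
  case True
  then have "pure z = 0" by (simp add: pure_def vec_eq_iff)
  then show ?thesis by (simp add: psd_iff_inner self_adjoint_def)
qed

lemma psd_one_minus_pure:
  assumes "norm x = 1"
  shows "psd (mat 1 - pure x)"
proof -
  have "norm (hinner x z) \<le> norm z" for z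
  proof -
    have "norm (hinner x z) \<le> (\<Sum>i\<in>UNIV. norm (x $ i) * norm (z $ i))"
      unfolding hinner_def by (rule order_trans[OF norm_sum]) (simp add: norm_mult)
    also have "\<dots> \<le> L2_set (\<lambda>i. norm (x $ i)) UNIV * L2_set (\<lambda>i. norm (z $ i)) UNIV"
      using L2_set_mult_ineq[of "\<lambda>i. norm (x $ i)" "\<lambda>i. norm (z $ i)" UNIV] by simp
    finally show ?thesis using assms by (simp add: norm_vec_def)
  qed
  then have "(norm (hinner x z))\<^sup>2 \<le> (norm z)\<^sup>2" for z by (intro power_mono) auto
  then show ?thesis
    using assms by (simp add: psd_iff_inner pure_outer self_adjoint_diff self_adjoint_mat self_adjoint_outer
        inner_diff_left inner_mat_outer outer_inner_outer)
qed

lemma trace_mat: "trace (mat 1 :: complex^'n^'n) = of_nat CARD('n)"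
  by (simp add: trace_def mat_def)

lemma trace_pure: "norm z = 1 \<Longrightarrow> trace (pure z) = 1"
  by (simp add: pure_outer trace_outer)

text \<open>All terms of the expansion of the tensor product except the leading one are tensor products
  of positive semidefinite matrices, with total trace \<open>1 - s ^ CARD('k)\<close>.\<close>

lemma kronecker_depolarized:
  fixes x :: "'k::finite \<Rightarrow> complex^'d::finite"
  assumes x: "\<And>k. norm (x k) = 1" and s: "0 \<le> s" "s \<le> 1" and d: "CARD('d) \<ge> 2"
    and bound: "\<And>z :: 'k \<Rightarrow> complex^'d. (\<And>k. norm (z k) = 1) \<Longrightarrow> \<bar>W \<bullet> kronecker (\<lambda>k. pure (z k))\<bar> \<le> M"
    and M: "M \<ge> 0"
  defines "r \<equiv> (1 - s) / (real CARD('d) - 1)"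
  shows "s ^ CARD('k) * \<bar>W \<bullet> kronecker (\<lambda>k. pure (x k))\<bar> - (1 - s ^ CARD('k)) * M
      \<le> \<bar>W \<bullet> kronecker (\<lambda>k. s *\<^sub>R pure (x k) + r *\<^sub>R (mat 1 - pure (x k)))\<bar>"
proof -
  define X where "X k = s *\<^sub>R pure (x k)" for k
  define Y where "Y k = r *\<^sub>R (mat 1 - pure (x k))" for k
  have r: "r \<ge> 0" using s d by (simp add: r_def)
  have psd: "psd (X k)" "psd (Y k)" for k
    using s r x by (auto simp: X_def Y_def intro!: psd_scaleR psd_pure psd_one_minus_pure)
  have tr: "Re (trace (X k)) = s" "Re (trace (Y k)) = 1 - s" for k
  proof -
    show "Re (trace (X k)) = s" using x by (simp add: X_def trace_scaleR trace_pure)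
    have "Re (trace (Y k)) = r * (real CARD('d) - 1)"
      using x by (simp add: Y_def trace_scaleR trace_sub trace_pure trace_mat)
    then show "Re (trace (Y k)) = 1 - s" using d by (simp add: r_def)
  qed
  \<comment> \<open>The trace of the term that takes the leading part in the factors of
    \<open>S\<close> and the remainder elsewhere; as in a binomial law these weights sum to
    1.\<close>
  define m where "m S = (\<Prod>k\<in>UNIV. if k \<in> S then s else 1 - s)" for S :: "'k set"
  have summand: "\<bar>W \<bullet> kronecker (\<lambda>k. if k \<in> S then X k else Y k)\<bar> \<le> M * m S" for S
  proof -
    have "\<bar>W \<bullet> kronecker (\<lambda>k. if k \<in> S then X k else Y k)\<bar>
        \<le> M * (\<Prod>k\<in>UNIV. Re (trace (if k \<in> S then X k else Y k)))"
      by (rule kronecker_psd_bound[OF bound M]) (auto simp: psd)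
    also have "(\<Prod>k\<in>UNIV. Re (trace (if k \<in> S then X k else Y k))) = m S"
      unfolding m_def by (intro prod.cong refl) (simp add: tr)
    finally show ?thesis .
  qed
  have total: "(\<Sum>S\<in>Pow UNIV. m S) = 1"
  proof -
    have "(\<Prod>k\<in>(UNIV::'k set). s + (1 - s)) = (\<Sum>S\<in>Pow (UNIV::'k set). (\<Prod>k\<in>S. s) * (\<Prod>k\<in>UNIV - S. 1 - s))"
      by (rule prod_add[of UNIV "\<lambda>_. s" "\<lambda>_. 1 - s"]) simp
    also have "\<dots> = (\<Sum>S\<in>Pow UNIV. m S)"
      unfolding m_def by (intro sum.cong refl, subst prod.If_cases) (auto simp: Compl_eq_Diff_UNIV)
    finally show ?thesis by simp
  qed
  have lead: "W \<bullet> kronecker X = s ^ CARD('k) * (W \<bullet> kronecker (\<lambda>k. pure (x k)))"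
    using kronecker_scaleR[of "\<lambda>_. s" "\<lambda>k. pure (x k)"] by (simp add: X_def[abs_def])
  have "W \<bullet> kronecker (\<lambda>k. X k + Y k) = (\<Sum>S\<in>Pow UNIV. W \<bullet> kronecker (\<lambda>k. if k \<in> S then X k else Y k))"
    by (simp add: kronecker_add inner_sum_right)
  also have "\<dots> = W \<bullet> kronecker X + (\<Sum>S\<in>Pow UNIV - {UNIV}. W \<bullet> kronecker (\<lambda>k. if k \<in> S then X k else Y k))"
    by (subst sum.remove[of _ UNIV]) auto
  finally have eq: "W \<bullet> kronecker (\<lambda>k. X k + Y k)
    = W \<bullet> kronecker X + (\<Sum>S\<in>Pow UNIV - {UNIV}. W \<bullet> kronecker (\<lambda>k. if k \<in> S then X k else Y k))" .
  have "\<bar>\<Sum>S\<in>Pow UNIV - {UNIV}. W \<bullet> kronecker (\<lambda>k. if k \<in> S then X k else Y k)\<bar> \<le> (\<Sum>S\<in>Pow UNIV - {UNIV}. M * m S)"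
    by (rule order_trans[OF sum_abs]) (intro sum_mono summand)
  also have "\<dots> = M * ((\<Sum>S\<in>Pow UNIV. m S) - m UNIV)"
    by (subst (2) sum.remove[of _ UNIV]) (auto simp: sum_distrib_left)
  also have "\<dots> = M * (1 - s ^ CARD('k))" unfolding total by (simp add: m_def)
  finally have "\<bar>\<Sum>S\<in>Pow UNIV - {UNIV}. W \<bullet> kronecker (\<lambda>k. if k \<in> S then X k else Y k)\<bar> \<le> M * (1 - s ^ CARD('k))" .
  moreover have "\<bar>W \<bullet> kronecker X\<bar> = s ^ CARD('k) * \<bar>W \<bullet> kronecker (\<lambda>k. pure (x k))\<bar>"
    unfolding lead using s by (simp add: abs_mult)
  moreover have "kronecker (\<lambda>k. s *\<^sub>R pure (x k) + r *\<^sub>R (mat 1 - pure (x k))) = kronecker (\<lambda>k. X k + Y k)"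
    by (simp add: X_def Y_def)
  ultimately show ?thesis by (simp add: eq mult.commute)
qed

section \<open>Suprema over pure states\<close>

text \<open>The supremum of |u . x|, written as the support function of the symmetrised set so that
  continuity carries over.\<close>

definition abs_support :: "'a::real_inner set \<Rightarrow> 'a \<Rightarrow> real" where
  "abs_support D u = (SUP x\<in>D \<union> uminus ` D. u \<bullet> x)"

lemma abs_support:
  fixes D :: "'a::real_inner set"
  assumes D: "bounded D" "D \<noteq> {}"
  shows abs_support_upper: "x \<in> D \<Longrightarrow> \<bar>u \<bullet> x\<bar> \<le> abs_support D u"
    and abs_support_least: "(\<And>x. x \<in> D \<Longrightarrow> \<bar>u \<bullet> x\<bar> \<le> B) \<Longrightarrow> abs_support D u \<le> B"
    and abs_support_nonneg: "0 \<le> abs_support D u"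
    and continuous_abs_support: "continuous_on UNIV (abs_support D)"
proof -
  have b: "bounded (D \<union> uminus ` D)" using D by (auto simp: bounded_iff)
  show *: "\<bar>u \<bullet> x\<bar> \<le> abs_support D u" if "x \<in> D" for x u
    using support_function_upper[OF b, of x u] support_function_upper[OF b, of "- x" u] that
    by (auto simp: abs_support_def abs_le_iff)
  show "abs_support D u \<le> B" if "\<And>x. x \<in> D \<Longrightarrow> \<bar>u \<bullet> x\<bar> \<le> B"
    unfolding abs_support_def
  proof (rule cSUP_least)
    fix x assume "x \<in> D \<union> uminus ` D"
    then show "u \<bullet> x \<le> B" using that by (auto simp: abs_le_iff)
  qed (use D in auto)
  obtain x where "x \<in> D" using D by blast
  then show "0 \<le> abs_support D u" using *[of x u] by linarith
  show "continuous_on UNIV (abs_support D)"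
    unfolding abs_support_def[abs_def] by (rule continuous_support_function[OF b]) (use D in auto)
qed

lemma cosh_le_iff_arcosh:
  fixes y C :: real
  assumes "cosh y \<le> C"
  shows "\<bar>y\<bar> \<le> arcosh C"
proof -
  have "1 \<le> cosh y" by (rule cosh_real_ge_1)
  then have "C \<ge> 1" using assms by linarith
  then have "cosh \<bar>y\<bar> \<le> cosh (arcosh C)" using assms by (simp add: cosh_arcosh_real)
  then show ?thesis using \<open>C \<ge> 1\<close> by (subst (asm) cosh_real_nonneg_le_iff) (auto simp: arcosh_nonneg_real)
qed

text \<open>In the application \<open>y\<close> is the value of \<open>u\<close> at the mean over a
  cap around \<open>x\<close>; it may fall short of a |u . x| by b times the supremum itself. Taking
  the supremum over \<open>x\<close> and absorbing this term leaves the factor a - b \<ge> c. A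
  single factor uses b = 0, a product uses b = 1 - a.\<close>

lemma (in prob_space) gauss_sup_second_moment:
  fixes D :: "'v::euclidean_space set"
  assumes D: "bounded D" "D \<noteq> {}"
    and T: "T \<in> M \<rightarrow>\<^sub>M borel" "\<And>w. norm (T w) \<le> 1"
    and \<eta>: "0 < \<eta>" "\<eta> \<le> 1" and c: "0 < c" "c \<le> a - b" and ab: "a > 0"
    and H: "\<And>t u x. t > 0 \<Longrightarrow> x \<in> D \<Longrightarrow> \<exists>y. a * \<bar>u \<bullet> x\<bar> - b * abs_support D u \<le> \<bar>y\<bar> \<and>
       \<eta> * cosh (t * y) \<le> (\<integral>w. cosh (t * (u \<bullet> T w)) \<partial>M)"
  shows "integrable gauss (\<lambda>u. (abs_support D u)\<^sup>2)"
    and "(\<integral>u. (abs_support D u)\<^sup>2 \<partial>gauss) \<le> 2 * (ln (1 / \<eta>) + ln 2) / c\<^sup>2"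
proof -
  have main: "\<eta> * cosh (t * (c * abs_support D u)) \<le> (\<integral>w. cosh (t * (u \<bullet> T w)) \<partial>M)" if t: "t > 0" for t u
  proof -
    define F where "F = abs_support D u"
    define I where "I = (\<integral>w. cosh (t * (u \<bullet> T w)) \<partial>M)"
    have *: "a * \<bar>u \<bullet> x\<bar> - b * F \<le> arcosh (I / \<eta>) / t \<and> 1 \<le> I / \<eta>" if xD: "x \<in> D" for x
    proof -
      obtain y where y: "a * \<bar>u \<bullet> x\<bar> - b * F \<le> \<bar>y\<bar>" "\<eta> * cosh (t * y) \<le> I"
        using H[OF t xD, of u] unfolding F_def I_def by blast
      have "cosh (t * y) \<le> I / \<eta>" using y(2) \<eta> by (simp add: field_simps)
      then have "\<bar>t * y\<bar> \<le> arcosh (I / \<eta>)" by (rule cosh_le_iff_arcosh)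
      then have "\<bar>y\<bar> \<le> arcosh (I / \<eta>) / t" using t by (simp add: abs_mult field_simps)
      moreover have "1 \<le> I / \<eta>" using \<open>cosh (t * y) \<le> I / \<eta>\<close> cosh_real_ge_1[of "t * y"] by linarith
      ultimately show ?thesis using y(1) by linarith
    qed
    then have one: "1 \<le> I / \<eta>" using D by blast
    \<comment> \<open>The bound by arcosh is uniform in \<open>x\<close>, so the supremum can be
      taken whether or not it is attained.\<close>
    have "F \<le> (arcosh (I / \<eta>) / t + b * F) / a"
      unfolding F_def
    proof (rule abs_support_least[OF D])
      fix x assume "x \<in> D"
      from *[OF this] show "\<bar>u \<bullet> x\<bar> \<le> (arcosh (I / \<eta>) / t + b * abs_support D u) / a"
        using ab by (simp add: field_simps F_def)
    qed
    then have "a * F \<le> arcosh (I / \<eta>) / t + b * F" using ab by (simp add: field_simps)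
    then have "(a - b) * F \<le> arcosh (I / \<eta>) / t" by (simp add: algebra_simps)
    moreover have "F \<ge> 0" unfolding F_def by (rule abs_support_nonneg[OF D])
    then have "c * F \<le> (a - b) * F" using c by (intro mult_right_mono) auto
    ultimately have "c * F \<le> arcosh (I / \<eta>) / t" by linarith
    then have "t * (c * F) \<le> arcosh (I / \<eta>)" using t by (simp add: field_simps)
    moreover have "0 \<le> t * (c * F)" using t c \<open>F \<ge> 0\<close> by simp
    ultimately have "cosh (t * (c * F)) \<le> cosh (arcosh (I / \<eta>))"
      by (subst cosh_real_nonneg_le_iff) auto
    then have "cosh (t * (c * F)) \<le> I / \<eta>" using one by (simp add: cosh_arcosh_real)
    then show ?thesis using \<eta> by (simp add: F_def I_def field_simps)
  qed
  have F: "abs_support D \<in> borel_measurable borel"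
    by (rule borel_measurable_continuous_onI[OF continuous_abs_support[OF D]])
  note res = gauss_second_moment_le[OF F abs_support_nonneg[OF D] T \<eta> c(1) main]
  show "integrable gauss (\<lambda>u. (abs_support D u)\<^sup>2)"
    "(\<integral>u. (abs_support D u)\<^sup>2 \<partial>gauss) \<le> 2 * (ln (1 / \<eta>) + ln 2) / c\<^sup>2"
    using res by auto
qed

lemma cosh_tangent: "cosh b + sinh b * (x - b) \<le> cosh (x :: real)"
proof -
  define f where "f x = cosh x - sinh b * x" for x
  have df: "(f has_real_derivative (sinh x - sinh b)) (at x)" for x
    unfolding f_def by (auto intro!: derivative_eq_intros)
  have "f b \<le> f x"
  proof (cases "x \<le> b")
    case True
    show ?thesis by (rule DERIV_nonpos_imp_nonincreasing[OF True]) (use df in force)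
  next
    case False
    show ?thesis by (rule DERIV_nonneg_imp_nondecreasing) (use df False in force)+
  qed
  then show ?thesis by (simp add: f_def algebra_simps)
qed

text \<open>Jensen's inequality on the event \<open>C\<close>, through the tangent line of cosh at t
  y; off \<open>C\<close> the integrand is merely positive and is dropped.\<close>

lemma (in prob_space) cosh_mean_le:
  fixes g :: "'a \<Rightarrow> real"
  assumes C [measurable]: "C \<in> sets M" and g [measurable]: "g \<in> borel_measurable M"
    and bound: "\<And>w. \<bar>g w\<bar> \<le> B" and mean: "(\<integral>w. indicator C w * g w \<partial>M) = prob C * y"
  shows "prob C * cosh (t * y) \<le> (\<integral>w. cosh (t * g w) \<partial>M)"
proof -
  have ind: "integrable M (\<lambda>w. indicator C w * g w)"
  proof (rule integrable_const_bound[of _ "\<bar>B\<bar>"])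
    show "AE w in M. norm (indicator C w * g w) \<le> \<bar>B\<bar>"
      using order_trans[OF bound abs_ge_self[of B]] by (intro AE_I2) (auto split: split_indicator)
  qed measurable
  have c: "integrable M (\<lambda>w. cosh (t * g w))"
  proof (rule integrable_const_bound[of _ "cosh (\<bar>t\<bar> * \<bar>B\<bar>)"])
    have "cosh (t * g w) \<le> cosh (\<bar>t\<bar> * \<bar>B\<bar>)" for w
    proof -
      have "\<bar>t * g w\<bar> \<le> \<bar>t\<bar> * \<bar>B\<bar>" using bound[of w] by (auto simp: abs_mult intro!: mult_left_mono)
      then have "cosh \<bar>t * g w\<bar> \<le> cosh (\<bar>t\<bar> * \<bar>B\<bar>)" by (subst cosh_real_nonneg_le_iff) auto
      then show ?thesis by simp
    qed
    then show "AE w in M. norm (cosh (t * g w)) \<le> cosh (\<bar>t\<bar> * \<bar>B\<bar>)" by (intro AE_I2) simp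
  qed measurable
  define e where "e = cosh (t * y) - sinh (t * y) * (t * y)"
  have i1: "integrable M (\<lambda>w. indicator C w * e :: real)"
    by (rule integrable_const_bound[of _ "\<bar>e\<bar>"]) (auto split: split_indicator)
  have "prob C * cosh (t * y)
      = (\<integral>w. indicator C w * e + (sinh (t * y) * t) * (indicator C w * g w) \<partial>M)"
    proof -
    have "(\<integral>w. indicator C w * e + (sinh (t * y) * t) * (indicator C w * g w) \<partial>M)
        = (\<integral>w. indicator C w * e \<partial>M) + (sinh (t * y) * t) * (\<integral>w. indicator C w * g w \<partial>M)"
      using i1 ind by simp
    also have "\<dots> = prob C * e + (sinh (t * y) * t) * (prob C * y)" by (simp add: mean)
    finally show ?thesis by (simp add: e_def algebra_simps)
  qed
  also have "\<dots> \<le> (\<integral>w. cosh (t * g w) \<partial>M)"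
  proof (rule integral_mono)
    show "integrable M (\<lambda>w. indicator C w * e + (sinh (t * y) * t) * (indicator C w * g w))"
      using i1 ind by (intro Bochner_Integration.integrable_add integrable_mult_right)
    show "indicator C w * e + (sinh (t * y) * t) * (indicator C w * g w) \<le> cosh (t * g w)" for w
      using cosh_tangent[of "t * y" "t * g w"] by (auto simp: e_def algebra_simps split: split_indicator)
  qed (rule c)
  finally show ?thesis .
qed

lemma measurable_vecI:
  fixes f :: "'a \<Rightarrow> 'b::euclidean_space^'n"
  assumes "\<And>i. (\<lambda>x. f x $ i) \<in> borel_measurable M"
  shows "f \<in> borel_measurable M"
proof -
  have "(\<lambda>x. f x \<bullet> b) \<in> borel_measurable M" if b: "b \<in> Basis" for b
  proof -
    obtain i u where "b = axis i u" using b by (auto simp: Basis_vec_def)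
    then show ?thesis using assms[of i] by (simp add: inner_axis)
  qed
  then show ?thesis by (subst borel_measurable_euclidean_space) auto
qed

lemma measurable_pure [measurable]: "pure \<in> borel_measurable borel"
  by (intro measurable_vecI measurable_pure_nth)

lemma integral_inner_matrix:
  fixes X :: "'a \<Rightarrow> complex^'n^'n"
  assumes int: "\<And>i j. integrable M (\<lambda>w. indicator C w *\<^sub>R (X w $ i $ j))"
    and mean: "\<And>i j. (\<integral>w. indicator C w *\<^sub>R (X w $ i $ j) \<partial>M) = of_real p * \<sigma> $ i $ j"
  shows "(\<integral>w. indicator C w * (W \<bullet> X w) \<partial>M) = p * (W \<bullet> \<sigma>)"
proof -
  define g where "g i j w = indicator C w *\<^sub>R (X w $ i $ j)" for i j w
  have int': "integrable M (g i j)" for i j unfolding g_def by (rule int)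
  have "indicator C w * (W \<bullet> X w) = Re (\<Sum>i\<in>UNIV. \<Sum>j\<in>UNIV. cnj (W $ i $ j) * g i j w)" for w
    by (cases "w \<in> C") (auto simp: inner_matrix g_def)
  then have "(\<integral>w. indicator C w * (W \<bullet> X w) \<partial>M)
     = (\<integral>w. Re (\<Sum>i\<in>UNIV. \<Sum>j\<in>UNIV. cnj (W $ i $ j) * g i j w) \<partial>M)" by simp
  also have "\<dots> = Re (\<integral>w. (\<Sum>i\<in>UNIV. \<Sum>j\<in>UNIV. cnj (W $ i $ j) * g i j w) \<partial>M)"
    by (intro integral_Re Bochner_Integration.integrable_sum integrable_mult_right int')
  also have "(\<integral>w. (\<Sum>i\<in>UNIV. \<Sum>j\<in>UNIV. cnj (W $ i $ j) * g i j w) \<partial>M)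
     = (\<Sum>i\<in>UNIV. \<Sum>j\<in>UNIV. cnj (W $ i $ j) * (of_real p * \<sigma> $ i $ j))"
    by (simp add: Bochner_Integration.integral_sum int') (simp add: g_def[abs_def] mean)
  also have "\<dots> = of_real p * (\<Sum>i\<in>UNIV. \<Sum>j\<in>UNIV. cnj (W $ i $ j) * \<sigma> $ i $ j)"
    by (simp add: sum_distrib_left mult_ac)
  finally show ?thesis by (simp add: inner_matrix)
qed

text \<open>With the adjoint, pairings of L u with projections become pairings of the Gaussian
  vector with vectors of norm at most 1, as \<open>gauss_cosh\<close> requires.\<close>

lemma adjoint_isometry_norm_le:
  fixes L :: "'a::euclidean_space \<Rightarrow> 'b::euclidean_space"
  assumes lin: "linear L" and norm: "\<And>u. norm (L u) = norm u"
  shows "norm (adjoint L A) \<le> norm A"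
proof -
  have "(norm (adjoint L A))\<^sup>2 = L (adjoint L A) \<bullet> A"
    by (simp add: power2_norm_eq_inner adjoint_works[OF lin])
  also have "\<dots> \<le> norm (L (adjoint L A)) * norm A" by (rule norm_cauchy_schwarz)
  finally have "norm (adjoint L A) * norm (adjoint L A) \<le> norm (adjoint L A) * norm A"
    by (simp add: norm power2_eq_square)
  then show ?thesis by (cases "norm (adjoint L A) = 0") auto
qed

lemma measurable_linear:
  fixes f :: "'a::euclidean_space \<Rightarrow> 'b::euclidean_space"
  assumes "linear f"
  shows "f \<in> borel_measurable borel"
  using assms by (simp add: borel_measurable_continuous_onI linear_continuous_on linear_conv_bounded_linear)

text \<open>The mean over a cap is (s - r) times the projection plus a multiple of the identity, and
  the identity is orthogonal to the traceless L u. So there is no error term, and \<open>c\<close>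
  is the value of s - r at the least possible s = \<rho>.\<close>

lemma pure_state_moment:
  fixes L :: "'v::euclidean_space \<Rightarrow> complex^'n::finite^'n"
  assumes lin: "linear L" and norm: "\<And>u. norm (L u) = norm u" and tr: "\<And>u. trace (L u) = 0"
    and n: "CARD('n) \<ge> 2" and \<rho>: "0 < \<rho>" "\<rho> < 1" "real CARD('n) * \<rho> > 1"
  defines "c \<equiv> (real CARD('n) * \<rho> - 1) / (real CARD('n) - 1)"
  defines "V \<equiv> 2 * (real (CARD('n) - 1) * ln (1 / (1 - \<rho>)) + ln 2) / c\<^sup>2"
  obtains F where "continuous_on UNIV F" "\<And>u. 0 \<le> F u" "\<And>u z. norm z = 1 \<Longrightarrow> \<bar>L u \<bullet> pure z\<bar> \<le> F u"
    "integrable gauss (\<lambda>u. (F u)\<^sup>2)" "(\<integral>u. (F u)\<^sup>2 \<partial>gauss) \<le> V"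
proof -
  define T where "T z = adjoint L (pure z)" for z
  have T: "u \<bullet> T z = L u \<bullet> pure z" for u z by (simp add: T_def adjoint_works[OF lin])
  have T1: "norm (T z) \<le> 1" for z
    unfolding T_def using adjoint_isometry_norm_le[OF lin norm] norm_pure_le order_trans by blast
  have [measurable]: "T \<in> borel_measurable borel"
    unfolding T_def by (rule measurable_compose[OF measurable_pure measurable_linear[OF adjoint_linear[OF lin]]])
  define D where "D = T ` {z. norm z = 1}"
  have D: "bounded D" "D \<noteq> {}"
  proof -
    show "bounded D" using T1 by (auto simp: D_def bounded_iff)
    have "norm (axis undefined 1 :: complex^'n) = 1" by (simp add: norm_axis_1)
    then have "T (axis undefined 1) \<in> D" by (simp add: D_def)
    then show "D \<noteq> {}" by blast
  qed
  obtain s where s: "\<rho> \<le> s" "s \<le> 1"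
    and meas: "\<And>x :: complex^'n. norm x = 1 \<Longrightarrow> measure gauss (cap x \<rho>) = (1 - \<rho>) ^ (CARD('n) - 1)"
    and mean: "\<And>(x :: complex^'n) a b. norm x = 1 \<Longrightarrow> (\<integral>z. indicator (cap x \<rho>) z *\<^sub>R (pure (z :: complex^'n) $ a $ b) \<partial>gauss)
      = of_real ((1 - \<rho>) ^ (CARD('n) - 1)) * (of_real s * pure x $ a $ b
          + of_real ((1 - s) / (real CARD('n) - 1)) * ((if a = b then 1 else 0) - pure x $ a $ b))"
    using gauss_cap_mean[OF \<rho>(1,2) n] by blast
  define r where "r = (1 - s) / (real CARD('n) - 1)"
  define P where "P = (1 - \<rho>) ^ (CARD('n) - 1)"
  have P: "0 < P" "P \<le> 1" using \<rho> by (auto simp: P_def power_le_one)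
  have n1: "real CARD('n) - 1 > 0" using n by simp
  have a_eq: "s - r = (real CARD('n) * s - 1) / (real CARD('n) - 1)"
    using n1 by (simp add: r_def field_simps)
  have c: "c > 0" using \<rho> n1 by (simp add: c_def)
  have ac: "c \<le> s - r" unfolding a_eq c_def using s n1 by (intro divide_right_mono) auto
  have H: "\<exists>y. (s - r) * \<bar>u \<bullet> x\<bar> - 0 * abs_support D u \<le> \<bar>y\<bar> \<and> P * cosh (t * y) \<le> (\<integral>w. cosh (t * (u \<bullet> T w)) \<partial>gauss)"
    if "t > 0" and x: "x \<in> D" for t u x
  proof -
    obtain z where z: "x = T z" "norm z = 1" using x by (auto simp: D_def)
    define \<sigma> where "\<sigma> = s *\<^sub>R pure z + r *\<^sub>R (mat 1 - pure z)"
    define y where "y = L u \<bullet> \<sigma>"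
    have "L u \<bullet> mat 1 = 0" using inner_mat_one[of "L u"] tr[of u] by (simp add: inner_commute)
    then have y: "y = (s - r) * (u \<bullet> x)" by (simp add: y_def \<sigma>_def T z inner_simps algebra_simps)
    have "(\<integral>w. indicator (cap z \<rho>) w * (u \<bullet> T w) \<partial>gauss) = P * y"
      unfolding T y_def
    proof (rule integral_inner_matrix)
      show "integrable gauss (\<lambda>w. indicator (cap z \<rho>) w *\<^sub>R (pure w $ i $ j))" for i j
        by (rule gauss.integrable_const_bound[of _ 1]) (use norm_pure_nth_le in \<open>auto split: split_indicator\<close>)
      show "(\<integral>w. indicator (cap z \<rho>) w *\<^sub>R (pure w $ i $ j) \<partial>gauss) = of_real P * \<sigma> $ i $ j" for i j
        unfolding mean[OF z(2)] P_def \<sigma>_def r_def by (simp add: mat_def scaleR_conv_of_real[where 'a=complex])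
    qed
    then have "(\<integral>w. indicator (cap z \<rho>) w * (u \<bullet> T w) \<partial>gauss) = measure gauss (cap z \<rho>) * y"
      by (simp add: meas[OF z(2)] P_def)
    then have "measure gauss (cap z \<rho>) * cosh (t * y) \<le> (\<integral>w. cosh (t * (u \<bullet> T w)) \<partial>gauss)"
    proof (rule gauss.cosh_mean_le[rotated 3])
      show "\<bar>u \<bullet> T w\<bar> \<le> norm u" for w
        using Cauchy_Schwarz_ineq2[of u "T w"] mult_left_mono[OF T1[of w], of "norm u"] by simp
    qed auto
    then have "P * cosh (t * y) \<le> (\<integral>w. cosh (t * (u \<bullet> T w)) \<partial>gauss)"
      by (simp add: meas[OF z(2)] P_def)
    moreover have "(s - r) * \<bar>u \<bullet> x\<bar> - 0 * abs_support D u \<le> \<bar>y\<bar>"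
      using c ac by (simp add: y abs_mult)
    ultimately show ?thesis by blast
  qed
  have "s - r > 0" using c ac by simp
  note res = gauss.gauss_sup_second_moment[OF D _ T1 P c _ \<open>s - r > 0\<close> H]
  have "ln (1 / P) = real (CARD('n) - 1) * ln (1 / (1 - \<rho>))"
    using \<rho> by (simp add: P_def ln_div ln_realpow)
  then have "integrable gauss (\<lambda>u. (abs_support D u)\<^sup>2)" "(\<integral>u. (abs_support D u)\<^sup>2 \<partial>gauss) \<le> V"
    using res ac by (auto simp: V_def)
  moreover have "\<bar>L u \<bullet> pure z\<bar> \<le> abs_support D u" if "norm z = 1" for u z
    using abs_support_upper[OF D, of "T z" u] that by (auto simp: D_def T)
  ultimately show ?thesis
    using that[of "abs_support D"] continuous_abs_support[OF D] abs_support_nonneg[OF D] by blast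
qed

text \<open>Under the product Gaussian measure the means over the caps multiply. The cross terms
  need not vanish even on traceless matrices; they are bounded by the supremum with weight 1 - s^K,
  where K is the number of factors, so that s^K - (1 - s^K) \<ge> 2 \<rho>^K - 1 = c remains. The
  measure of the product cap is the product of the single measures, whence the factor K in front of
  the logarithm.\<close>

lemma product_state_moment:
  fixes L :: "'v::euclidean_space \<Rightarrow> ('d::finite, 'k::finite) tensor_op"
  assumes lin: "linear L" and norm: "\<And>u. norm (L u) = norm u"
    and d: "CARD('d) \<ge> 2" and \<rho>: "0 < \<rho>" "\<rho> < 1" "2 * \<rho> ^ CARD('k) > 1"
  defines "c \<equiv> 2 * \<rho> ^ CARD('k) - 1"
  defines "V \<equiv> 2 * (real CARD('k) * real (CARD('d) - 1) * ln (1 / (1 - \<rho>)) + ln 2) / c\<^sup>2"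
  obtains F where "continuous_on UNIV F" "\<And>u. 0 \<le> F u"
    "\<And>u z. (\<And>k. norm (z k) = 1) \<Longrightarrow> \<bar>L u \<bullet> kronecker (\<lambda>k. pure (z k))\<bar> \<le> F u"
    "integrable gauss (\<lambda>u. (F u)\<^sup>2)" "(\<integral>u. (F u)\<^sup>2 \<partial>gauss) \<le> V"
proof -
  define X where "X z = kronecker (\<lambda>k. pure (z k))" for z :: "'k \<Rightarrow> complex^'d"
  define T where "T z = adjoint L (X z)" for z
  have T: "u \<bullet> T z = L u \<bullet> X z" for u z by (simp add: T_def adjoint_works[OF lin])
  have T1: "norm (T z) \<le> 1" for z
    unfolding T_def X_def using adjoint_isometry_norm_le[OF lin norm] norm_kronecker_pure_le order_trans by blast
  define N where "N = PiM (UNIV :: 'k set) (\<lambda>_. gauss :: (complex^'d) measure)"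
  interpret N: prob_space N
    unfolding N_def by (intro prob_space_PiM prob_space_gauss)
  have comp [measurable]: "(\<lambda>w. pure (w k) $ i $ j) \<in> borel_measurable N" for k i j
    unfolding N_def by (rule measurable_compose[OF measurable_component_singleton[of k]]) auto
  have [measurable]: "(\<lambda>w. X w $ i $ j) \<in> borel_measurable N" for i j
    unfolding X_def kronecker_def by simp
  have "X \<in> borel_measurable N"
    by (intro measurable_vecI) measurable
  then have [measurable]: "T \<in> borel_measurable N"
    unfolding T_def by (rule measurable_compose[OF _ measurable_linear[OF adjoint_linear[OF lin]]])
  define D where "D = T ` {z. \<forall>k. norm (z k) = 1}"
  have D: "bounded D" "D \<noteq> {}"
  proof -
    show "bounded D" using T1 by (auto simp: D_def bounded_iff)
    have "norm (axis undefined 1 :: complex^'d) = 1" by (simp add: norm_axis_1)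
    then have "(\<lambda>_. axis undefined 1) \<in> {z :: 'k \<Rightarrow> complex^'d. \<forall>k. norm (z k) = 1}" by simp
    then have "T (\<lambda>_. axis undefined 1) \<in> D" unfolding D_def by (rule imageI)
    then show "D \<noteq> {}" by blast
  qed
  obtain s where s: "\<rho> \<le> s" "s \<le> 1"
    and meas: "\<And>x :: complex^'d. norm x = 1 \<Longrightarrow> measure gauss (cap x \<rho>) = (1 - \<rho>) ^ (CARD('d) - 1)"
    and mean: "\<And>(x :: complex^'d) a b. norm x = 1 \<Longrightarrow> (\<integral>z. indicator (cap x \<rho>) z *\<^sub>R (pure (z :: complex^'d) $ a $ b) \<partial>gauss)
      = of_real ((1 - \<rho>) ^ (CARD('d) - 1)) * (of_real s * pure x $ a $ b
          + of_real ((1 - s) / (real CARD('d) - 1)) * ((if a = b then 1 else 0) - pure x $ a $ b))"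
    using gauss_cap_mean[OF \<rho>(1,2) d] by blast
  define r where "r = (1 - s) / (real CARD('d) - 1)"
  define p where "p = (1 - \<rho>) ^ (CARD('d) - 1)"
  define P where "P = p ^ CARD('k)"
  have p: "0 < p" "p \<le> 1" using \<rho> by (auto simp: p_def power_le_one)
  then have P: "0 < P" "P \<le> 1" by (auto simp: P_def power_le_one)
  define a where "a = s ^ CARD('k)"
  have c: "c > 0" using \<rho> by (simp add: c_def)
  have "\<rho> ^ CARD('k) \<le> a" unfolding a_def using s \<rho> by (intro power_mono) auto
  then have ac: "c \<le> a - (1 - a)" "a > 0" using \<rho> by (auto simp: c_def)
  have upper: "\<bar>L u \<bullet> kronecker (\<lambda>k. pure (z k))\<bar> \<le> abs_support D u" if "\<And>k. norm (z k) = 1" for u z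
    using abs_support_upper[OF D, of "T z" u] that by (auto simp: D_def T X_def)
  have H: "\<exists>y. a * \<bar>u \<bullet> x\<bar> - (1 - a) * abs_support D u \<le> \<bar>y\<bar> \<and> P * cosh (t * y) \<le> (\<integral>w. cosh (t * (u \<bullet> T w)) \<partial>N)"
    if "t > 0" and x: "x \<in> D" for t u x
  proof -
    obtain z where z: "x = T z" "\<And>k. norm (z k) = 1" using x by (auto simp: D_def)
    define \<sigma> where "\<sigma> k = s *\<^sub>R pure (z k) + r *\<^sub>R (mat 1 - pure (z k))" for k
    define y where "y = L u \<bullet> kronecker \<sigma>"
    define C where "C = Pi\<^sub>E UNIV (\<lambda>k. cap (z k) \<rho>)"
    have C [measurable]: "C \<in> sets N"
      unfolding C_def N_def by (rule sets_PiM_I_finite) auto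
    have probC: "measure N C = P"
    proof -
      have "emeasure N C = (\<Prod>k\<in>UNIV. emeasure gauss (cap (z k) \<rho>))"
        unfolding N_def C_def by (rule gauss_prod.emeasure_PiM) auto
      also have "\<dots> = (\<Prod>k\<in>(UNIV :: 'k set). ennreal p)"
        by (intro prod.cong refl) (simp add: gauss.emeasure_eq_measure meas[OF z(2)] p_def)
      also have "\<dots> = ennreal P" using p by (simp add: P_def ennreal_power)
      finally show ?thesis using P by (simp add: measure_def)
    qed
    \<comment> \<open>Indicator and matrix entry factor together over the tensor factors, which
      reduces the mean over the product cap to the single caps.\<close>
    have ind: "indicator C w *\<^sub>R (X w $ i $ j) = (\<Prod>k\<in>UNIV. indicator (cap (z k) \<rho>) (w k) *\<^sub>R (pure (w k) $ i k $ j k))" for w i j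
    proof (cases "w \<in> C")
      case True
      then have "w k \<in> cap (z k) \<rho>" for k by (auto simp: C_def)
      then show ?thesis using True by (simp add: X_def kronecker_def)
    next
      case False
      then obtain k where "w k \<notin> cap (z k) \<rho>" by (auto simp: C_def)
      then have "(\<Prod>k\<in>UNIV. indicator (cap (z k) \<rho>) (w k) *\<^sub>R (pure (w k) $ i k $ j k)) = 0"
        by (intro prod_zero bexI[of _ k]) auto
      then show ?thesis using False by simp
    qed
    have int1: "integrable gauss (\<lambda>v. indicator (cap (z k) \<rho>) v *\<^sub>R (pure v $ a $ b))" for k a b
      by (rule gauss.integrable_const_bound[of _ 1]) (use norm_pure_nth_le in \<open>auto split: split_indicator\<close>)
    have "(\<integral>w. indicator C w * (u \<bullet> T w) \<partial>N) = P * y"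
      unfolding T y_def
    proof (rule integral_inner_matrix)
      show "integrable N (\<lambda>w. indicator C w *\<^sub>R (X w $ i $ j))" for i j
        unfolding ind N_def by (rule gauss_prod.product_integrable_prod) (auto simp: int1)
      have "(\<integral>w. indicator C w *\<^sub>R (X w $ i $ j) \<partial>N)
         = (\<Prod>k\<in>UNIV. \<integral>v. indicator (cap (z k) \<rho>) v *\<^sub>R (pure v $ i k $ j k) \<partial>gauss)" for i j
        unfolding ind N_def by (rule gauss_prod.product_integral_prod) (auto simp: int1)
      also have "\<dots> i j = (\<Prod>k\<in>UNIV. of_real p * \<sigma> k $ i k $ j k)" for i j
        by (intro prod.cong refl, unfold mean[OF z(2)])
          (simp add: p_def \<sigma>_def r_def mat_def scaleR_conv_of_real[where 'a=complex])
      finally show "(\<integral>w. indicator C w *\<^sub>R (X w $ i $ j) \<partial>N) = of_real P * kronecker \<sigma> $ i $ j" for i j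
        by (simp add: kronecker_def P_def prod.distrib)
    qed
    then have "(\<integral>w. indicator C w * (u \<bullet> T w) \<partial>N) = measure N C * y" by (simp add: probC)
    then have "measure N C * cosh (t * y) \<le> (\<integral>w. cosh (t * (u \<bullet> T w)) \<partial>N)"
    proof (rule N.cosh_mean_le[rotated 3])
      show "\<bar>u \<bullet> T w\<bar> \<le> norm u" for w
        using Cauchy_Schwarz_ineq2[of u "T w"] mult_left_mono[OF T1[of w], of "norm u"] by simp
    qed auto
    then have "P * cosh (t * y) \<le> (\<integral>w. cosh (t * (u \<bullet> T w)) \<partial>N)" by (simp add: probC)
    moreover have "a * \<bar>u \<bullet> x\<bar> - (1 - a) * abs_support D u \<le> \<bar>y\<bar>"
      unfolding y_def \<sigma>_def z(1) T a_def X_def r_def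
      by (rule kronecker_depolarized) (use z s \<rho> d upper abs_support_nonneg[OF D] in auto)
    ultimately show ?thesis by blast
  qed
  note res = N.gauss_sup_second_moment[OF D _ T1 P c ac H]
  have "ln (1 / P) = real CARD('k) * real (CARD('d) - 1) * ln (1 / (1 - \<rho>))"
    using \<rho> by (simp add: P_def p_def ln_div ln_realpow)
  then have "integrable gauss (\<lambda>u. (abs_support D u)\<^sup>2)" "(\<integral>u. (abs_support D u)\<^sup>2 \<partial>gauss) \<le> V"
    using res by (auto simp: V_def)
  then show ?thesis
    using that[of "abs_support D"] continuous_abs_support[OF D] abs_support_nonneg[OF D] upper by blast
qed

section \<open>The trace hyperplane\<close>

text \<open>Polarisation gives the inner products, and the defects of additivity and homogeneity
  then have norm 0.\<close>

lemma isometry_fixing_zero: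
  fixes f :: "'a::real_inner \<Rightarrow> 'b::real_inner"
  assumes f0: "f 0 = 0" and dist: "\<And>x y. dist (f x) (f y) = dist x y"
  shows "linear f" and "f u \<bullet> f v = u \<bullet> v"
proof -
  have norm: "norm (f u) = norm u" for u using dist[of u 0] f0 by simp
  have inner: "f u \<bullet> f v = u \<bullet> v" for u v
  proof -
    have "(norm (f u - f v))\<^sup>2 = (norm (u - v))\<^sup>2" using dist[of u v] by (simp add: dist_norm)
    moreover have "(norm (f u))\<^sup>2 = (norm u)\<^sup>2" "(norm (f v))\<^sup>2 = (norm v)\<^sup>2" by (simp_all add: norm)
    ultimately show ?thesis by (simp add: power2_norm_eq_inner inner_diff_left inner_diff_right inner_commute)
  qed
  then show "f u \<bullet> f v = u \<bullet> v" .
  show "linear f"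
  proof (rule linearI)
    fix x y
    have "(f (x + y) - (f x + f y)) \<bullet> (f (x + y) - (f x + f y)) = 0"
      by (simp add: inner_diff_left inner_diff_right inner_add_left inner_add_right inner)
    then show "f (x + y) = f x + f y" by simp
  next
    fix c x
    have "(f (c *\<^sub>R x) - c *\<^sub>R f x) \<bullet> (f (c *\<^sub>R x) - c *\<^sub>R f x) = 0"
      by (simp add: inner_diff_left inner_diff_right inner)
    then show "f (c *\<^sub>R x) = c *\<^sub>R f x" by simp
  qed
qed

lemma vol_radius_translation: "vol_radius ((+) a ` S) = vol_radius S"
  by (simp add: vol_radius_def measure_translation)

lemma integral_gauss_odd:
  fixes g :: "'a::euclidean_space \<Rightarrow> real"
  assumes g: "g \<in> borel_measurable borel" and odd: "\<And>x. g (- x) = - g x"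
  shows "(\<integral>x. g x \<partial>gauss) = 0"
proof -
  have "(\<integral>x. g x \<partial>gauss) = (\<integral>x. g (- x) \<partial>gauss)"
    by (rule integral_gauss_isometry[symmetric]) (auto simp: g linear_uminus intro: surjI[of _ uminus])
  then show ?thesis by (simp add: odd)
qed

lemma integral_gauss_reflect:
  fixes g :: "'a::euclidean_space \<Rightarrow> real"
  assumes g: "g \<in> borel_measurable borel"
  shows "(\<integral>x. g (- x) \<partial>gauss) = (\<integral>x. g x \<partial>gauss)"
  by (rule integral_gauss_isometry) (auto simp: g linear_uminus intro: surjI[of _ uminus])

lemma gauss_norm_pos: "(\<integral>x. norm x \<partial>(gauss :: 'a::euclidean_space measure)) > 0"
proof -
  have "0 < sqrt (2 / pi) * sqrt (real DIM('a))" by simp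
  then show ?thesis using gauss_norm_lower[where 'a='a] by linarith
qed

text \<open>Translation adds the odd function u . a to the support function, and its Gaussian mean
  is 0.\<close>

lemma mean_width_translation:
  fixes S :: "(real^'m::{finite,wellorder}) set"
  assumes S: "bounded S" "S \<noteq> {}"
  shows "mean_width ((+) a ` S) = mean_width S"
proof -
  let ?E = "\<integral>x. norm x \<partial>(gauss :: (real, 'm) vec measure)"
  have "mean_width ((+) a ` S) * ?E = (\<integral>u. (SUP x\<in>(+) a ` S. u \<bullet> x) \<partial>gauss)"
    by (rule mean_width_gauss) (use S in \<open>auto simp: bounded_translation\<close>)
  also have "\<dots> = (\<integral>u. u \<bullet> a + (SUP x\<in>S. u \<bullet> x) \<partial>gauss)"
  proof (rule Bochner_Integration.integral_cong[OF refl])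
    fix u :: "(real, 'm) vec"
    have "(SUP x\<in>(+) a ` S. u \<bullet> x) = (SUP x\<in>S. u \<bullet> a + u \<bullet> x)"
      by (simp add: image_image inner_add_right)
    also have "\<dots> = u \<bullet> a + (SUP x\<in>S. u \<bullet> x)"
    proof (rule antisym)
      show "(SUP x\<in>S. u \<bullet> a + u \<bullet> x) \<le> u \<bullet> a + (SUP x\<in>S. u \<bullet> x)"
        using S by (intro cSUP_least) (auto intro: support_function_upper)
      have "(SUP x\<in>S. u \<bullet> x) \<le> (SUP x\<in>S. u \<bullet> a + u \<bullet> x) - u \<bullet> a"
      proof (rule cSUP_least[OF S(2)])
        fix x assume "x \<in> S"
        obtain B where "\<And>x. x \<in> S \<Longrightarrow> u \<bullet> x \<le> B"
          using bdd_above_support[OF S(1), of u] by (auto simp: bdd_above_def)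
        then have "bdd_above ((\<lambda>x. u \<bullet> a + u \<bullet> x) ` S)"
          by (auto intro!: bdd_aboveI[of _ "u \<bullet> a + B"])
        then have "u \<bullet> a + u \<bullet> x \<le> (SUP x\<in>S. u \<bullet> a + u \<bullet> x)" by (rule cSUP_upper[OF \<open>x \<in> S\<close>])
        then show "u \<bullet> x \<le> (SUP x\<in>S. u \<bullet> a + u \<bullet> x) - u \<bullet> a" by linarith
      qed
      then show "u \<bullet> a + (SUP x\<in>S. u \<bullet> x) \<le> (SUP x\<in>S. u \<bullet> a + u \<bullet> x)" by linarith
    qed
    finally show "(SUP x\<in>(+) a ` S. u \<bullet> x) = u \<bullet> a + (SUP x\<in>S. u \<bullet> x)" .
  qed
  also have "\<dots> = (\<integral>u. u \<bullet> a \<partial>gauss) + (\<integral>u. (SUP x\<in>S. u \<bullet> x) \<partial>gauss)"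
  proof (rule Bochner_Integration.integral_add)
    have "integrable gauss (\<lambda>u. SUP x\<in>{a}. u \<bullet> x)" by (rule integrable_gauss_support_function) auto
    then show "integrable gauss (\<lambda>u. u \<bullet> a)" by simp
  qed (rule integrable_gauss_support_function[OF S])
  also have "(\<integral>u. u \<bullet> a \<partial>gauss) = 0" by (rule integral_gauss_odd) auto
  also have "0 + (\<integral>u. (SUP x\<in>S. u \<bullet> x) \<partial>gauss) = mean_width S * ?E" by (simp add: mean_width_gauss[OF S])
  finally show ?thesis using gauss_norm_pos[where 'a="(real, 'm) vec"] by simp
qed

definition max_mixed :: "complex^'n^'n" where
  "max_mixed = (1 / real CARD('n)) *\<^sub>R mat 1"

lemma psd_mat: "psd (mat 1)"
  by (simp add: psd_iff_inner self_adjoint_mat inner_mat_outer)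

lemma trace_max_mixed: "trace (max_mixed :: complex^'n::finite^'n) = 1"
  by (simp add: max_mixed_def trace_scaleR trace_mat scaleR_conv_of_real[where 'a=complex])

lemma psd_max_mixed: "psd max_mixed"
  by (simp add: max_mixed_def psd_scaleR psd_mat)

text \<open>The chart is an arbitrary choice of which only isometry and range are known. Recentring
  at the preimage of the maximally mixed state makes it linear, with values in the traceless
  matrices.\<close>

lemma trace_chart_linear:
  assumes n: "CARD('n::finite) \<ge> 2"
  obtains y0 and L :: "real^('n coord) \<Rightarrow> complex^'n^'n" where
    "linear L" "\<And>u v. L u \<bullet> L v = u \<bullet> v" "\<And>u. self_adjoint (L u)" "\<And>u. trace (L u) = 0"
    "\<And>u. trace_chart (y0 + u) = max_mixed + L u"
    "\<forall>A\<in>unit_trace. \<exists>u. A = max_mixed + L u"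
proof -
  let ?\<phi> = "trace_chart :: real^('n coord) \<Rightarrow> complex^'n^'n"
  note chart = trace_chart[OF n]
  have mm: "self_adjoint (max_mixed :: complex^'n^'n)"
    using psd_max_mixed[where 'a='n] unfolding psd_iff_inner by blast
  then have "(max_mixed :: complex^'n^'n) \<in> range ?\<phi>"
    unfolding chart(2) using trace_max_mixed[where 'n='n] by (simp add: unit_trace_def)
  then obtain y0 where "max_mixed = ?\<phi> y0" by (rule imageE)
  note y0 = this[symmetric]
  define L where "L u = ?\<phi> (y0 + u) - max_mixed" for u
  have L0: "L 0 = 0" by (simp add: L_def y0)
  have Ld: "dist (L u) (L v) = dist u v" for u v
    using chart(1)[of "y0 + u" "y0 + v"] by (simp add: L_def dist_norm)
  have ut: "?\<phi> x \<in> unit_trace" for x unfolding chart(2)[symmetric] by simp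
  have "self_adjoint (L u)" "trace (L u) = 0" for u
    using ut[of "y0 + u"] mm trace_max_mixed[where 'n='n]
    by (auto simp: L_def unit_trace_def self_adjoint_diff trace_sub)
  moreover have "\<exists>u. A = max_mixed + L u" if A: "A \<in> unit_trace" for A
  proof -
    have "A \<in> range ?\<phi>" unfolding chart(2) by (rule A)
    then obtain x where "A = ?\<phi> x" by (rule imageE)
    then show ?thesis by (intro exI[of _ "x - y0"]) (simp add: L_def)
  qed
  moreover have "?\<phi> (y0 + u) = max_mixed + L u" for u by (simp add: L_def)
  ultimately show ?thesis
    by (intro that[of L y0] isometry_fixing_zero[of L, OF L0 Ld] ballI)
qed

lemma psd_norm_le_trace:
  assumes "psd A"
  shows "norm A \<le> Re (trace A)"
proof -
  obtain N v where v: "A = (\<Sum>a<(N::nat). outer (v a))" using psd_sum_outer[OF assms] by blast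
  have "norm (outer z) \<le> (norm z)\<^sup>2" for z :: "complex^'a"
    using norm_pure_le[of z] by (simp add: outer_pure mult_left_le)
  then have "norm A \<le> (\<Sum>a<N. (norm (v a))\<^sup>2)" unfolding v by (rule sum_norm_le)
  also have "\<dots> = Re (trace A)" by (simp add: v trace_sum trace_outer del: of_real_power)
  finally show ?thesis .
qed

text \<open>The traces of the product terms are nonnegative weights with sum trace A = 1, so a
  separable state does no better than the best product of pure states.\<close>

lemma separable_inner_le:
  fixes W :: "('d::finite, 'k::finite) tensor_op"
  assumes A: "A \<in> separable_states"
    and bound: "\<And>z :: 'k \<Rightarrow> complex^'d. (\<And>k. norm (z k) = 1) \<Longrightarrow> \<bar>W \<bullet> kronecker (\<lambda>k. pure (z k))\<bar> \<le> M"
    and M: "M \<ge> 0"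
  shows "W \<bullet> A \<le> M"
proof -
  have ks: "kronecker_separable A" and tr: "trace A = 1"
    using A by (simp_all add: separable_states_def unit_trace_def)
  from ks have "\<exists>r\<ge>1. \<exists>X :: nat \<Rightarrow> 'k \<Rightarrow> complex^'d^'d. (\<forall>a\<in>{1..r}. \<forall>k. psd (X a k)) \<and> A = (\<Sum>a=1..r. kronecker (X a))"
    unfolding kronecker_separable_def by (rule conjunct2)
  then obtain r and X :: "nat \<Rightarrow> 'k \<Rightarrow> complex^'d^'d" where
    X': "\<forall>a\<in>{1..r}. \<forall>k. psd (X a k)" "A = (\<Sum>a=1..r. kronecker (X a))" by (elim exE conjE)
  have X: "psd (X a k)" if "a \<in> {1..r}" for a k using X'(1) that by blast
  have real_tr: "trace (X a k) = of_real (Re (trace (X a k)))" if "a \<in> {1..r}" for a k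
    using psd_diag_nonneg[OF X[OF that]] by (simp add: trace_def complex_eq_iff)
  have "W \<bullet> A = (\<Sum>a=1..r. W \<bullet> kronecker (X a))" by (simp add: X'(2) inner_sum_right)
  also have "\<dots> \<le> (\<Sum>a=1..r. M * (\<Prod>k\<in>UNIV. Re (trace (X a k))))"
  proof (rule sum_mono)
    fix a assume a: "a \<in> {1..r}"
    have "\<bar>W \<bullet> kronecker (X a)\<bar> \<le> M * (\<Prod>k\<in>UNIV. Re (trace (X a k)))"
      by (rule kronecker_psd_bound[OF bound M]) (assumption, rule X[OF a])
    then show "W \<bullet> kronecker (X a) \<le> M * (\<Prod>k\<in>UNIV. Re (trace (X a k)))" by linarith
  qed
  also have "\<dots> = M * (\<Sum>a=1..r. \<Prod>k\<in>UNIV. Re (trace (X a k)))" by (simp add: sum_distrib_left)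
  also have "(\<Sum>a=1..r. \<Prod>k\<in>UNIV. Re (trace (X a k))) = 1"
  proof -
    have "complex_of_real (\<Sum>a=1..r. \<Prod>k\<in>UNIV. Re (trace (X a k))) = (\<Sum>a=1..r. \<Prod>k\<in>UNIV. trace (X a k))"
      unfolding of_real_sum of_real_prod by (intro sum.cong prod.cong refl) (use real_tr in auto)
    also have "\<dots> = trace A" by (simp add: X'(2) trace_sum trace_kronecker)
    finally show ?thesis unfolding tr by (simp only: of_real_eq_1_iff)
  qed
  finally show ?thesis by simp
qed

text \<open>This places the origin of the centred coordinates in both sets and makes them nonempty,
  so that their support functions are defined.\<close>

lemma max_mixed_separable: "(max_mixed :: ('d::finite, 'k::finite) tensor_op) \<in> separable_states"
proof -
  define X where "X = (\<lambda>(a::nat) (k::'k). max_mixed :: complex^'d^'d)"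
  have "(\<Prod>k\<in>UNIV. (max_mixed :: complex^'d^'d) $ i k $ j k) = (max_mixed :: ('d, 'k) tensor_op) $ i $ j" for i j :: "'k \<Rightarrow> 'd"
  proof (cases "i = j")
    case True
    then show ?thesis by (simp add: max_mixed_def mat_def scaleR_conv_of_real[where 'a=complex] card_fun power_one_over)
  next
    case False
    then obtain k where "i k \<noteq> j k" by auto
    then have "(\<Prod>k\<in>UNIV. (max_mixed :: complex^'d^'d) $ i k $ j k) = 0"
      by (intro prod_zero bexI[of _ k]) (auto simp: max_mixed_def mat_def)
    then show ?thesis using False by (simp add: max_mixed_def mat_def)
  qed
  then have "(max_mixed :: ('d, 'k) tensor_op) = (\<Sum>a=1..1. kronecker (X a))"
    by (simp add: kronecker_def X_def vec_eq_iff)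
  then have "kronecker_separable (max_mixed :: ('d, 'k) tensor_op)"
    unfolding kronecker_separable_def using psd_max_mixed[where 'a="'k \<Rightarrow> 'd"] psd_max_mixed[where 'a='d]
    by (intro conjI exI[of _ 1] exI[of _ X]) (auto simp: X_def)
  moreover have "self_adjoint (max_mixed :: ('d, 'k) tensor_op)"
    using psd_max_mixed[where 'a="'k \<Rightarrow> 'd"] by (simp add: psd_iff_inner)
  ultimately show ?thesis by (simp add: separable_states_def unit_trace_def trace_max_mixed)
qed

lemma separable_subset_psd: "separable_states \<subseteq> psd_states"
  by (auto simp: separable_states_def psd_states_def kronecker_separable_def)

lemma unit_trace_pure: "norm z = 1 \<Longrightarrow> pure z \<in> psd_states"
  using psd_pure[of z] by (simp add: psd_states_def unit_trace_def trace_pure psd_iff_inner)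

lemma expectation_le_sqrt_second_moment:
  fixes F :: "'a \<Rightarrow> real"
  assumes "prob_space M" "F \<in> borel_measurable M" "integrable M (\<lambda>x. (F x)\<^sup>2)" "\<And>x. 0 \<le> F x" 
  shows "integrable M F" and "(\<integral>x. F x \<partial>M) \<le> sqrt (\<integral>x. (F x)\<^sup>2 \<partial>M)"
proof -
  interpret prob_space M by fact
  show int: "integrable M F"
    using assms(2,3) by (rule square_integrable_imp_integrable)
  have "0 \<le> variance F" by (rule integral_nonneg_AE) auto
  then have "(expectation F)\<^sup>2 \<le> (\<integral>x. (F x)\<^sup>2 \<partial>M)"
    using variance_eq[OF int assms(3)] by simp
  then show "(\<integral>x. F x \<partial>M) \<le> sqrt (\<integral>x. (F x)\<^sup>2 \<partial>M)" by (rule real_le_rsqrt)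
qed

section \<open>Sets of states with the maximally mixed state as origin\<close>

definition centred :: "('v \<Rightarrow> complex^'n^'n) \<Rightarrow> (complex^'n^'n) set \<Rightarrow> 'v set" where
  "centred L S = {u. max_mixed + L u \<in> S}"

context
  fixes y0 and L :: "real^('n::finite coord) \<Rightarrow> complex^'n^'n"
  assumes n: "CARD('n) \<ge> 2" and lin: "linear L" and inner: "\<And>u v. L u \<bullet> L v = u \<bullet> v"
    and sa: "\<And>u. self_adjoint (L u)" and tr: "\<And>u. trace (L u) = 0"
    and chart: "\<And>u. trace_chart (y0 + u) = max_mixed + L u"
    and onto: "\<forall>A\<in>unit_trace. \<exists>u. A = max_mixed + L u"
begin

lemma trace_chart_vimage: "trace_chart -` S = (+) y0 ` centred L S"
proof
  show "trace_chart -` S \<subseteq> (+) y0 ` centred L S"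
  proof
    fix x assume "x \<in> trace_chart -` S"
    then have "x - y0 \<in> centred L S" using chart[of "x - y0"] by (simp add: centred_def)
    then show "x \<in> (+) y0 ` centred L S" by (intro image_eqI[of _ _ "x - y0"]) auto
  qed
qed (auto simp: centred_def chart)

lemma L_norm: "norm (L u) = norm u"
  by (simp add: norm_eq_sqrt_inner inner)

lemma L_inner_mixed: "L u \<bullet> mat 1 = 0" "L u \<bullet> max_mixed = 0"
proof -
  show "L u \<bullet> mat 1 = 0" using inner_mat_one[of "L u"] tr[of u] by (simp add: inner_commute)
  then show "L u \<bullet> max_mixed = 0" by (simp add: max_mixed_def)
qed

lemma inner_state: "L u \<bullet> (max_mixed + L v) = u \<bullet> v"
  by (simp add: inner_add_right L_inner_mixed inner)

lemma bounded_centred: "S \<subseteq> psd_states \<Longrightarrow> bounded (centred L S)"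
proof -
  assume S: "S \<subseteq> psd_states"
  have "norm u \<le> 1 + norm (max_mixed :: complex^'n^'n)" if "u \<in> centred L S" for u
  proof -
    have "max_mixed + L u \<in> psd_states" using that S by (auto simp: centred_def)
    then have "norm (max_mixed + L u) \<le> 1"
      using psd_norm_le_trace[of "max_mixed + L u"] by (simp add: psd_states_def unit_trace_def)
    then show ?thesis
      using norm_triangle_ineq4[of "max_mixed + L u" max_mixed] by (simp add: L_norm)
  qed
  then show ?thesis by (auto simp: bounded_iff)
qed

lemma centred_ne: "max_mixed \<in> S \<Longrightarrow> centred L S \<noteq> {}"
  using linear_0[OF lin] by (auto simp: centred_def intro!: exI[of _ 0])

lemma max_mixed_psd_state: "(max_mixed :: complex^'n^'n) \<in> psd_states"
  using psd_max_mixed[where 'a='n] trace_max_mixed[where 'n='n]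
  by (simp add: psd_states_def unit_trace_def psd_iff_inner)

lemma centred_psd_iff: "u \<in> centred L psd_states \<longleftrightarrow> (\<forall>z. 0 \<le> (max_mixed + L u) \<bullet> outer z)"
proof -
  have "self_adjoint (max_mixed + L u)"
    using psd_max_mixed[where 'a='n] sa[of u] by (simp add: psd_iff_inner self_adjoint_add)
  moreover have "trace (max_mixed + L u) = 1" by (simp add: trace_add tr trace_max_mixed)
  ultimately show ?thesis by (auto simp: centred_def psd_states_def unit_trace_def psd_iff_inner)
qed

lemma closed_centred_psd: "closed (centred L psd_states)"
proof -
  have "continuous_on UNIV L" by (simp add: linear_continuous_on linear_conv_bounded_linear[symmetric] lin)
  then have "closed (\<Inter>z. {u. 0 \<le> (max_mixed + L u) \<bullet> outer z})"
    by (intro closed_INT ballI closed_Collect_le continuous_intros) auto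
  also have "(\<Inter>z. {u. 0 \<le> (max_mixed + L u) \<bullet> outer z}) = centred L psd_states"
    by (auto simp: centred_psd_iff)
  finally show ?thesis .
qed

lemma vol_radius_vimage: "vol_radius (trace_chart -` S) = vol_radius (centred L S)"
  by (simp add: trace_chart_vimage vol_radius_translation)

lemma mean_width_vimage:
  "S \<subseteq> psd_states \<Longrightarrow> max_mixed \<in> S \<Longrightarrow> mean_width (trace_chart -` S) = mean_width (centred L S)"
  by (simp add: trace_chart_vimage mean_width_translation bounded_centred centred_ne)

lemma DIM_coord: "DIM(real^('n coord)) = CARD('n)\<^sup>2 - 1" "CARD('n coord) = CARD('n)\<^sup>2 - 1"
  using card_coord[OF n] by simp_all

lemma vol_radius_mono:
  assumes "S \<subseteq> psd_states"
  shows "vol_radius (centred L S) \<le> vol_radius (centred L psd_states)"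
proof -
  have fm: "centred L psd_states \<in> lmeasurable"
    using closed_centred_psd bounded_centred[OF order_refl]
    by (intro lmeasurable_compact) (simp add: compact_eq_bounded_closed)
  have "measure lebesgue (centred L S) \<le> measure lebesgue (centred L psd_states)"
  proof (cases "centred L S \<in> sets lebesgue")
    case True
    then show ?thesis using assms by (intro measure_mono_fmeasurable fm) (auto simp: centred_def)
  qed (simp add: measure_notin_sets)
  then show ?thesis
    unfolding vol_radius_def by (intro powr_mono2 divide_right_mono divide_nonneg_nonneg) auto
qed

lemma mean_width_mono:
  assumes "S \<subseteq> psd_states" "max_mixed \<in> S"
  shows "mean_width (centred L S) \<le> mean_width (centred L psd_states)"
proof -
  let ?E = "\<integral>x. norm x \<partial>(gauss :: (real^('n coord)) measure)"
  note S = bounded_centred[OF assms(1)] centred_ne[OF assms(2)]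
  note P = bounded_centred[OF order_refl] centred_ne[OF max_mixed_psd_state]
  have "mean_width (centred L S) * ?E \<le> mean_width (centred L psd_states) * ?E"
    unfolding mean_width_gauss[OF S] mean_width_gauss[OF P]
    by (intro integral_mono integrable_gauss_support_function S P cSUP_subset_mono bdd_above_support)
      (use assms in \<open>auto simp: centred_def\<close>)
  then show ?thesis using gauss_norm_pos[where 'a="real^('n coord)"] by simp
qed

text \<open>For the smallest and largest eigenvalue \<open>- \<beta>\<close>, \<open>\<alpha>\<close> of the traceless matrix \<open>L u\<close>, the product of
  the positive semidefinite matrices \<open>\<alpha> I - L u\<close> and \<open>\<beta> I + L u\<close> has nonnegative trace, so that
  \<open>\<parallel>u\<parallel>\<^sup>2 \<le> n \<alpha> \<beta>\<close>.\<close>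

lemma psd_support_lower:
  fixes u
  defines "h \<equiv> \<lambda>u. SUP x\<in>centred L psd_states. u \<bullet> x"
  shows "2 * norm u / sqrt (real CARD('n)) \<le> h u + h (- u)"
proof -
  note P = bounded_centred[OF order_refl] centred_ne[OF max_mixed_psd_state]
  have pure_le: "L u \<bullet> outer z \<le> h u * (norm z)\<^sup>2" for u z
  proof (cases "z = 0")
    case False
    define z' where "z' = sgn z"
    have z': "norm z' = 1" "outer z = (norm z)\<^sup>2 *\<^sub>R pure z'"
      using False by (simp_all add: z'_def norm_sgn pure_sgn outer_pure)
    have st: "pure z' \<in> psd_states" by (rule unit_trace_pure[OF z'(1)])
    then obtain v where v: "pure z' = max_mixed + L v" using onto by (auto simp: psd_states_def)
    then have "v \<in> centred L psd_states" using st by (simp add: centred_def)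
    then have "u \<bullet> v \<le> h u" unfolding h_def by (rule support_function_upper[OF P(1)])
    then have "L u \<bullet> pure z' \<le> h u" unfolding v inner_state .
    then show ?thesis by (simp add: z'(2) mult.commute mult_right_mono)
  qed (simp add: outer_def zero_vec_def[symmetric])
  \<comment> \<open>By \<open>pure_le\<close>, \<open>h u\<close> and \<open>h (- u)\<close> bound
    the quadratic form of L u from above and from below, so they serve as \<alpha> and \<beta>
    without any diagonalisation.\<close>
  define A where "A = h u *\<^sub>R mat 1 - L u"
  define B where "B = h (- u) *\<^sub>R mat 1 + L u"
  have "psd A"
    using pure_le[of u] sa[of u]
    by (simp add: A_def psd_iff_inner self_adjoint_diff self_adjoint_scaleR self_adjoint_mat
        inner_diff_left inner_mat_outer)
  moreover have "psd B"
    using pure_le[of "- u"] sa[of u]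
    by (simp add: B_def psd_iff_inner self_adjoint_add self_adjoint_scaleR self_adjoint_mat
        inner_add_left inner_mat_outer linear_neg[OF lin])
      (smt (verit))
  ultimately have "0 \<le> A \<bullet> B" by (rule psd_inner_nonneg)
  also have "A \<bullet> B = h u * h (- u) * real CARD('n) - (norm u)\<^sup>2"
    using L_inner_mixed(1)[of u] inner_mat_one[of "mat 1 :: complex^'n^'n"] inner_commute[of "mat 1" "L u"]
    by (simp add: A_def B_def inner_simps inner trace_mat power2_norm_eq_inner)
  finally have le: "(norm u)\<^sup>2 \<le> h u * h (- u) * real CARD('n)" by simp
  have h0: "0 \<le> h u" for u
  proof -
    have "0 \<in> centred L psd_states" using max_mixed_psd_state linear_0[OF lin] by (simp add: centred_def)
    from support_function_upper[OF P(1) this, of u] show ?thesis by (simp add: h_def)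
  qed
  \<comment> \<open>From the product to the sum: 4 \<alpha> \<beta> \<le> (\<alpha> +
    \<beta>)^2.\<close>
  have "(2 * norm u)\<^sup>2 \<le> real CARD('n) * (4 * (h u * h (- u)))" using le by (simp add: power_mult_distrib mult.commute mult.left_commute)
  also have "\<dots> \<le> real CARD('n) * (h u + h (- u))\<^sup>2"
  proof (intro mult_left_mono)
    have "0 \<le> (h u - h (- u))\<^sup>2" by simp
    then show "4 * (h u * h (- u)) \<le> (h u + h (- u))\<^sup>2" by (simp add: power2_diff power2_sum)
  qed simp
  also have "\<dots> = (sqrt (real CARD('n)) * (h u + h (- u)))\<^sup>2" by (simp add: power_mult_distrib)
  finally have "2 * norm u \<le> sqrt (real CARD('n)) * (h u + h (- u))"
    by (rule power2_le_imp_le) (simp add: h0)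
  then show ?thesis using n by (simp add: field_simps)
qed

text \<open>Only the sum of the support function at u and -u is controlled; both have the same
  Gaussian mean by symmetry. The factor E |Z| then cancels exactly.\<close>

lemma mean_width_psd_lower: "1 / sqrt (real CARD('n)) \<le> mean_width (centred L psd_states)"
proof -
  let ?E = "\<integral>x. norm x \<partial>(gauss :: (real^('n coord)) measure)"
  note P = bounded_centred[OF order_refl] centred_ne[OF max_mixed_psd_state]
  define h where "h u = (SUP x\<in>centred L psd_states. u \<bullet> x)" for u
  have int: "integrable gauss h" unfolding h_def by (rule integrable_gauss_support_function[OF P])
  have meas [measurable]: "h \<in> borel_measurable borel"
    unfolding h_def by (rule borel_measurable_continuous_onI[OF continuous_support_function[OF P]])
  have int': "integrable gauss (\<lambda>u. h (- u))"
  proof -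
    have "distr gauss borel uminus = (gauss :: (real^('n coord)) measure)"
      by (rule distr_gauss_isometry) (auto simp: linear_uminus intro: surjI[of _ uminus])
    then have "integrable (distr gauss borel uminus) h" using int by simp
    then show ?thesis by (subst (asm) integrable_distr_eq) auto
  qed
  have "2 / sqrt (real CARD('n)) * ?E = (\<integral>u. 2 * norm u / sqrt (real CARD('n)) \<partial>(gauss :: (real^('n coord)) measure))"
    by simp
  also have "\<dots> \<le> (\<integral>u. h u + h (- u) \<partial>gauss)"
  proof (rule integral_mono)
    show "2 * norm u / sqrt (real CARD('n)) \<le> h u + h (- u)" for u
      unfolding h_def by (rule psd_support_lower)
    show "integrable gauss (\<lambda>u :: real^('n coord). 2 * norm u / sqrt (real CARD('n)))"
      using integrable_gauss_norm[where 'a="real^('n coord)"] by simp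
    show "integrable gauss (\<lambda>u. h u + h (- u))"
      by (rule Bochner_Integration.integrable_add[OF int int'])
  qed
  also have "\<dots> = 2 * (\<integral>u. h u \<partial>gauss)"
    using int int' by (simp add: integral_gauss_reflect[OF meas])
  also have "(\<integral>u. h u \<partial>gauss) = mean_width (centred L psd_states) * ?E"
    unfolding h_def mean_width_gauss[OF P] ..
  finally have "1 / sqrt (real CARD('n)) * ?E \<le> mean_width (centred L psd_states) * ?E" by simp
  then show ?thesis using gauss_norm_pos[where 'a="real^('n coord)"] by (subst (asm) mult_le_cancel_right_pos) auto
qed

text \<open>All eigenvalues of the maximally mixed state are 1/n, so adding L u / t keeps it
  positive once the form of L u is at most t/n in absolute value on unit vectors. Hence n F
  dominates the gauge, which is the source of the factor n^2 in front of \<open>V\<close>.\<close>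

lemma vol_radius_psd_lower:
  assumes \<rho>: "0 < \<rho>" "\<rho> < 1" "real CARD('n) * \<rho> > 1"
  defines "c \<equiv> (real CARD('n) * \<rho> - 1) / (real CARD('n) - 1)"
  defines "V \<equiv> 2 * (real (CARD('n) - 1) * ln (1 / (1 - \<rho>)) + ln 2) / c\<^sup>2"
  shows "sqrt (real (CARD('n)\<^sup>2 - 1) / ((real CARD('n))\<^sup>2 * V)) \<le> vol_radius (centred L psd_states)"
proof -
  obtain F where F: "continuous_on UNIV F" "\<And>u. 0 \<le> F u" "\<And>u z. norm z = 1 \<Longrightarrow> \<bar>L u \<bullet> pure z\<bar> \<le> F u"
    "integrable gauss (\<lambda>u. (F u)\<^sup>2)" "(\<integral>u. (F u)\<^sup>2 \<partial>gauss) \<le> V"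
    using pure_state_moment[OF lin L_norm tr n \<rho>] unfolding V_def c_def by blast
  have [measurable]: "F \<in> borel_measurable borel" by (rule borel_measurable_continuous_onI[OF F(1)])
  have V: "V > 0"
  proof -
    have "c > 0" using \<rho> n by (simp add: c_def)
    moreover have "ln (1 / (1 - \<rho>)) \<ge> 0" using \<rho> by (intro ln_ge_zero) simp
    ultimately show ?thesis by (simp add: V_def add_nonneg_pos)
  qed
  have outer_le: "\<bar>L u \<bullet> outer z\<bar> \<le> F u * (norm z)\<^sup>2" for u z
  proof (cases "z = 0")
    case False
    define z' where "z' = sgn z"
    have z': "norm z' = 1" "outer z = (norm z)\<^sup>2 *\<^sub>R pure z'"
      using False by (simp_all add: z'_def norm_sgn pure_sgn outer_pure)
    have "\<bar>L u \<bullet> outer z\<bar> = (norm z)\<^sup>2 * \<bar>L u \<bullet> pure z'\<bar>" by (simp add: z'(2) abs_mult)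
    then show ?thesis using F(3)[OF z'(1), of u] by (simp add: mult.commute mult_right_mono)
  qed (simp add: outer_def zero_vec_def[symmetric])
  have "sqrt (real CARD('n coord) / ((real CARD('n))\<^sup>2 * V)) \<le> vol_radius (centred L psd_states)"
  proof (rule vol_radius_ge[where p="\<lambda>u. real CARD('n) * F u"])
    show "centred L psd_states \<in> sets borel" by (rule borel_closed[OF closed_centred_psd])
    show "bounded (centred L psd_states)" by (rule bounded_centred) simp
    show "(1 / t) *\<^sub>R u \<in> centred L psd_states" if t: "real CARD('n) * F u < t" for u t
      unfolding centred_psd_iff
    proof
      fix z
      have tpos: "t > 0" using t F(2)[of u] by (meson le_less_trans mult_nonneg_nonneg of_nat_0_le_iff)
      have "- (L u \<bullet> outer z) \<le> F u * (norm z)\<^sup>2" using outer_le[of u z] by linarith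
      also have "\<dots> \<le> (t / real CARD('n)) * (norm z)\<^sup>2"
        using t n by (intro mult_right_mono) (auto simp: field_simps)
      finally have "- (L u \<bullet> outer z) / t \<le> (t / real CARD('n)) * (norm z)\<^sup>2 / t"
        using tpos by (intro divide_right_mono) auto
      then have "- (L u \<bullet> outer z) / t \<le> (norm z)\<^sup>2 / real CARD('n)" using tpos by simp
      then show "0 \<le> (max_mixed + L ((1 / t) *\<^sub>R u)) \<bullet> outer z"
        by (simp add: linear_scale[OF lin] inner_add_left max_mixed_def inner_mat_outer)
    qed
    show "integrable gauss (\<lambda>u. (real CARD('n) * F u)\<^sup>2)" using F(4) by (simp add: power_mult_distrib)
    show "(\<integral>u. (real CARD('n) * F u)\<^sup>2 \<partial>gauss) \<le> (real CARD('n))\<^sup>2 * V"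
      using F(5) by (simp add: power_mult_distrib mult_left_mono)
    show "0 < (real CARD('n))\<^sup>2 * V" using V n by simp
  qed (use F(2) in auto)
  then show ?thesis by (simp add: DIM_coord(2))
qed

end

text \<open>Each estimate of a supremum has its own cap parameter, left free here. The volume bound
  is the quotient of sqrt (V_1 / m) and sqrt (m / (n^2 V_0)) with m = n^2 - 1. In the width bound pi
  / 2 stems from the lower estimate of E |Z| and n from the lower bound 1 / sqrt n for all states.
  The bounds by 1 serve the small parameters.\<close>

lemma rho_bounds:
  fixes \<rho>\<^sub>0 \<rho>\<^sub>1 :: real
  assumes d: "CARD('d::finite) \<ge> 2" and K: "CARD('k::finite) \<ge> 1"
  defines "n \<equiv> real (CARD('d) ^ CARD('k))"
  assumes \<rho>\<^sub>0: "0 < \<rho>\<^sub>0" "\<rho>\<^sub>0 < 1" "n * \<rho>\<^sub>0 > 1"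
    and \<rho>\<^sub>1: "0 < \<rho>\<^sub>1" "\<rho>\<^sub>1 < 1" "2 * \<rho>\<^sub>1 ^ CARD('k) > 1"
  defines "V\<^sub>0 \<equiv> 2 * ((n - 1) * ln (1 / (1 - \<rho>\<^sub>0)) + ln 2) / ((n * \<rho>\<^sub>0 - 1) / (n - 1))\<^sup>2"
    and "V\<^sub>1 \<equiv> 2 * (real CARD('k) * (real CARD('d) - 1) * ln (1 / (1 - \<rho>\<^sub>1)) + ln 2) / (2 * \<rho>\<^sub>1 ^ CARD('k) - 1)\<^sup>2"
  shows "rho_v TYPE(('d, 'k) tensor_power) \<le> 1" "rho_w TYPE(('d, 'k) tensor_power) \<le> 1"
    and "rho_v TYPE(('d, 'k) tensor_power) \<le> sqrt (n\<^sup>2 * V\<^sub>0 * V\<^sub>1 / (n\<^sup>2 - 1)\<^sup>2)"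
    and "rho_w TYPE(('d, 'k) tensor_power) \<le> sqrt (pi / 2 * n * V\<^sub>1 / (n\<^sup>2 - 1))"
proof -
  have n: "real CARD('k \<Rightarrow> 'd) = n" by (simp add: card_fun n_def)
  have n2: "CARD('k \<Rightarrow> 'd) \<ge> 2"
  proof -
    have "2 \<le> CARD('d)" by (rule d)
    also have "\<dots> = CARD('d) ^ 1" by simp
    also have "\<dots> \<le> CARD('d) ^ CARD('k)" using d K by (intro power_increasing) auto
    finally show ?thesis by (simp add: card_fun)
  qed
  have n_ge: "n \<ge> 2" using n2 n by (metis of_nat_le_iff of_nat_numeral)
  have m: "real (CARD('k \<Rightarrow> 'd)\<^sup>2 - 1) = n\<^sup>2 - 1"
  proof -
    have "CARD('k \<Rightarrow> 'd)\<^sup>2 \<ge> 1" using n2 by (simp add: Suc_le_eq)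
    then show ?thesis by (simp add: of_nat_diff n)
  qed
  have m0: "n\<^sup>2 - 1 > 0"
  proof -
    have "n\<^sup>2 \<ge> 2\<^sup>2" using n_ge by (intro power_mono) auto
    then show ?thesis by simp
  qed
  obtain y0 and L :: "real^(('k \<Rightarrow> 'd) coord) \<Rightarrow> ('d, 'k) tensor_op" where L:
    "linear L" "\<And>u v. L u \<bullet> L v = u \<bullet> v" "\<And>u. self_adjoint (L u)" "\<And>u. trace (L u) = 0"
    "\<And>u. trace_chart (y0 + u) = max_mixed + L u"
    "\<forall>A\<in>unit_trace. \<exists>u. A = max_mixed + L u"
    by (rule trace_chart_linear[OF n2]) (rule that)
  note facts = n2 L
  have Ln: "norm (L u) = norm u" for u by (simp add: norm_eq_sqrt_inner L(2))
  obtain F where F: "continuous_on UNIV F" "\<And>u. 0 \<le> F u"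
    "\<And>u z. (\<And>k. norm (z k) = 1) \<Longrightarrow> \<bar>L u \<bullet> kronecker (\<lambda>k. pure (z k))\<bar> \<le> F u"
    "integrable gauss (\<lambda>u. (F u)\<^sup>2)" "(\<integral>u. (F u)\<^sup>2 \<partial>gauss) \<le> V\<^sub>1"
  proof -
    have "V\<^sub>1 = 2 * (real CARD('k) * real (CARD('d) - 1) * ln (1 / (1 - \<rho>\<^sub>1)) + ln 2) / (2 * \<rho>\<^sub>1 ^ CARD('k) - 1)\<^sup>2"
      using d by (simp add: V\<^sub>1_def of_nat_diff)
    then show ?thesis
      using product_state_moment[OF L(1) Ln d \<rho>\<^sub>1] that by metis
  qed
  have [measurable]: "F \<in> borel_measurable borel" by (rule borel_measurable_continuous_onI[OF F(1)])
  note vimage = vol_radius_vimage[OF facts]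
    and wimage = mean_width_vimage[OF facts]
    and bdd = bounded_centred[OF facts]
    and ne = centred_ne[OF facts]
  let ?sep = "separable_states :: ('d, 'k) tensor_op set"
  let ?psd = "psd_states :: ('d, 'k) tensor_op set"
  have sub: "?sep \<subseteq> ?psd" "max_mixed \<in> ?sep" "max_mixed \<in> ?psd"
    using separable_subset_psd max_mixed_separable by auto
  have v_eq: "rho_v TYPE(('d, 'k) tensor_power) = vol_radius (centred L ?sep) / vol_radius (centred L ?psd)"
    by (simp add: rho_v_def vimage)
  have w_eq: "rho_w TYPE(('d, 'k) tensor_power) = mean_width (centred L ?sep) / mean_width (centred L ?psd)"
    by (simp add: rho_w_def wimage sub)
  have v_nn: "0 \<le> vol_radius S" for S :: "(real^(('k \<Rightarrow> 'd) coord)) set"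
    by (simp add: vol_radius_def)
  have w_pos: "1 / sqrt n \<le> mean_width (centred L ?psd)"
    using mean_width_psd_lower[OF facts] by (simp add: n)
  have w_pos': "0 < mean_width (centred L ?psd)"
  proof -
    have "0 < 1 / sqrt n" using n_ge by simp
    then show ?thesis using w_pos by linarith
  qed
  show "rho_v TYPE(('d, 'k) tensor_power) \<le> 1"
    unfolding v_eq using vol_radius_mono[OF facts sub(1)] v_nn[of "centred L ?psd"]
    by (cases "vol_radius (centred L ?psd) = 0") (auto simp: divide_le_eq)
  show "rho_w TYPE(('d, 'k) tensor_power) \<le> 1"
    unfolding w_eq using mean_width_mono[OF facts sub(1,2)] w_pos' by simp
  have V\<^sub>1: "V\<^sub>1 > 0"
  proof -
    have "ln (1 / (1 - \<rho>\<^sub>1)) \<ge> 0" using \<rho>\<^sub>1 by (intro ln_ge_zero) simp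
    then show ?thesis using \<rho>\<^sub>1 d by (simp add: V\<^sub>1_def add_nonneg_pos)
  qed
  have V\<^sub>0: "V\<^sub>0 > 0"
  proof -
    have "ln (1 / (1 - \<rho>\<^sub>0)) \<ge> 0" using \<rho>\<^sub>0 by (intro ln_ge_zero) simp
    then show ?thesis using \<rho>\<^sub>0 n_ge by (simp add: V\<^sub>0_def add_nonneg_pos)
  qed
  have supp: "x \<bullet> u \<le> F u" if x: "x \<in> centred L ?sep" for x u
  proof -
    have "L u \<bullet> (max_mixed + L x) \<le> F u"
      by (rule separable_inner_le[OF _ F(3) F(2)]) (use x in \<open>auto simp: centred_def\<close>)
    then show ?thesis by (simp add: inner_state[OF facts] inner_commute)
  qed
  have "vol_radius (centred L ?sep) \<le> sqrt (V\<^sub>1 / CARD(('k \<Rightarrow> 'd) coord))"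
  proof (rule vol_radius_le[OF _ _ F(2) supp F(4,5) V\<^sub>1])
    show "emeasure lebesgue (centred L ?sep) \<noteq> \<infinity>"
    proof -
      obtain B where "\<forall>x\<in>centred L ?sep. norm x \<le> B" using bdd[OF sub(1)] unfolding bounded_iff ..
      then have "centred L ?sep \<subseteq> cball 0 B" by auto
      then have "emeasure lebesgue (centred L ?sep) \<le> emeasure lebesgue (cball (0 :: real^(('k \<Rightarrow> 'd) coord)) B)"
        by (intro emeasure_mono) auto
      also have "\<dots> < \<infinity>" using emeasure_bounded_finite[of "cball (0 :: real^(('k \<Rightarrow> 'd) coord)) B"] by simp
      finally show ?thesis by simp
    qed
  qed auto
  then have v_up: "vol_radius (centred L ?sep) \<le> sqrt (V\<^sub>1 / (n\<^sup>2 - 1))"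
    using m by (simp add: card_coord[OF n2])
  have v_low: "sqrt ((n\<^sup>2 - 1) / (n\<^sup>2 * V\<^sub>0)) \<le> vol_radius (centred L ?psd)"
  proof -
    have "n - 1 = real (CARD('k \<Rightarrow> 'd) - 1)" using n2 n by (simp add: of_nat_diff)
    then show ?thesis
      using vol_radius_psd_lower[OF facts, of \<rho>\<^sub>0] \<rho>\<^sub>0 unfolding m V\<^sub>0_def n by simp
  qed
  have "rho_v TYPE(('d, 'k) tensor_power) \<le> sqrt (V\<^sub>1 / (n\<^sup>2 - 1)) / sqrt ((n\<^sup>2 - 1) / (n\<^sup>2 * V\<^sub>0))"
    unfolding v_eq using v_nn m0 V\<^sub>0 V\<^sub>1 n_ge by (intro frac_le v_up v_low) auto
  also have "\<dots> = sqrt (n\<^sup>2 * V\<^sub>0 * V\<^sub>1 / (n\<^sup>2 - 1)\<^sup>2)"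
    unfolding real_sqrt_divide[symmetric] by (simp add: power2_eq_square mult_ac)
  finally show "rho_v TYPE(('d, 'k) tensor_power) \<le> sqrt (n\<^sup>2 * V\<^sub>0 * V\<^sub>1 / (n\<^sup>2 - 1)\<^sup>2)" .
  let ?E = "\<integral>x. norm x \<partial>(gauss :: (real^(('k \<Rightarrow> 'd) coord)) measure)"
  have E: "sqrt (2 / pi) * sqrt (n\<^sup>2 - 1) \<le> ?E"
    using gauss_norm_lower[where 'a="real^(('k \<Rightarrow> 'd) coord)"] m by (simp add: card_coord[OF n2])
  have E0: "0 < sqrt (2 / pi) * sqrt (n\<^sup>2 - 1)" using m0 by simp
  note S = bdd[OF sub(1)] ne[OF sub(2)]
  have "mean_width (centred L ?sep) * ?E \<le> (\<integral>u. F u \<partial>gauss)"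
    unfolding mean_width_gauss[OF S]
  proof (rule integral_mono[OF integrable_gauss_support_function[OF S]])
    show "integrable gauss F" by (rule expectation_le_sqrt_second_moment(1)[OF prob_space_gauss _ F(4,2)]) simp
    show "(SUP x\<in>centred L ?sep. u \<bullet> x) \<le> F u" for u
      using S(2) supp by (intro cSUP_least) (auto simp: inner_commute)
  qed
  also have "\<dots> \<le> sqrt (\<integral>u. (F u)\<^sup>2 \<partial>gauss)" by (rule expectation_le_sqrt_second_moment(2)[OF prob_space_gauss _ F(4,2)]) simp
  also have "\<dots> \<le> sqrt V\<^sub>1" using F(5) by simp
  finally have "mean_width (centred L ?sep) \<le> sqrt V\<^sub>1 / ?E" using E E0 by (simp add: pos_le_divide_eq)
  also have "\<dots> \<le> sqrt V\<^sub>1 / (sqrt (2 / pi) * sqrt (n\<^sup>2 - 1))"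
    using E E0 V\<^sub>1 by (intro divide_left_mono) auto
  finally have w_up: "mean_width (centred L ?sep) \<le> sqrt V\<^sub>1 / (sqrt (2 / pi) * sqrt (n\<^sup>2 - 1))" .
  have "rho_w TYPE(('d, 'k) tensor_power) \<le> (sqrt V\<^sub>1 / (sqrt (2 / pi) * sqrt (n\<^sup>2 - 1))) / mean_width (centred L ?psd)"
    unfolding w_eq using w_up w_pos' by (intro divide_right_mono) auto
  also have "\<dots> \<le> (sqrt V\<^sub>1 / (sqrt (2 / pi) * sqrt (n\<^sup>2 - 1))) / (1 / sqrt n)"
    using w_pos w_pos' E0 V\<^sub>1 n_ge by (intro divide_left_mono divide_nonneg_nonneg) auto
  also have "\<dots> = sqrt (pi / 2 * n * V\<^sub>1 / (n\<^sup>2 - 1))"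
  proof -
    have "(sqrt V\<^sub>1 / (sqrt (2 / pi) * sqrt (n\<^sup>2 - 1))) / (1 / sqrt n) = (sqrt V\<^sub>1 * sqrt n) / (sqrt (2 / pi) * sqrt (n\<^sup>2 - 1))"
      by simp
    also have "\<dots> = sqrt ((V\<^sub>1 * n) / ((2 / pi) * (n\<^sup>2 - 1)))"
      by (simp only: real_sqrt_mult real_sqrt_divide)
    also have "(V\<^sub>1 * n) / ((2 / pi) * (n\<^sup>2 - 1)) = pi / 2 * n * V\<^sub>1 / (n\<^sup>2 - 1)"
      by (simp add: mult_ac)
    finally show ?thesis .
  qed
  finally show "rho_w TYPE(('d, 'k) tensor_power) \<le> sqrt (pi / 2 * n * V\<^sub>1 / (n\<^sup>2 - 1))" .
qed

section \<open>Numerical estimates\<close>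

text \<open>At \<rho> = 3/4 the logarithm is 2 ln 2 and c = 3/4 - 1 / (4 (n - 1)) is at least
  149/200. With ln 2 \<le> 25/36 the quotient is below 5.005 n.\<close>

lemma psd_moment_numeric:
  fixes n :: real
  assumes n: "n \<ge> 101"
  shows "2 * ((n - 1) * ln (1 / (1 - 3 / 4)) + ln 2) / ((n * (3 / 4) - 1) / (n - 1))\<^sup>2 \<le> 501 / 100 * n"
proof -
  have "ln (4 :: real) = 2 * ln 2" using ln_realpow[of 2 2] by simp
  then have num: "2 * ((n - 1) * ln (1 / (1 - 3 / 4)) + ln 2) = 2 * ln 2 * (2 * n - 1)"
    by (simp add: algebra_simps)
  have c: "149 / 200 \<le> (n * (3 / 4) - 1) / (n - 1)" using n by (simp add: field_simps)
  have "2 * ln 2 * (2 * n - 1) \<le> 2 * (25 / 36) * (2 * n)"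
    using n ln2_le_25_over_36 by (intro mult_mono) auto
  moreover have "(149 / 200)\<^sup>2 \<le> ((n * (3 / 4) - 1) / (n - 1))\<^sup>2" using c by (intro power_mono) auto
  ultimately have "2 * ln 2 * (2 * n - 1) / ((n * (3 / 4) - 1) / (n - 1))\<^sup>2 \<le> (2 * (25 / 36) * (2 * n)) / (149 / 200)\<^sup>2"
    using n by (intro frac_le) auto
  also have "\<dots> \<le> 501 / 100 * n" using n by (simp add: power2_eq_square field_simps)
  finally show ?thesis unfolding num .
qed

lemma square_minus_one_ge:
  fixes n :: real
  assumes "n \<ge> 101"
  shows "99 / 100 * n\<^sup>2 \<le> n\<^sup>2 - 1" and "99 / 100 * n ^ 4 \<le> (n\<^sup>2 - 1)\<^sup>2"
proof -
  have n2: "n\<^sup>2 \<ge> 101\<^sup>2" using assms by (intro power_mono) auto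
  then show "99 / 100 * n\<^sup>2 \<le> n\<^sup>2 - 1" by simp
  have "(999 / 1000 * n\<^sup>2)\<^sup>2 \<le> (n\<^sup>2 - 1)\<^sup>2" using n2 by (intro power_mono) auto
  moreover have "(999 / 1000 * n\<^sup>2)\<^sup>2 = 998001 / 1000000 * n ^ 4" by (simp add: power_mult_distrib power_divide flip: power_mult)
  moreover have "n ^ 4 \<ge> 0" by simp
  ultimately show "99 / 100 * n ^ 4 \<le> (n\<^sup>2 - 1)\<^sup>2" by linarith
qed

text \<open>The single constant 507/100 covers both ratios: 501/99 arises for the volume radius, and
  only 200/99 for the mean width, where pi / 2 is replaced by 2.\<close>

lemma ratio_bounds_numeric:
  fixes n V\<^sub>0 V\<^sub>1 A B :: real
  assumes n: "n \<ge> 101" and V\<^sub>0: "0 \<le> V\<^sub>0" "V\<^sub>0 \<le> 501 / 100 * n" and V\<^sub>1: "0 \<le> V\<^sub>1" "V\<^sub>1 \<le> A"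
    and B: "507 / 100 * A \<le> B * n"
  shows "n\<^sup>2 * V\<^sub>0 * V\<^sub>1 / (n\<^sup>2 - 1)\<^sup>2 \<le> B" and "pi / 2 * n * V\<^sub>1 / (n\<^sup>2 - 1) \<le> B"
proof -
  have A: "A \<ge> 0" using V\<^sub>1 by linarith
  have n4: "0 < 99 / 100 * n ^ 4" "0 < 99 / 100 * n\<^sup>2" using n by auto
  have "n\<^sup>2 * V\<^sub>0 * V\<^sub>1 / (n\<^sup>2 - 1)\<^sup>2 \<le> (n\<^sup>2 * (501 / 100 * n) * A) / (99 / 100 * n ^ 4)"
    using square_minus_one_ge(2)[OF n] n4 n V\<^sub>0 V\<^sub>1 A by (intro frac_le mult_mono) auto
  also have "\<dots> = (501 / 99 * A) / n" using n by (simp add: power2_eq_square power4_eq_xxxx)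
  also have "\<dots> \<le> (507 / 100 * A) / n" using n A by (intro divide_right_mono mult_right_mono) auto
  also have "\<dots> \<le> B" using B n by (simp add: divide_le_eq)
  finally show "n\<^sup>2 * V\<^sub>0 * V\<^sub>1 / (n\<^sup>2 - 1)\<^sup>2 \<le> B" .
  have "pi / 2 * n * V\<^sub>1 / (n\<^sup>2 - 1) \<le> (2 * n * A) / (99 / 100 * n\<^sup>2)"
    using square_minus_one_ge(1)[OF n] n4 n V\<^sub>1 A pi_less_4 by (intro frac_le mult_mono) auto
  also have "\<dots> = (200 / 99 * A) / n" using n by (simp add: power2_eq_square)
  also have "\<dots> \<le> (507 / 100 * A) / n" using n A by (intro divide_right_mono mult_right_mono) auto
  also have "\<dots> \<le> B" using B n by (simp add: divide_le_eq)
  finally show "pi / 2 * n * V\<^sub>1 / (n\<^sup>2 - 1) \<le> B" .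
qed

text \<open>The value 31/32 makes the logarithm 5 ln 2 and keeps 2 \<rho>^2 - 1 = 449/512 close to
  1, which leaves a quotient below 18.1 d.\<close>

lemma bipartite_moment_numeric:
  fixes d :: real
  assumes d: "d \<ge> 1"
  shows "2 * (2 * (d - 1) * ln (1 / (1 - 31 / 32)) + ln 2) / (2 * (31 / 32)\<^sup>2 - 1)\<^sup>2 \<le> 181 / 10 * d"
    and "0 \<le> 2 * (2 * (d - 1) * ln (1 / (1 - 31 / 32)) + ln 2) / (2 * (31 / 32)\<^sup>2 - 1 :: real)\<^sup>2"
proof -
  have "ln (32 :: real) = 5 * ln 2" using ln_realpow[of 2 5] by simp
  then have num: "2 * (2 * (d - 1) * ln (1 / (1 - 31 / 32)) + ln 2) = 2 * ln 2 * (10 * d - 9)"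
    by (simp add: algebra_simps)
  show "0 \<le> 2 * (2 * (d - 1) * ln (1 / (1 - 31 / 32)) + ln 2) / (2 * (31 / 32)\<^sup>2 - 1 :: real)\<^sup>2"
    unfolding num using d by (intro divide_nonneg_nonneg mult_nonneg_nonneg) auto
  have "2 * ln 2 * (10 * d - 9) \<le> 2 * (25 / 36) * (10 * d)"
    using d ln2_le_25_over_36 by (intro mult_mono) auto
  then have "2 * ln 2 * (10 * d - 9) / (2 * (31 / 32)\<^sup>2 - 1)\<^sup>2 \<le> 2 * (25 / 36) * (10 * d) / (2 * (31 / 32)\<^sup>2 - 1 :: real)\<^sup>2"
    by (intro divide_right_mono) auto
  also have "\<dots> \<le> 181 / 10 * d" using d by (simp add: power2_eq_square field_simps)
  finally show "2 * (2 * (d - 1) * ln (1 / (1 - 31 / 32)) + ln 2) / (2 * (31 / 32)\<^sup>2 - 1)\<^sup>2 \<le> 181 / 10 * d"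
    unfolding num .
qed

lemma ln_ge_numeric:
  fixes K :: nat
  shows "2 \<le> K \<Longrightarrow> 2 / 3 \<le> ln (real K)" and "4 \<le> K \<Longrightarrow> 4 / 3 \<le> ln (real K)"
    and "8 \<le> K \<Longrightarrow> 3 * ln 2 \<le> ln (real K)"
proof -
  have l: "ln a \<le> ln (real K)" if "0 < a" "a \<le> real K" for a :: real
    using that by simp
  show "2 / 3 \<le> ln (real K)" if "2 \<le> K"
  proof -
    have "ln 2 \<le> ln (real K)" using that by (intro l) auto
    then show ?thesis using ln2_ge_two_thirds by linarith
  qed
  show "4 / 3 \<le> ln (real K)" if "4 \<le> K"
  proof -
    have "ln 4 \<le> ln (real K)" using that by (intro l) auto
    moreover have "ln (4 :: real) = 2 * ln 2" using ln_realpow[of 2 2] by simp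
    ultimately show ?thesis using ln2_ge_two_thirds by linarith
  qed
  show "3 * ln 2 \<le> ln (real K)" if "8 \<le> K"
  proof -
    have "ln 8 \<le> ln (real K)" using that by (intro l) auto
    moreover have "ln (8 :: real) = 3 * ln 2" using ln_realpow[of 2 3] by simp
    ultimately show ?thesis by linarith
  qed
qed

text \<open>Since 96 \<le> 48 e, this makes the right-hand side of the qubit bound at least 1. The
  margin is slim at K = 11, where 2048 stands against 96 * 22 = 2112.\<close>

lemma qubit_rhs_ge_one:
  fixes K :: nat
  assumes K: "2 \<le> K" "K \<le> 11"
  shows "2 ^ K \<le> 96 * (real K * ln (real K))"
proof -
  consider "K < 4" | "4 \<le> K" "K < 8" | "8 \<le> K" by linarith
  then show ?thesis
  proof cases
    case 1
    have "(2 :: real) ^ K \<le> 2 ^ 3" using 1 by (intro power_increasing) auto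
    moreover have "2 * (2 / 3) \<le> real K * ln (real K)" using K ln_ge_numeric(1) by (intro mult_mono) auto
    ultimately show ?thesis by simp
  next
    case 2
    have "(2 :: real) ^ K \<le> 2 ^ 7" using 2 by (intro power_increasing) auto
    moreover have "4 * (4 / 3) \<le> real K * ln (real K)" using 2 ln_ge_numeric(2) by (intro mult_mono) auto
    ultimately show ?thesis by simp
  next
    case 3
    have ln: "2 \<le> ln (real K)" using ln_ge_numeric(3)[OF 3] ln2_ge_two_thirds by linarith
    show ?thesis
    proof (cases "K = 11")
      case True
      have "11 * 2 \<le> real K * ln (real K)" using ln True by (intro mult_mono) auto
      then show ?thesis using True by simp
    next
      case False
      have "(2 :: real) ^ K \<le> 2 ^ 10" using K False by (intro power_increasing) auto
      moreover have "8 * 2 \<le> real K * ln (real K)" using 3 ln by (intro mult_mono) auto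
      ultimately show ?thesis by simp
    qed
  qed
qed

text \<open>By Bernoulli's inequality 1 - \<rho> = 1/(4 K) gives \<rho>^K \<ge> 3/4, so the
  denominator is at least 1/4, while the logarithm is only ln (4 K).\<close>

lemma qubit_moment_numeric:
  fixes K :: nat
  assumes K: "K \<ge> 12"
  defines "\<rho> \<equiv> 1 - 1 / (4 * real K)"
  shows "2 * (real K * (2 - 1) * ln (1 / (1 - \<rho>)) + ln 2) / (2 * \<rho> ^ K - 1)\<^sup>2 \<le> 14 * (real K * ln (real K))"
    and "0 \<le> 2 * (real K * (2 - 1) * ln (1 / (1 - \<rho>)) + ln 2) / (2 * \<rho> ^ K - 1)\<^sup>2"
proof -
  have "1 + real K * (- (1 / (4 * real K))) \<le> (1 + (- (1 / (4 * real K)))) ^ K"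
    using K by (intro Bernoulli_inequality) (simp add: field_simps)
  then have c: "1 / 2 \<le> 2 * \<rho> ^ K - 1" using K by (simp add: \<rho>_def)
  have ln1: "ln (1 / (1 - \<rho>)) = 2 * ln 2 + ln (real K)"
  proof -
    have "ln (4 :: real) = 2 * ln 2" using ln_realpow[of 2 2] by simp
    then show ?thesis using K by (simp add: \<rho>_def ln_mult)
  qed
  have lnK: "3 * ln 2 \<le> ln (real K)" using K by (intro ln_ge_numeric) auto
  have ln0: "ln (real K) \<ge> 0" using K by simp
  define X where "X = real K * ln 2"
  define Y where "Y = real K * ln (real K)"
  have "real K * (3 * ln 2) \<le> real K * ln (real K)" using lnK by (intro mult_left_mono) auto
  then have X: "3 * X \<le> Y" by (simp add: X_def Y_def)
  have "12 * ln (real K) \<le> Y" unfolding Y_def using K ln0 by (intro mult_right_mono) auto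
  moreover have "real K * (2 - 1) * ln (1 / (1 - \<rho>)) = 2 * X + Y"
    unfolding ln1 X_def Y_def by (simp add: algebra_simps)
  \<comment> \<open>From X \<le> Y/3 and ln 2 \<le> Y/36 the left side is at most (61/18) Y.\<close>
  moreover have "2 * (2 * X + Y + ln 2) \<le> 7 / 2 * Y" using calculation(1) lnK X ln0 by argo
  ultimately have up: "2 * (real K * (2 - 1) * ln (1 / (1 - \<rho>)) + ln 2) \<le> 7 / 2 * (real K * ln (real K))"
    by (simp only: Y_def)
  have nn: "0 \<le> 2 * (real K * (2 - 1) * ln (1 / (1 - \<rho>)) + ln 2)"
    unfolding ln1 using ln0 by simp
  then show "0 \<le> 2 * (real K * (2 - 1) * ln (1 / (1 - \<rho>)) + ln 2) / (2 * \<rho> ^ K - 1)\<^sup>2" by simp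
  have "(1 / 2)\<^sup>2 \<le> (2 * \<rho> ^ K - 1)\<^sup>2" using c by (intro power_mono) auto
  then have "2 * (real K * (2 - 1) * ln (1 / (1 - \<rho>)) + ln 2) / (2 * \<rho> ^ K - 1)\<^sup>2 \<le> (7 / 2 * (real K * ln (real K))) / (1 / 2)\<^sup>2"
    using up nn ln0 by (intro frac_le) auto
  then show "2 * (real K * (2 - 1) * ln (1 / (1 - \<rho>)) + ln 2) / (2 * \<rho> ^ K - 1)\<^sup>2 \<le> 14 * (real K * ln (real K))"
    by (simp add: power2_eq_square)
qed

theorem theorem2:
  fixes d K :: nat
  assumes "CARD('d::finite) = d" and "CARD('k::finite) = K"
    and "d \<ge> 2" and "K \<ge> 2"
  shows "max (rho_v TYPE(('d, 2) tensor_power)) (rho_w TYPE(('d, 2) tensor_power)) \<le> 10 / sqrt (real d)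
    \<and> max (rho_v TYPE((2, 'k) tensor_power)) (rho_w TYPE((2, 'k) tensor_power))
        \<le> sqrt (48 * exp 1) * (sqrt (real K * ln (real K)) / 2 powr (real K / 2))"
proof
  note d = assms(1,3) and K = assms(2,4)
  define R where "R = 10 / sqrt (real d)"
  have bip: "rho_v TYPE(('d, 2) tensor_power) \<le> R \<and> rho_w TYPE(('d, 2) tensor_power) \<le> R"
  proof -
    have n: "real (CARD('d) ^ CARD(2)) = (real d)\<^sup>2" by (simp add: d)
    have d2: "(real d)\<^sup>2 \<ge> 4" using power_mono[of 2 "real d" 2] d by simp
    have "1 < (real d)\<^sup>2 * (3 / 4)" using d2 by simp
    moreover have "1 < 2 * (31 / 32 :: real) ^ CARD(2)" by (simp add: power2_eq_square)
    ultimately have bounds: "rho_v TYPE(('d, 2) tensor_power) \<le> 1" "rho_w TYPE(('d, 2) tensor_power) \<le> 1"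
      "rho_v TYPE(('d, 2) tensor_power) \<le> sqrt (((real d)\<^sup>2)\<^sup>2
         * (2 * (((real d)\<^sup>2 - 1) * ln (1 / (1 - 3 / 4)) + ln 2) / (((real d)\<^sup>2 * (3 / 4) - 1) / ((real d)\<^sup>2 - 1))\<^sup>2)
         * (2 * (2 * (real d - 1) * ln (1 / (1 - 31 / 32)) + ln 2) / (2 * (31 / 32)\<^sup>2 - 1)\<^sup>2) / (((real d)\<^sup>2)\<^sup>2 - 1)\<^sup>2)"
      "rho_w TYPE(('d, 2) tensor_power) \<le> sqrt (pi / 2 * (real d)\<^sup>2
         * (2 * (2 * (real d - 1) * ln (1 / (1 - 31 / 32)) + ln 2) / (2 * (31 / 32)\<^sup>2 - 1)\<^sup>2) / (((real d)\<^sup>2)\<^sup>2 - 1))"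
      using rho_bounds[where 'd='d and 'k=2 and \<rho>\<^sub>0="3 / 4" and \<rho>\<^sub>1="31 / 32", unfolded n] d
      by simp_all
    show ?thesis
    \<comment> \<open>Exactly for these d the bound 10 / sqrt d is at least 1.\<close>
    proof (cases "d \<le> 100")
      case True
      have "sqrt (real d) \<le> sqrt (10\<^sup>2)" using True by (intro real_sqrt_le_mono) simp
      then have "sqrt (real d) \<le> 10" by simp
      then have "1 \<le> R" using d by (simp add: R_def pos_le_divide_eq)
      then show ?thesis using bounds(1,2) by linarith
    next
      case False
      have R: "R = sqrt (100 / real d)" by (simp add: R_def real_sqrt_divide)
      have n_ge: "101 \<le> (real d)\<^sup>2"
      proof -
        have "(101 :: real) \<le> 101\<^sup>2" by simp
        also have "\<dots> \<le> (real d)\<^sup>2" using False by (intro power_mono) auto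
        finally show ?thesis .
      qed
      \<comment> \<open>The product 5.07 * 18.1 = 91.767 stays below 100 = 10^2.\<close>
      have B: "507 / 100 * (181 / 10 * real d) \<le> 100 / real d * (real d)\<^sup>2"
        using d by (simp add: power2_eq_square)
      have V: "0 \<le> 2 * (((real d)\<^sup>2 - 1) * ln (1 / (1 - 3 / 4)) + ln 2) / (((real d)\<^sup>2 * (3 / 4) - 1) / ((real d)\<^sup>2 - 1))\<^sup>2"
        using n_ge by (intro divide_nonneg_nonneg mult_nonneg_nonneg add_nonneg_nonneg) auto
      have d1: "real d \<ge> 1" using d by simp
      note num = ratio_bounds_numeric[OF n_ge V psd_moment_numeric[OF n_ge]
          bipartite_moment_numeric(2)[OF d1] bipartite_moment_numeric(1)[OF d1] B]
      show ?thesis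
        unfolding R using bounds(3,4) num[THEN real_sqrt_le_mono] by (auto intro: order_trans)
    qed
  qed
  then show "max (rho_v TYPE(('d, 2) tensor_power)) (rho_w TYPE(('d, 2) tensor_power)) \<le> 10 / sqrt (real d)"
    by (simp add: R_def)
  define Q where "Q = sqrt (48 * exp 1) * (sqrt (real K * ln (real K)) / 2 powr (real K / 2))"
  have Q: "Q = sqrt (48 * exp 1 * (real K * ln (real K)) / 2 ^ K)"
  proof -
    have "2 powr (real K / 2) = sqrt (2 ^ K)"
      by (simp add: powr_half_sqrt[symmetric] powr_realpow[symmetric] powr_powr)
    then show ?thesis by (simp add: Q_def real_sqrt_mult real_sqrt_divide)
  qed
  have ln0: "0 \<le> real K * ln (real K)" using K by simp
  have e2: "96 * (real K * ln (real K)) \<le> 48 * exp 1 * (real K * ln (real K))"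
    using exp_ge_add_one_self[of 1] ln0 by (intro mult_right_mono) auto
  have qubit: "rho_v TYPE((2, 'k) tensor_power) \<le> Q \<and> rho_w TYPE((2, 'k) tensor_power) \<le> Q"
  proof -
    define \<rho> where "\<rho> = 1 - 1 / (4 * real K)"
    define n :: real where "n = 2 ^ K"
    have n: "real (CARD(2) ^ CARD('k)) = n" by (simp add: K n_def)
    have n4: "n \<ge> 4" using power_increasing[of 2 K "2 :: real"] K by (simp add: n_def)
    have \<rho>: "0 < \<rho>" "\<rho> < 1" using K by (auto simp: \<rho>_def field_simps)
    have "1 + real K * (- (1 / (4 * real K))) \<le> (1 + (- (1 / (4 * real K)))) ^ K"
      using K by (intro Bernoulli_inequality) (simp add: field_simps)
    then have "1 < 2 * \<rho> ^ CARD('k)" using K by (simp add: \<rho>_def)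
    moreover have "1 < n * (3 / 4)" using n4 by simp
    ultimately have bounds: "rho_v TYPE((2, 'k) tensor_power) \<le> 1" "rho_w TYPE((2, 'k) tensor_power) \<le> 1"
      "rho_v TYPE((2, 'k) tensor_power) \<le> sqrt (n\<^sup>2
         * (2 * ((n - 1) * ln (1 / (1 - 3 / 4)) + ln 2) / ((n * (3 / 4) - 1) / (n - 1))\<^sup>2)
         * (2 * (real K * (2 - 1) * ln (1 / (1 - \<rho>)) + ln 2) / (2 * \<rho> ^ K - 1)\<^sup>2) / (n\<^sup>2 - 1)\<^sup>2)"
      "rho_w TYPE((2, 'k) tensor_power) \<le> sqrt (pi / 2 * n
         * (2 * (real K * (2 - 1) * ln (1 / (1 - \<rho>)) + ln 2) / (2 * \<rho> ^ K - 1)\<^sup>2) / (n\<^sup>2 - 1))"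
      using rho_bounds[where 'd=2 and 'k='k and \<rho>\<^sub>0="3 / 4" and \<rho>\<^sub>1=\<rho>, unfolded n] K \<rho>
      by simp_all
    show ?thesis
    \<comment> \<open>At K = 12 the claimed bound first drops below 1, and from there on the moment
      estimates take over.\<close>
    proof (cases "K \<le> 11")
      case True
      have "2 ^ K \<le> 48 * exp 1 * (real K * ln (real K))"
        using qubit_rhs_ge_one[OF K(2) True] e2 by linarith
      then have "1 \<le> Q" unfolding Q by (simp add: pos_le_divide_eq)
      then show ?thesis using bounds(1,2) by linarith
    next
      case False
      then have K12: "K \<ge> 12" by simp
      have n_ge: "n \<ge> 101"
        using power_increasing[of 12 K "2 :: real"] K12 by (simp add: n_def)
      \<comment> \<open>The product 5.07 * 14 = 70.98 stays below 96 \<le> 48 e.\<close>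
      have B: "507 / 100 * (14 * (real K * ln (real K))) \<le> 48 * exp 1 * (real K * ln (real K)) / 2 ^ K * n"
        using e2 ln0 by (simp add: n_def)
      have V: "0 \<le> 2 * ((n - 1) * ln (1 / (1 - 3 / 4)) + ln 2) / ((n * (3 / 4) - 1) / (n - 1))\<^sup>2"
        using n_ge by (intro divide_nonneg_nonneg mult_nonneg_nonneg add_nonneg_nonneg) auto
      note num = ratio_bounds_numeric[OF n_ge V psd_moment_numeric[OF n_ge]
          qubit_moment_numeric(2)[OF K12] qubit_moment_numeric(1)[OF K12] B, folded \<rho>_def]
      show ?thesis
        unfolding Q using bounds(3,4) num[THEN real_sqrt_le_mono] by (auto intro: order_trans)
    qed
  qed
  then show "max (rho_v TYPE((2, 'k) tensor_power)) (rho_w TYPE((2, 'k) tensor_power))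
      \<le> sqrt (48 * exp 1) * (sqrt (real K * ln (real K)) / 2 powr (real K / 2))"
    by (simp add: Q_def)
qed

end
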